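(* Let $F(x,t)=\sum_{d=1}^nf_d(x-a_dt)$ be a superposition of traveling waves with distinct speeds $a_1,\dots,a_n$, normalized so that $F$ is $\{0,1\}$-valued almost everywhere, with all profiles $f_d$ nonconstant. (i) $n=2$ is impossible; no boundedness of the profiles is required. (ii) $n=3$ occurs for every triple of distinct speeds $a_1<a_2<a_3$, in two forms. Sawtooth form: for any $\lambda_1,\lambda_3>0$ with $a_2=(\lambda_1a_1+\lambda_3a_3)/(\lambda_1+\lambda_3)$ and any phases $\rho_1,\rho_3$, the field $$F(x,t)=\{\lambda_1(x-a_1t)+\rho_1\}+\{\lambda_3(x-a_3t)+\rho_3\}-\{\lambda_1(x-a_1t)+\lambda_3(x-a_3t)+\rho_1+\rho_3\}$$ is $\{0,1\}$-valued. Step form: $F(x,t)=H(x-a_1t)+H(x-a_3t)-H(x-a_2t)$, together with its space-time translates $F(x-x_0,t-t_0)$ and its complement $1-F$, is $\{0,1\}$-valued; this is a three-line fan in space-time. The three fronts must pass through a common event, since $H(u-a)+H(v-b)-H(u+v-c)$ is two-valued only for $c=a+b$. In both forms the inverted wave travels at the intermediate speed. Conversely, every solution with $n=3$ either has non-integer profiles, in which case the wavenumbers and frequencies satisfy the exact resonance $k_1+k_2=k_3$, $\omega_1+\omega_2=\omega_3$ and, granting the floor rigidity conjecture (stated in the context), the solution is of sawtooth form; or it has integer-valued profiles, where the step form occurs and it is conjectured that it is the only one. (iii) Every odd $n$ occurs with step profiles: for speeds $a_1<\dots<a_n$ the alternating field of $n$ concurrent fronts $$F(x,t)=\frac12+\frac12\sum_{d=1}^n(-1)^{d-1}\,\mathrm{sign}(x-a_dt)$$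 is $\{0,1\}$-valued (the fan with $n$ lines), and no even $n$ occurs with finitely many fronts. For profiles which are not integer-valued, $n=4$ is impossible when the four functionals satisfy a single resonance in general position, and it is conjectured that $n\in\{1,3\}$ always; more precisely, that every solution with infinitely many fronts is of sawtooth form with $n=3$, and every solution with finitely many fronts is an alternating concurrent step field.
   Context: $\{\cdot\}$ is the fractional part and $H=\chi_{[0,\infty)}$ is the Heaviside function. A solution is a field $F$ as in the first sentence of the claim. In the paper's setting such a field arises as $2\chi_S-1=F$ for a planar set $S$, with bounded profiles; that $\{\pm1\}$-valued normalization differs from the $\{0,1\}$-valued one by the affine change $F\mapsto\frac12(F+1)$, absorbed into the profiles. Fronts are the jumps of the profiles, moving at the $n$ speeds; an event is a point of space-time. A fan is a union of alternate sectors among the $2k$ sectors cut out by an odd number $k$ of concurrent lines. "Integer-valued profiles" means integer-valued up to additive constants. Wavenumbers and frequencies: in the non-integer case with $n=3$ each wave has a linear phase $k(x-at)$, with wavenumber $k$ and frequency $\omega=ka$, where $a$ is the speed of the wave: $e^{2\pi if(s)}$ is a constant multiple of $e^{2\pi iks}$ for two of the profiles and of $e^{-2\pi iks}$ for the inverted one; in the resonance the waves are labeled so that the third is the inverted (sum) wave. In the sawtooth form the two non-inverted waves have wavenumbers $\lambda_1,\lambda_3$ and frequencies $\lambda_1a_1,\lambda_3a_3$. Floor rigidity conjecture: let $\mu\ne0$ and let $N_1,N_2,N_3:\mathbb{R}\to\mathbb{Z}$ be measurable, with $N_1-\mu x$, $N_2-\mu x$, $N_3+\mu x$ bounded, such that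 $N_1(u)+N_2(v)+N_3(u+v)$ takes only two values a.e.; then, up to additive integer constants, $N_1(x)=\lfloor\mu x+\rho_1\rfloor$, $N_2(x)=\lfloor\mu x+\rho_2\rfloor$, $N_3(x)=-\lfloor\mu x+\rho_1+\rho_2\rfloor$ for some $\rho_1,\rho_2$. Single resonance in general position, for four functionals $\ell_d$ (here $\ell_d=x-a_dt$): with nonzero coefficients $\mu_d$ the functionals $\mu_d\ell_d$ are pairwise non-proportional and satisfy $\sum_{d=1}^4\mu_d\ell_d=0$ and no other rational relation.
   Formalization: In the n=3 converse, "of sawtooth form" is read up to complement 1-F (a solution with negative wavenumbers), profiles are bounded there, for even n and for n=4, and the floor rigidity conjecture is taken for two consecutive integer values, being false for arbitrary two values. *)

theory Defs
  imports "HOL-Analysis.Analysis"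
begin

definition superposition ::
  "nat \<Rightarrow> (nat \<Rightarrow> real) \<Rightarrow> (nat \<Rightarrow> real \<Rightarrow> real) \<Rightarrow> real \<Rightarrow> real \<Rightarrow> real" where
  "superposition n a f x t = (\<Sum>d=1..n. f d (x - a d * t))"

text \<open>Since the field is only constrained almost everywhere, ``nonconstant'' has to be read as
  ``not almost everywhere equal to a constant''. Boundedness of the profiles is kept separate.\<close>

definition wave_solution :: "nat \<Rightarrow> (nat \<Rightarrow> real) \<Rightarrow> (nat \<Rightarrow> real \<Rightarrow> real) \<Rightarrow> bool" where
  "wave_solution n a f \<longleftrightarrow>
     n \<ge> 1 \<and> inj_on a {1..n} \<and>
     (\<forall>d\<in>{1..n}. f d \<in> borel_measurable lebesgue \<and> \<not> (\<exists>c. AE s in lebesgue. f d s = c)) \<and>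
     (AE p in lebesgue. superposition n a f (fst p) (snd p) \<in> {0, 1})"

definition bounded_profiles :: "nat \<Rightarrow> (nat \<Rightarrow> real \<Rightarrow> real) \<Rightarrow> bool" where
  "bounded_profiles n f \<longleftrightarrow> (\<forall>d\<in>{1..n}. bounded (range (f d)))"

definition integer_valued :: "(real \<Rightarrow> real) \<Rightarrow> bool" where
  "integer_valued g \<longleftrightarrow> (\<exists>c. AE s in lebesgue. g s - c \<in> \<int>)"

text \<open>Fronts are the jumps of the profiles. \<open>finitely_many_fronts\<close> does not ask the profile to be
  constant between its jumps; it is used together with boundedness.\<close>

definition finitely_many_fronts :: "(real \<Rightarrow> real) \<Rightarrow> bool" where
  "finitely_many_fronts g \<longleftrightarrow> finite {s. \<not> isCont g s}"

definition step_profile :: "(real \<Rightarrow> real) \<Rightarrow> bool" where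
  "step_profile g \<longleftrightarrow> (\<exists>J. finite J \<and> (\<forall>x y. x < y \<and> {x..y} \<inter> J = {} \<longrightarrow> g x = g y))"


definition sector :: "real \<times> real \<Rightarrow> real \<Rightarrow> real \<Rightarrow> (real \<times> real) set" where
  "sector p \<alpha> \<beta> = {p + r *\<^sub>R (cos \<phi>, sin \<phi>) | r \<phi>. 0 < r \<and> \<alpha> < \<phi> \<and> \<phi> < \<beta>}"

text \<open>The \<open>k\<close> lines through the vertex \<open>p\<close> have the \<open>2 k\<close> rays at the angles
  \<open>\<theta> 0 < \<dots> < \<theta> (2 k - 1)\<close>; opposite rays differ by \<open>pi\<close>, and
  \<open>\<theta> (2 k) = \<theta> 0 + 2 pi\<close> closes the circle.\<close>

definition fan :: "nat \<Rightarrow> (real \<times> real) set \<Rightarrow> bool" where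
  "fan k A \<longleftrightarrow> odd k \<and>
     (\<exists>p \<theta>. (\<forall>j<2 * k. \<theta> j < \<theta> (Suc j)) \<and> (\<forall>j\<le>k. \<theta> (j + k) = \<theta> j + pi) \<and>
        A = (\<Union>i<k. sector p (\<theta> (2 * i)) (\<theta> (2 * i + 1))))"

definition fan_field :: "nat \<Rightarrow> (real \<Rightarrow> real \<Rightarrow> real) \<Rightarrow> bool" where
  "fan_field k F \<longleftrightarrow>
     (\<exists>A. fan k A \<and> (AE p in lebesgue. F (fst p) (snd p) = indicator A p))"


definition heaviside :: "real \<Rightarrow> real" where
  "heaviside = indicator {0..}"

definition sawtooth_field ::
  "real \<Rightarrow> real \<Rightarrow> real \<Rightarrow> real \<Rightarrow> real \<Rightarrow> real \<Rightarrow> real \<Rightarrow> real \<Rightarrow> real" where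
  "sawtooth_field l1 l3 r1 r3 a1 a3 x t =
     frac (l1 * (x - a1 * t) + r1) + frac (l3 * (x - a3 * t) + r3)
     - frac (l1 * (x - a1 * t) + l3 * (x - a3 * t) + r1 + r3)"

text \<open>If \<open>a2\<close> is the mean of \<open>a1\<close> and \<open>a3\<close> with weights \<open>l1\<close> and \<open>l3\<close>, then
  \<open>l1 (x - a1 t) + l3 (x - a3 t) = (l1 + l3) (x - a2 t)\<close>: the inverted wave is wave 2.\<close>

definition sawtooth_profiles :: "real \<Rightarrow> real \<Rightarrow> real \<Rightarrow> real \<Rightarrow> nat \<Rightarrow> real \<Rightarrow> real" where
  "sawtooth_profiles l1 l3 r1 r3 d s =
     (if d = 1 then frac (l1 * s + r1)
      else if d = 3 then frac (l3 * s + r3)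
      else - frac ((l1 + l3) * s + r1 + r3))"

text \<open>The waves \<open>i\<close> and \<open>j\<close> are the non-inverted ones, \<open>m\<close> is the inverted one. The complement
  has to be admitted: it is again two-valued, and it is (almost everywhere) the same formula with
  both wavenumbers negated, hence not itself a sawtooth field with positive wavenumbers.\<close>

definition sawtooth_form ::
  "(nat \<Rightarrow> real) \<Rightarrow> nat \<Rightarrow> nat \<Rightarrow> nat \<Rightarrow> (real \<Rightarrow> real \<Rightarrow> real) \<Rightarrow> bool" where
  "sawtooth_form a i j m F \<longleftrightarrow>
     (\<exists>l1 l3 r1 r3. 0 < l1 \<and> 0 < l3 \<and> a m = (l1 * a i + l3 * a j) / (l1 + l3) \<and>
        ((AE p in lebesgue.
            F (fst p) (snd p) = sawtooth_field l1 l3 r1 r3 (a i) (a j) (fst p) (snd p)) \<or>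
         (AE p in lebesgue.
            F (fst p) (snd p) = 1 - sawtooth_field l1 l3 r1 r3 (a i) (a j) (fst p) (snd p))))"

definition step_field :: "(nat \<Rightarrow> real) \<Rightarrow> real \<Rightarrow> real \<Rightarrow> real" where
  "step_field a x t =
     heaviside (x - a 1 * t) + heaviside (x - a 3 * t) - heaviside (x - a 2 * t)"

text \<open>One front for each of three waves, wave \<open>d\<close> jumping on the line \<open>x - a d * t = c d\<close>,
  with wave 2 inverted.\<close>

definition front_profiles :: "(nat \<Rightarrow> real) \<Rightarrow> nat \<Rightarrow> real \<Rightarrow> real" where
  "front_profiles c d s = (if d = 2 then - heaviside (s - c d) else heaviside (s - c d))"

definition alternating_field :: "nat \<Rightarrow> (nat \<Rightarrow> real) \<Rightarrow> real \<Rightarrow> real \<Rightarrow> real" where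
  "alternating_field n a x t = 1/2 + 1/2 * (\<Sum>d=1..n. (-1) ^ (d - 1) * sgn (x - a d * t))"


definition linear_phase :: "(real \<Rightarrow> real) \<Rightarrow> real \<Rightarrow> bool" where
  "linear_phase g k \<longleftrightarrow>
     (\<exists>c::complex. AE s in lebesgue. cis (2 * pi * g s) = c * cis (2 * pi * k * s))"

definition single_resonance :: "(nat \<Rightarrow> real) \<Rightarrow> (nat \<Rightarrow> real) \<Rightarrow> bool" where
  "single_resonance a \<mu> \<longleftrightarrow>
     (\<forall>d\<in>{1..4}. \<mu> d \<noteq> 0) \<and>
     (\<forall>d\<in>{1..4}. \<forall>e\<in>{1..4}. d \<noteq> e \<longrightarrow>
        \<not> (\<exists>c. \<forall>x t. \<mu> d * (x - a d * t) = c * (\<mu> e * (x - a e * t)))) \<and>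
     (\<forall>x t. (\<Sum>d=1..4. \<mu> d * (x - a d * t)) = 0) \<and>
     (\<forall>q::nat \<Rightarrow> rat. (\<forall>x t. (\<Sum>d=1..4. of_rat (q d) * (\<mu> d * (x - a d * t))) = 0)
        \<longrightarrow> (\<forall>d\<in>{1..4}. q d = q 1))"

text \<open>The floor rigidity conjecture, as a proposition. The two values are taken to be consecutive
  integers, which is the case arising from a \<open>{0,1}\<close>-valued field. For values further apart
  the conclusion fails: \<open>2 \<lfloor>u/2\<rfloor> + 2 \<lfloor>v/2\<rfloor> - 2 \<lfloor>(u+v)/2\<rfloor>\<close> takes only the values \<open>-2\<close> and \<open>0\<close>
  (here \<open>\<mu> = 1\<close>). Restricting to consecutive values makes the conjecture a weaker assumption.\<close>

definition floor_rigidity :: bool where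
  "floor_rigidity \<longleftrightarrow>
     (\<forall>(\<mu>::real) (N1::real \<Rightarrow> int) (N2::real \<Rightarrow> int) (N3::real \<Rightarrow> int).
        \<mu> \<noteq> 0 \<and>
        N1 \<in> lebesgue \<rightarrow>\<^sub>M count_space UNIV \<and>
        N2 \<in> lebesgue \<rightarrow>\<^sub>M count_space UNIV \<and>
        N3 \<in> lebesgue \<rightarrow>\<^sub>M count_space UNIV \<and>
        bounded (range (\<lambda>x. of_int (N1 x) - \<mu> * x)) \<and>
        bounded (range (\<lambda>x. of_int (N2 x) - \<mu> * x)) \<and>
        bounded (range (\<lambda>x. of_int (N3 x) + \<mu> * x)) \<and>
        (\<exists>m. AE p in lebesgue. N1 (fst p) + N2 (snd p) + N3 (fst p + snd p) \<in> {m, m + 1})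
        \<longrightarrow>
        (\<exists>\<rho>1 \<rho>2 c1 c2 c3.
           (AE x in lebesgue. N1 x = \<lfloor>\<mu> * x + \<rho>1\<rfloor> + c1) \<and>
           (AE x in lebesgue. N2 x = \<lfloor>\<mu> * x + \<rho>2\<rfloor> + c2) \<and>
           (AE x in lebesgue. N3 x = - \<lfloor>\<mu> * x + \<rho>1 + \<rho>2\<rfloor> + c3)))"

end

theory Submission
  imports Defs "HOL-Analysis.Analysis"
begin

text \<open>
Write $e(x) = e^{2\pi i x}$. Since $F$ is integer-valued, $\prod_d e(f_d(x - a_d t)) = 1$. Shifting along
a line on which one factor is constant eliminates that factor, so for three waves the phases
$e(f_d)$ are linear exponentials and for four waves they are quadratic exponentials. The relations
between the coefficients give the resonance, and with the floor rigidity conjecture the sawtooth form.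

For four waves either no phase is trivial or all are, or else an integer-valued wave coexists with a
wave of nontrivial phase. In the first case each wave has a local variance bounded below
(because $f_d$ modulo 1 is equidistributed) and different waves are asymptotically
uncorrelated, so the four variances add up to more than $1/4$, the largest variance of a
two-valued function. In the last case, compare $F$ with the integer-valued wave along its
characteristics, on which the other waves average out: this makes the mean oscillation of second
differences of a wave with linear phase too small.

With finitely many fronts, a profile is constant near both ends, since iterated differences remove the
other waves. Evaluating $F$ along each characteristic far from all other fronts shows
that on either side of it the jumps of the other waves balance; for even $n$ this forces all jumps
between the two ends to vanish, so that all profiles are bumps of the same sign over a constant, and
two such bumps meet somewhere.
\<close>

section \<open>Null sets in the plane\<close>

text \<open>The number of waves enters the variance argument through a narrow margin. A profile that
  is equidistributed modulo 1 has variance at least 1/12. Three waves thus cost 1/4, exactly what a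
  two-valued field can carry, and the sawtooth attains it; four waves cost 1/3. Any bound above 1/16
  per wave excludes four, and two harmonics of the phase already give one. The obstacle is that a
  profile need not have a mean: only its phase is rigid, while its integer part is free. Variance is
  therefore measured against means over the blocks of a grid. These means are unknown, but a profile
  minus its block means has a bounded integral over every interval, and this controls all
  correlations, those with the block means of the other waves included. An integer-valued wave has
  trivial phase and no such variance bound. In the mixed case boundedness of the profiles is used
  instead: a shift changes an integral over an arbitrarily long interval only by a bounded
  amount.\<close>

lemma AE_real_ex:
  assumes "AE x in (lborel :: real measure). P x"
  obtains x where "P x"
proof -
  have "ae_filter (lborel :: real measure) \<noteq> bot"
    by (simp add: ae_filter_eq_bot_iff)
  with assms that show ?thesis
    using eventually_happens' by blast
qed

lemma pred_compose2:
  assumes "Measurable.pred (borel \<Otimes>\<^sub>M borel) (\<lambda>p. Q (fst p) (snd p))"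
    and "f \<in> borel_measurable M" "g \<in> borel_measurable M"
  shows "Measurable.pred M (\<lambda>x. Q (f x) (g x))"
  using measurable_compose[OF measurable_Pair[OF assms(2,3)] assms(1)] by simp

lemma AE_plane_iff:
  fixes Q :: "real \<Rightarrow> real \<Rightarrow> bool"
  assumes [measurable]: "Measurable.pred (borel \<Otimes>\<^sub>M borel) (\<lambda>p. Q (fst p) (snd p))"
  shows "(AE p in lborel. Q (fst p) (snd p)) \<longleftrightarrow> (AE x in lborel. AE y in lborel. Q x y)"
    and "(AE p in lborel. Q (fst p) (snd p)) \<longleftrightarrow> (AE y in lborel. AE x in lborel. Q x y)"
proof -
  have *: "{x \<in> space (lborel \<Otimes>\<^sub>M lborel). Q (fst x) (snd x)} \<in> sets (lborel \<Otimes>\<^sub>M lborel)"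
    by measurable
  show "(AE p in lborel. Q (fst p) (snd p)) \<longleftrightarrow> (AE x in lborel. AE y in lborel. Q x y)"
    using lborel_pair.AE_pair_iff[OF *] unfolding lborel_prod by simp
  then show "(AE p in lborel. Q (fst p) (snd p)) \<longleftrightarrow> (AE y in lborel. AE x in lborel. Q x y)"
    using lborel_pair.AE_commute[OF *] by simp
qed

lemma AE_swap:
  fixes Q :: "real \<Rightarrow> real \<Rightarrow> bool"
  assumes "Measurable.pred (borel \<Otimes>\<^sub>M borel) (\<lambda>p. Q (fst p) (snd p))"
  shows "(AE x in lborel. AE y in lborel. Q x y) \<longleftrightarrow> (AE y in lborel. AE x in lborel. Q x y)"
  using AE_plane_iff[OF assms] by simp

lemma AE_affine_iff:
  fixes P :: "real \<Rightarrow> bool"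
  assumes "c \<noteq> 0" "Measurable.pred borel P"
  shows "(AE x in lborel. P (t + c * x)) \<longleftrightarrow> (AE x in lborel. P x)"
proof
  assume *: "AE x in lborel. P (t + c * x)"
  have [measurable]: "Measurable.pred borel (\<lambda>x. P (t + c * x))"
    using assms(2) by measurable
  have "AE x in lborel. P (t + c * (- t / c + 1 / c * x))"
    by (rule AE_borel_affine[of "1 / c" "\<lambda>x. P (t + c * x)" "- t / c", OF _ _ *]) (use assms in auto)
  then show "AE x in lborel. P x"
    using assms(1) by (simp add: field_simps)
qed (rule AE_borel_affine[OF assms])

lemma AE_shift_iff:
  fixes P :: "real \<Rightarrow> bool"
  assumes "Measurable.pred borel P"
  shows "(AE x in lborel. P (x + t)) \<longleftrightarrow> (AE x in lborel. P x)"
  using AE_affine_iff[of 1 P t] assms by (simp add: add.commute)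

text \<open>For distinct speeds \<open>(x, t) \<mapsto> (x - a * t, x - b * t)\<close> is an
  invertible linear map and respects null sets. Fubini reduces this to changes of one variable:
  translate \<open>x\<close> for fixed \<open>t\<close>, then rescale \<open>t\<close> for fixed
  \<open>x\<close>. The arguments of two waves may thus be treated as independent variables.\<close>

lemma AE_characteristics:
  fixes Q :: "real \<Rightarrow> real \<Rightarrow> bool"
  assumes "a \<noteq> b" and [measurable]: "Measurable.pred (borel \<Otimes>\<^sub>M borel) (\<lambda>p. Q (fst p) (snd p))"
  shows "(AE p in lborel. Q (fst p - a * snd p) (fst p - b * snd p))
    \<longleftrightarrow> (AE u in lborel. AE v in lborel. Q u v)"
proof -
  have "(AE p in lborel. Q (fst p - a * snd p) (fst p - b * snd p))
      \<longleftrightarrow> (AE t in lborel. AE x in lborel. Q (x - a * t) (x - b * t))"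
    by (rule AE_plane_iff(2)) (rule pred_compose2[OF assms(2)]; measurable)
  also have "\<dots> \<longleftrightarrow> (AE t in lborel. AE x in lborel. Q x (x + (a - b) * t))"
  proof (rule AE_cong)
    fix t
    show "(AE x in lborel. Q (x - a * t) (x - b * t)) \<longleftrightarrow> (AE x in lborel. Q x (x + (a - b) * t))"
      using AE_affine_iff[of 1 "\<lambda>x. Q x (x + (a - b) * t)" "- a * t",
          OF _ pred_compose2[OF assms(2)]]
      by (simp add: algebra_simps)
  qed
  also have "\<dots> \<longleftrightarrow> (AE p in lborel. Q (fst p) (fst p + (a - b) * snd p))"
    by (rule AE_plane_iff(2)[symmetric]) (rule pred_compose2[OF assms(2)]; measurable)
  also have "\<dots> \<longleftrightarrow> (AE x in lborel. AE t in lborel. Q x (x + (a - b) * t))"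
    by (rule AE_plane_iff(1)) (rule pred_compose2[OF assms(2)]; measurable)
  also have "\<dots> \<longleftrightarrow> (AE u in lborel. AE v in lborel. Q u v)"
  proof (rule AE_cong)
    fix u
    have "Measurable.pred borel (\<lambda>v. Q u v)"
      by (rule pred_compose2[OF assms(2)]) simp_all
    then show "(AE t in lborel. Q u (u + (a - b) * t)) \<longleftrightarrow> (AE v in lborel. Q u v)"
      using assms(1) by (intro AE_affine_iff) simp_all
  qed
  finally show ?thesis .
qed

lemma AE_plane_translate:
  fixes Q :: "real \<Rightarrow> real \<Rightarrow> bool"
  assumes Q: "Measurable.pred (borel \<Otimes>\<^sub>M borel) (\<lambda>p. Q (fst p) (snd p))"
    and "AE p in lborel. Q (fst p) (snd p)"
  shows "AE p in lborel. Q (fst p + x0) (snd p + t0)"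
proof -
  have m1: "Measurable.pred borel (\<lambda>y. Q x y)" for x
    by (rule pred_compose2[OF Q]) simp_all
  have m2: "Measurable.pred borel (\<lambda>x. Q x y)" for y
    by (rule pred_compose2[OF Q]) simp_all
  have m3: "Measurable.pred (borel \<Otimes>\<^sub>M borel) (\<lambda>p. Q (fst p) (snd p + t0))"
    by (rule pred_compose2[OF Q]) simp_all
  have m4: "Measurable.pred (borel \<Otimes>\<^sub>M borel) (\<lambda>p. Q (fst p + x0) (snd p + t0))"
    by (rule pred_compose2[OF Q]) simp_all
  have "AE x in lborel. AE y in lborel. Q x y"
    using assms(2) AE_plane_iff(1)[OF Q] by blast
  then have "AE x in lborel. AE y in lborel. Q x (y + t0)"
    using AE_shift_iff[OF m1] by simp
  then have "AE y in lborel. AE x in lborel. Q x (y + t0)"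
    using AE_swap[of "\<lambda>x y. Q x (y + t0)", OF m3] by blast
  then have "AE y in lborel. AE x in lborel. Q (x + x0) (y + t0)"
    using AE_shift_iff[OF m2] by simp
  then show ?thesis
    using AE_plane_iff(2)[of "\<lambda>x y. Q (x + x0) (y + t0)", OF m4] by blast
qed

text \<open>\<open>P\<close> is not assumed measurable, so it is first replaced by the complement of
  a Borel null set, to which the change of variables applies.\<close>

lemma AE_plane_characteristic:
  fixes P :: "real \<Rightarrow> bool"
  assumes "AE s in lborel. P s"
  shows "AE p in lborel. P (fst p - a * snd p)"
proof -
  obtain N where N: "N \<in> null_sets lborel" "{x \<in> space lborel. \<not> P x} \<subseteq> N"
    using assms unfolding eventually_ae_filter by blast
  have [measurable]: "N \<in> sets borel" using N(1) by (simp add: null_sets_def)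
  have "AE s in lborel. s \<notin> N"
    by (rule AE_not_in[OF N(1)])
  then have ae: "AE u in lborel. AE v in lborel :: real measure. u \<notin> N"
    by (rule eventually_mono) (rule AE_I2, assumption)
  have meas: "Measurable.pred (borel \<Otimes>\<^sub>M borel) (\<lambda>p :: real \<times> real. fst p \<notin> N)"
    by measurable
  \<comment> \<open>The second speed is a dummy; any value other than \<open>a\<close> would
    do.\<close>
  have *: "AE p in lborel. fst p - a * snd p \<notin> N"
    using AE_characteristics[of a "a + 1" "\<lambda>u v. u \<notin> N", OF _ meas] ae by force
  show ?thesis
    using * by (rule eventually_mono) (use N(2) in \<open>simp add: subset_eq, blast\<close>)
qed

text \<open>Separation of variables: the two arguments are independent, so fixing a generic value of
  one of them makes the function of the other constant.\<close>

lemma separated_characteristics_const: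
  fixes \<phi> \<psi> :: "real \<Rightarrow> complex"
  assumes [measurable]: "\<phi> \<in> borel_measurable borel" "\<psi> \<in> borel_measurable borel" and "a \<noteq> b"
    and "AE p in lborel. \<phi> (fst p - a * snd p) = \<psi> (fst p - b * snd p)"
  obtains c where "AE u in lborel. \<phi> u = c"
proof -
  have "Measurable.pred (borel \<Otimes>\<^sub>M borel) (\<lambda>p. \<phi> (snd p) = \<psi> (fst p))"
    by measurable
  from AE_characteristics[of b a "\<lambda>u v. \<phi> v = \<psi> u", OF _ this] assms(3,4)
  have "AE u in lborel. AE v in lborel. \<phi> v = \<psi> u"
    by blast
  then obtain u where "AE v in lborel. \<phi> v = \<psi> u"
    using AE_real_ex by blast
  then show ?thesis
    by (rule that)
qed

section \<open>Additive functions and shifts\<close>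

text \<open>The defect \<open>L x = G x - x * G 1\<close> is additive and vanishes on the integers,
  so it has period 1; the local bound makes it bounded on the unit interval, hence everywhere. A
  bounded additive function is zero, because \<open>L (n * x) = n * L x\<close>.\<close>

lemma additive_bounded_imp_linear:
  fixes G :: "real \<Rightarrow> real"
  assumes add: "\<And>x y. G (x + y) = G x + G y"
    and "\<delta> > 0" and bd: "\<And>x. \<bar>x\<bar> < \<delta> \<Longrightarrow> \<bar>G x\<bar> \<le> M"
  shows "G x = x * G 1"
proof -
  define L where "L x = G x - x * G 1" for x
  have addL: "L (x + y) = L x + L y" for x y
    by (simp add: L_def add algebra_simps)
  have L0: "L 0 = 0" using addL[of 0 0] by simp
  have nL: "L (of_nat n * x) = of_nat n * L x" for n x
    by (induction n) (simp_all add: L0 addL algebra_simps)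
  have L1: "L 1 = 0" by (simp add: L_def)
  have Lneg: "L (- x) = - L x" for x
    using addL[of x "-x"] L0 by simp
  have Lint: "L (of_int k) = 0" for k
    by (cases k rule: int_cases2) (use nL[of _ 1] L1 Lneg in simp_all)
  \<comment> \<open>Division by \<open>m\<close> brings a fractional part into the neighbourhood of
    0 where the bound holds; additivity multiplies the value back by \<open>m\<close>.\<close>
  obtain m :: nat where m: "1 / of_nat m < \<delta>" "m > 0"
    using \<open>\<delta> > 0\<close> by (metis nat_approx_posE zero_less_Suc)
  define B where "B = of_nat m * (M + \<bar>G 1\<bar>)"
  have LB: "\<bar>L x\<bar> \<le> B" for x
  proof -
    define y where "y = frac x / of_nat m"
    have y: "0 \<le> y" "y < 1 / of_nat m" "y \<le> 1"
      using frac_ge_0[of x] frac_lt_1[of x] m(2)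
      by (auto simp: y_def field_simps) 
    have "L x = L (frac x)"
      using addL[of "frac x" "of_int \<lfloor>x\<rfloor>"] Lint by (simp add: frac_def)
    also have "\<dots> = of_nat m * L y"
      using m(2) nL[of m y] by (simp add: y_def)
    finally have "\<bar>L x\<bar> = of_nat m * \<bar>L y\<bar>" by (simp add: abs_mult)
    also have "\<bar>L y\<bar> \<le> M + \<bar>G 1\<bar>"
    proof -
      have "\<bar>G y\<bar> \<le> M" using y m by (intro bd) linarith
      moreover have "\<bar>y * G 1\<bar> \<le> 1 * \<bar>G 1\<bar>"
        unfolding abs_mult using y by (intro mult_right_mono) auto
      ultimately show ?thesis by (simp add: L_def)
    qed
    finally show ?thesis unfolding B_def by (simp add: mult_left_mono)
  qed
  have "L x = 0"
  proof (rule ccontr)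
    assume "L x \<noteq> 0"
    then obtain n :: nat where "of_nat n * \<bar>L x\<bar> > B"
      using reals_Archimedean3[of "\<bar>L x\<bar>"] by auto
    with LB[of "of_nat n * x"] show False by (simp add: nL abs_mult)
  qed
  then show ?thesis by (simp add: L_def)
qed

section \<open>Integrals over compact intervals and L1 continuity of translations\<close>

lemma set_integrable_bounded_Icc:
  fixes f :: "real \<Rightarrow> 'a::{banach, second_countable_topology}"
  assumes [measurable]: "f \<in> borel_measurable borel" and B: "\<And>x. norm (f x) \<le> B"
  shows "set_integrable lborel {a..b} f"
  unfolding set_integrable_def
  by (rule integrableI_bounded_set_indicator[of _ _ _ B]) (use B in \<open>auto simp: emeasure_lborel_Icc_eq\<close>)

lemma set_integral_shift:
  fixes f :: "real \<Rightarrow> 'a::{banach, second_countable_topology}"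
  shows "(LBINT s:{a..b}. f (s + h)) = (LBINT s:{a+h..b+h}. f s)"
  unfolding set_lebesgue_integral_def
  by (subst (2) lborel_integral_real_affine[of 1 _ h])
    (auto intro!: Bochner_Integration.integral_cong simp: add.commute indicator_def)

lemma set_integral_nonneg_subset:
  fixes f :: "real \<Rightarrow> real"
  assumes "set_integrable lborel B f" "A \<in> sets borel" "A \<subseteq> B" "\<And>x. f x \<ge> 0"
  shows "(LBINT x:A. f x) \<le> (LBINT x:B. f x)"
proof -
  have "set_integrable lborel A f"
    using set_integrable_subset[OF assms(1), of A] assms(2,3) by simp
  with assms show ?thesis
    unfolding set_lebesgue_integral_def set_integrable_def
    by (intro integral_mono) (auto simp: indicator_def)
qed

text \<open>A bounded measurable function is an a.e. limit of continuous ones. By dominated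
  convergence one of them is close to \<open>g\<close> in L1, and for it uniform continuity on a
  compact interval controls small shifts.\<close>

lemma L1_shift_continuous:
  fixes g :: "real \<Rightarrow> real"
  assumes [measurable]: "g \<in> borel_measurable borel" and B: "\<And>x. \<bar>g x\<bar> \<le> B" and "\<epsilon> > 0"
  obtains \<delta> where "\<delta> > 0" "\<And>h. \<bar>h\<bar> < \<delta> \<Longrightarrow> (LBINT s:{0..1}. \<bar>g (s + h) - g s\<bar>) < \<epsilon>"
proof -
  have "g measurable_on UNIV"
    by (rule lebesgue_measurable_imp_measurable_on_real) (auto intro: measurable_completion)
  then obtain N G where N: "negligible N" and cont: "\<And>n. continuous_on UNIV (G n)"
    and lim: "\<And>x. x \<notin> N \<Longrightarrow> (\<lambda>n. G n x) \<longlonglongrightarrow> g x"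
    unfolding measurable_on_def by auto
  have B0: "B \<ge> 0" using B[of 0] by linarith
  \<comment> \<open>Truncation to \<open>[-B, B]\<close> preserves the limit, since \<open>g\<close>
    takes its values there, and supplies the dominating function.\<close>
  define K where "K n x = max (-B) (min B (G n x))" for n x
  have contK: "continuous_on UNIV (K n)" for n
    unfolding K_def by (intro continuous_intros cont)
  have [measurable]: "K n \<in> borel_measurable borel" for n
    using contK by (intro borel_measurable_continuous_onI)
  have KB: "\<bar>K n x\<bar> \<le> B" for n x
    unfolding K_def using B0 by auto
  have limK: "(\<lambda>n. K n x) \<longlonglongrightarrow> g x" if "x \<notin> N" for x
  proof -
    have "(\<lambda>n. K n x) \<longlonglongrightarrow> max (-B) (min B (g x))"
      unfolding K_def by (intro tendsto_intros lim that)
    also have "max (-B) (min B (g x)) = g x" using B[of x] by auto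
    finally show ?thesis .
  qed
  have aeN: "AE x in lborel. x \<notin> N"
    using N unfolding negligible_iff_null_sets
    by (metis AE_completion_iff AE_not_in)
  \<comment> \<open>The window \<open>{-1..2}\<close> contains every translate of
    \<open>{0..1}\<close> by less than 1, so one estimate serves both \<open>g\<close> and its
    shift.\<close>
  have "(\<lambda>n. LBINT s:{-1..2}. \<bar>K n s - g s\<bar>) \<longlonglongrightarrow> (\<integral>s. (0::real) \<partial>(lborel::real measure))"
    unfolding set_lebesgue_integral_def
  proof (rule integral_dominated_convergence[where f="\<lambda>_. 0 :: real" and w="\<lambda>s::real. indicator {-1..2} s * (2 * B)"])
    show "integrable lborel (\<lambda>s::real. indicator {-1..2} s * (2 * B))"
      by (intro integrable_mult_left integrable_real_indicator) (auto simp: emeasure_lborel_Icc_eq)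
    show "AE x in lborel. (\<lambda>i. indicator {- 1..2::real} x *\<^sub>R \<bar>K i x - g x\<bar>) \<longlonglongrightarrow> 0"
      using aeN
    proof eventually_elim
      case (elim x)
      have "(\<lambda>i. indicator {- 1..2::real} x *\<^sub>R \<bar>K i x - g x\<bar>) \<longlonglongrightarrow> indicator {- 1..2::real} x *\<^sub>R \<bar>g x - g x\<bar>"
        by (intro tendsto_intros limK elim)
      then show ?case by simp
    qed
    show "AE x in lborel. norm (indicator {- 1..2::real} x *\<^sub>R \<bar>K i x - g x\<bar>) \<le> indicator {- 1..2::real} x * (2 * B)" for i
    proof (intro AE_I2)
      fix x show "norm (indicator {- 1..2::real} x *\<^sub>R \<bar>K i x - g x\<bar>) \<le> indicator {- 1..2::real} x * (2 * B)"
        using KB[of i x] B[of x] by (auto simp: indicator_def)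
    qed
  qed measurable
  then have "(\<lambda>n. LBINT s:{-1..2}. \<bar>K n s - g s\<bar>) \<longlonglongrightarrow> 0" by simp
  then have "eventually (\<lambda>n. (LBINT s:{-1..2}. \<bar>K n s - g s\<bar>) < \<epsilon> / 3) sequentially"
    using \<open>\<epsilon> > 0\<close> by (intro order_tendstoD) auto
  then obtain n where n: "(LBINT s:{-1..2}. \<bar>K n s - g s\<bar>) < \<epsilon> / 3"
    by (auto simp: eventually_sequentially)
  have "uniformly_continuous_on {-1..2} (K n)"
    by (intro compact_uniformly_continuous continuous_on_subset[OF contK]) auto
  then obtain \<delta>' where \<delta>': "\<delta>' > 0"
    "\<And>x y. x \<in> {-1..2} \<Longrightarrow> y \<in> {-1..2} \<Longrightarrow> dist y x < \<delta>' \<Longrightarrow> dist (K n y) (K n x) < \<epsilon> / 3"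
    unfolding uniformly_continuous_on_def using \<open>\<epsilon> > 0\<close> by (metis divide_pos_pos zero_less_numeral)
  show ?thesis
  proof (rule that[of "min \<delta>' 1"])
    show "min \<delta>' 1 > 0" using \<delta>' by auto
    fix h :: real assume h: "\<bar>h\<bar> < min \<delta>' 1"
    have KgB: "\<bar>K n x - g y\<bar> \<le> 2 * B" for x y
      using KB[of n x] B[of y] by linarith
    have gB: "\<bar>g x - g y\<bar> \<le> 2 * B" for x y
      using B[of x] B[of y] by linarith
    have int [intro]: "set_integrable lborel {a..b} (\<lambda>s. \<bar>K n (s + c) - g (s + c)\<bar>)" for a b c
      by (rule set_integrable_bounded_Icc[where B="2 * B"])
        (measurable, use KgB in simp)
    have near: "(LBINT s:{0..1}. \<bar>K n (s + c) - g (s + c)\<bar>) < \<epsilon> / 3" if "\<bar>c\<bar> < 1" for c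
    proof -
      have "(LBINT s:{0..1}. \<bar>K n (s + c) - g (s + c)\<bar>) = (LBINT s:{0+c..1+c}. \<bar>K n s - g s\<bar>)"
        by (rule set_integral_shift)
      also have "\<dots> \<le> (LBINT s:{-1..2}. \<bar>K n s - g s\<bar>)"
        using that int[of "-1" 2 0] by (intro set_integral_nonneg_subset) auto
      finally show ?thesis using n by linarith
    qed
    have "(LBINT s:{0..1}. \<bar>g (s + h) - g s\<bar>)
      \<le> (LBINT s:{0..1}. (\<bar>K n (s + h) - g (s + h)\<bar> + \<bar>K n (s + 0) - g (s + 0)\<bar>) + \<epsilon> / 3)"
    proof (rule set_integral_mono)
      show "set_integrable lborel {0..1} (\<lambda>s. \<bar>g (s + h) - g s\<bar>)"
        by (rule set_integrable_bounded_Icc[where B="2 * B"])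
          (measurable, use gB in simp)
      show "set_integrable lborel {0..1} (\<lambda>s. (\<bar>K n (s + h) - g (s + h)\<bar> + \<bar>K n (s + 0) - g (s + 0)\<bar>) + \<epsilon> / 3)"
      proof (rule set_integrable_bounded_Icc[where B="4 * B + \<epsilon>"])
        fix s show "norm ((\<bar>K n (s + h) - g (s + h)\<bar> + \<bar>K n (s + 0) - g (s + 0)\<bar>) + \<epsilon> / 3) \<le> 4 * B + \<epsilon>"
          using KgB[of "s + h" "s + h"] KgB[of "s + 0" "s + 0"] \<open>\<epsilon> > 0\<close> unfolding real_norm_def by linarith
      qed measurable
      fix s :: real assume "s \<in> {0..1}"
      then have "dist (K n (s + h)) (K n s) < \<epsilon> / 3"
        using h by (intro \<delta>') (auto simp: dist_real_def)
      then show "\<bar>g (s + h) - g s\<bar> \<le> (\<bar>K n (s + h) - g (s + h)\<bar> + \<bar>K n (s + 0) - g (s + 0)\<bar>) + \<epsilon> / 3"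
        using abs_triangle_ineq[of "K n (s + h) - K n s" "(g (s + h) - K n (s + h)) + (K n s - g s)"]
          abs_triangle_ineq[of "g (s + h) - K n (s + h)" "K n s - g s"]
        by (simp add: dist_real_def abs_minus_commute)
    qed
    also have "\<dots> = (LBINT s:{0..1}. \<bar>K n (s + h) - g (s + h)\<bar>)
        + (LBINT s:{0..1}. \<bar>K n (s + 0) - g (s + 0)\<bar>) + \<epsilon> / 3"
    proof -
      have "set_integrable lborel {0..1::real} (\<lambda>s. \<epsilon> / 3)"
        by (rule set_integrable_bounded_Icc[where B="\<epsilon> / 3"]) (use \<open>\<epsilon> > 0\<close> in auto)
      then show ?thesis
        using set_integral_add[OF int[of 0 1 h] int[of 0 1 0]]
        by (simp add: set_integral_add(2) set_integral_const)
    qed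
    also have "\<dots> < \<epsilon>"
      using near[of h] near[of 0] h by auto
    finally show "(LBINT s:{0..1}. \<bar>g (s + h) - g s\<bar>) < \<epsilon>" .
  qed
qed

section \<open>Linear and quadratic phases\<close>

lemma cis_measurable [measurable]: "cis \<in> borel_measurable borel"
  by (intro borel_measurable_continuous_onI continuous_intros)

lemma cnj_measurable [measurable]: "cnj \<in> borel_measurable borel"
  by (intro borel_measurable_continuous_onI continuous_intros)

lemma unimodular_mult_cnj: "norm z = 1 \<Longrightarrow> z * cnj z = 1"
  using complex_norm_square[of z] by simp

text \<open>A continuous character of the line lifts through the exponential. The lift is additive
  up to an integer multiple of \<open>2 * pi\<close> that varies continuously and is therefore
  constant; after subtracting its value at 0 it is additive and locally bounded, hence
  linear.\<close>

lemma character_real: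
  fixes c :: "real \<Rightarrow> complex"
  assumes mult: "\<And>x y. c (x + y) = c x * c y" and nrm: "\<And>x. norm (c x) = 1"
    and cont: "\<And>\<epsilon>. \<epsilon> > 0 \<Longrightarrow> \<exists>\<delta>>0. \<forall>h. \<bar>h\<bar> < \<delta> \<longrightarrow> norm (c h - 1) < \<epsilon>"
  obtains k where "\<And>x. c x = cis (k * x)"
proof -
  have cont': "continuous_on UNIV c"
  proof (rule continuous_onI)
    fix x :: real and \<epsilon> :: real assume "\<epsilon> > 0"
    then obtain \<delta> where \<delta>: "\<delta> > 0" "\<And>h. \<bar>h\<bar> < \<delta> \<Longrightarrow> norm (c h - 1) < \<epsilon>"
      using cont by metis
    have "dist (c y) (c x) \<le> \<epsilon>" if "dist y x < \<delta>" for y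
    proof -
      have "c y - c x = c x * (c (y - x) - 1)"
        using mult[of x "y - x"] by (simp add: algebra_simps)
      then have "dist (c y) (c x) = norm (c (y - x) - 1)"
        by (simp add: dist_norm norm_mult nrm)
      then show ?thesis using \<delta>(2)[of "y - x"] that by (simp add: dist_real_def)
    qed
    then show "\<exists>d>0. \<forall>x'\<in>UNIV. dist x' x < d \<longrightarrow> dist (c x') (c x) \<le> \<epsilon>"
      using \<delta>(1) by blast
  qed
  have "c x \<noteq> 0" for x using nrm[of x] by auto
  then obtain g where g: "continuous_on UNIV g" "\<And>x. c x = exp (g x)"
    using continuous_logarithm_on_contractible[OF cont' contractible_UNIV] by auto
  define G where "G x = Im (g x) - Im (g 0)" for x
  have Re0: "Re (g x) = 0" for x
    using nrm[of x] by (simp add: g(2))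
  have c_eq: "c x = cis (Im (g x))" for x
    by (simp add: g(2) exp_eq_polar Re0)
  have c0: "c 0 = 1"
    using mult[of 0 0] nrm[of 0] by auto
  have addG: "G (x + y) = G x + G y" for x y
  proof -
    define r where "r y = (Im (g (x + y)) - Im (g x) - Im (g y)) / (2 * pi)" for y
    have Ints: "r y \<in> \<int>" for y
    proof -
      have "cis (Im (g (x + y)) - Im (g x) - Im (g y)) = 1"
        using mult[of x y] nrm[of x] nrm[of y] unfolding c_eq
        by (simp add: cis_divide[symmetric] divide_simps cis_neq_zero)
      then obtain n :: int where "Im (g (x + y)) - Im (g x) - Im (g y) = of_int n * (2 * pi)"
        by (auto simp: complex_eq_iff cos_one_2pi_int)
      then show ?thesis by (simp add: r_def)
    qed
    have gap: "1 \<le> norm (r y - r x)" if "r y \<noteq> r x" for x y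
      using that Ints Ints_nonzero_abs_ge1[of "r y - r x"] by (simp add: Ints_diff)
    have "continuous_on UNIV r"
      unfolding r_def
      by (intro continuous_intros continuous_on_compose2[OF g(1)]) auto
    then have "r constant_on UNIV"
      by (rule continuous_discrete_range_constant[OF connected_UNIV]) (use gap zero_less_one in blast)
    then have "r y = r 0"
      unfolding constant_on_def by auto
    then have "Im (g (x + y)) - Im (g x) - Im (g y) = - Im (g 0)"
      unfolding r_def using pi_gt_zero by (simp add: divide_simps split: if_splits)
    then show ?thesis by (simp add: G_def)
  qed
  have "continuous_on UNIV G"
    unfolding G_def by (intro continuous_intros g(1))
  then have "\<exists>\<delta>>0. \<forall>h. dist h 0 < \<delta> \<longrightarrow> dist (G h) (G 0) < 1"
    unfolding continuous_on_iff by (metis UNIV_I zero_less_one)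
  then obtain \<delta> where \<delta>: "\<delta> > 0" "\<And>h. \<bar>h\<bar> < \<delta> \<Longrightarrow> \<bar>G h\<bar> \<le> 1"
    by (auto simp: dist_real_def G_def less_imp_le)
  have "G x = x * G 1" for x
    by (rule additive_bounded_imp_linear[OF addG \<delta>])
  moreover have "c x = cis (G x)" for x
    using c0 by (simp add: c_eq G_def cis_divide[symmetric])
  ultimately have "c x = cis (G 1 * x)" for x
    by (metis mult.commute)
  then show ?thesis
    by (rule that)
qed

text \<open>Fubini turns "for every shift, at almost every point" into a single base point
  \<open>s\<close> that is good for almost every shift; then \<open>W\<close> equals
  \<open>W s\<close> almost everywhere.\<close>

lemma shift_invariant_const:
  fixes W :: "real \<Rightarrow> complex"
  assumes [measurable]: "W \<in> borel_measurable borel" and "\<And>h. AE s in lborel. W (s + h) = W s"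
  obtains c where "AE s in lborel. W s = c"
proof -
  have "AE h in lborel. AE s in lborel. W (s + h) = W s"
    using assms(2) by simp
  moreover have "Measurable.pred (borel \<Otimes>\<^sub>M borel) (\<lambda>p. W (snd p + fst p) = W (snd p))"
    by measurable
  ultimately have "AE s in lborel. AE h in lborel. W (s + h) = W s"
    using AE_swap[of "\<lambda>h s. W (s + h) = W s"] by blast
  then obtain s where s: "AE h in lborel. W (s + h) = W s"
    by (rule AE_real_ex)
  have "AE h in lborel. W h = W s"
    using AE_affine_iff[of 1 "\<lambda>h. W h = W s" s] s by simp
  then show ?thesis by (rule that)
qed

text \<open>If \<open>E (s + h) = c h * E s\<close>, the integral is \<open>c h\<close> itself. So
  L1 continuity of translations becomes continuity of the factor \<open>c\<close> at 0.\<close>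

lemma autocorrelation_near_one:
  fixes E :: "real \<Rightarrow> complex"
  assumes [measurable]: "E \<in> borel_measurable borel" and nrm: "\<And>s. norm (E s) = 1" and "\<epsilon> > 0"
  shows "\<exists>\<delta>>0. \<forall>h. \<bar>h\<bar> < \<delta> \<longrightarrow> norm ((LBINT s:{0..1}. E (s + h) * cnj (E s)) - 1) < \<epsilon>"
proof -
  have Re1: "\<bar>Re (E s)\<bar> \<le> 1" and Im1: "\<bar>Im (E s)\<bar> \<le> 1" for s
    using abs_Re_le_cmod[of "E s"] abs_Im_le_cmod[of "E s"] nrm[of s] by simp_all
  obtain d1 where d1: "d1 > 0" "\<And>h. \<bar>h\<bar> < d1 \<Longrightarrow> (LBINT s:{0..1}. \<bar>Re (E (s + h)) - Re (E s)\<bar>) < \<epsilon> / 2"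
    using L1_shift_continuous[of "\<lambda>s. Re (E s)" 1 "\<epsilon> / 2"] Re1 \<open>\<epsilon> > 0\<close> by auto
  obtain d2 where d2: "d2 > 0" "\<And>h. \<bar>h\<bar> < d2 \<Longrightarrow> (LBINT s:{0..1}. \<bar>Im (E (s + h)) - Im (E s)\<bar>) < \<epsilon> / 2"
    using L1_shift_continuous[of "\<lambda>s. Im (E s)" 1 "\<epsilon> / 2"] Im1 \<open>\<epsilon> > 0\<close> by auto
  have "norm ((LBINT s:{0..1}. E (s + h) * cnj (E s)) - 1) < \<epsilon>" if "\<bar>h\<bar> < min d1 d2" for h
  proof -
    have unit: "E s * cnj (E s) = 1" for s
      using nrm[of s] by (simp add: unimodular_mult_cnj)
    have nE: "norm (E (s + h) - E s) \<le> 2" for s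
      using norm_triangle_ineq4[of "E (s + h)" "E s"] nrm by simp
    have i1: "set_integrable lborel {0..1} (\<lambda>s. E (s + h) * cnj (E s))"
      by (rule set_integrable_bounded_Icc[where B=1]) (simp_all add: norm_mult nrm)
    have i2: "set_integrable lborel {0..1::real} (\<lambda>s. 1 :: complex)"
      by (rule set_integrable_bounded_Icc[where B=1]) simp_all
    have i3: "set_integrable lborel {0..1} (\<lambda>s. norm (E (s + h) - E s))"
      by (rule set_integrable_bounded_Icc[where B=2]) (use nE in simp_all)
    have i4: "set_integrable lborel {0..1} (\<lambda>s. \<bar>Re (E (s + h)) - Re (E s)\<bar>)"
      by (rule set_integrable_bounded_Icc[where B=2])
        (use nE abs_Re_le_cmod[of "E (_ + h) - E _"] order_trans in \<open>simp_all, blast\<close>)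
    have i5: "set_integrable lborel {0..1} (\<lambda>s. \<bar>Im (E (s + h)) - Im (E s)\<bar>)"
      by (rule set_integrable_bounded_Icc[where B=2])
        (use nE abs_Im_le_cmod[of "E (_ + h) - E _"] order_trans in \<open>simp_all, blast\<close>)
    have "(LBINT s:{0..1}. E (s + h) * cnj (E s)) - 1
        = (LBINT s:{0..1}. E (s + h) * cnj (E s)) - (LBINT s:{0..1::real}. 1)"
      by (simp add: set_integral_const)
    also have "\<dots> = (LBINT s:{0..1}. E (s + h) * cnj (E s) - 1)"
      using set_integral_diff(2)[OF i1 i2] by simp
    also have "norm \<dots> \<le> (LBINT s:{0..1}. norm (E (s + h) * cnj (E s) - 1))"
      using set_integral_diff(1)[OF i1 i2] by (rule set_integral_norm_bound)
    also have "\<dots> = (LBINT s:{0..1}. norm (E (s + h) - E s))"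
    proof -
      have "E (s + h) * cnj (E s) - 1 = (E (s + h) - E s) * cnj (E s)" for s
        by (simp add: algebra_simps unit)
      then show ?thesis by (simp add: norm_mult nrm)
    qed
    also have "\<dots> \<le> (LBINT s:{0..1}. \<bar>Re (E (s + h)) - Re (E s)\<bar> + \<bar>Im (E (s + h)) - Im (E s)\<bar>)"
      using i3 set_integral_add(1)[OF i4 i5]
      by (rule set_integral_mono) (use cmod_le in \<open>metis minus_complex.simps\<close>)
    also have "\<dots> < \<epsilon>"
      using set_integral_add(2)[OF i4 i5] d1(2)[of h] d2(2)[of h] that by simp
    finally show ?thesis .
  qed
  with d1(1) d2(1) show ?thesis
    by (intro exI[of _ "min d1 d2"]) auto
qed

text \<open>The shift ratio is multiplicative in the shift and continuous, hence a character;
  dividing \<open>E\<close> by it leaves a shift-invariant function.\<close>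

lemma shift_ratio_const_imp_linear_phase:
  fixes E :: "real \<Rightarrow> complex"
  assumes [measurable]: "E \<in> borel_measurable borel" and nrm: "\<And>s. norm (E s) = 1"
    and shift: "\<And>h. \<exists>c. AE s in lborel. E (s + h) = c * E s"
  obtains \<gamma> k where "norm \<gamma> = 1" "AE s in lborel. E s = \<gamma> * cis (k * s)"
proof -
  obtain c where c: "\<And>h. AE s in lborel. E (s + h) = c h * E s"
    using shift by metis
  have nc: "norm (c h) = 1" for h
  proof -
    obtain s where "E (s + h) = c h * E s" by (rule AE_real_ex[OF c[of h]])
    then have "norm (E (s + h)) = norm (c h) * norm (E s)" by (simp add: norm_mult)
    then show ?thesis by (simp add: nrm)
  qed
  have mult: "c (x + y) = c x * c y" for x y
  proof -
    have "AE s in lborel. E (s + x + y) = c y * E (s + x)"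
      using c[of y] by (subst AE_shift_iff[where P="\<lambda>s. E (s + y) = c y * E s"]) measurable
    with c[of "x + y"] c[of x] have "AE s in lborel. c (x + y) * E s = c x * c y * E s"
      by eventually_elim (simp add: add.assoc mult.commute mult.left_commute)
    then obtain s where "c (x + y) * E s = c x * c y * E s" by (rule AE_real_ex)
    moreover have "E s \<noteq> 0" using nrm[of s] by auto
    ultimately show ?thesis by simp
  qed
  have cont: "\<exists>\<delta>>0. \<forall>h. \<bar>h\<bar> < \<delta> \<longrightarrow> norm (c h - 1) < \<epsilon>" if "\<epsilon> > 0" for \<epsilon>
  proof -
    have "(LBINT s:{0..1}. E (s + h) * cnj (E s)) = c h" for h
    proof -
      have "AE s in lborel. E (s + h) * cnj (E s) = c h"
        using c[of h]
      proof eventually_elim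
        case (elim s)
        have "E s * cnj (E s) = 1" using nrm[of s] by (simp add: unimodular_mult_cnj)
        then show ?case by (simp add: elim mult.assoc)
      qed
      then have "(LBINT s:{0..1}. E (s + h) * cnj (E s)) = (LBINT s:{0..1::real}. c h)"
        by (intro set_lebesgue_integral_cong_AE) auto
      then show ?thesis by (simp add: set_integral_const)
    qed
    then show ?thesis
      using autocorrelation_near_one[of E \<epsilon>] nrm that by simp
  qed
  obtain k where k: "\<And>x. c x = cis (k * x)"
    using character_real[of c, OF mult nc cont] by blast
  define W where "W s = E s * cis (- k * s)" for s
  have [measurable]: "W \<in> borel_measurable borel"
    unfolding W_def by measurable
  have "AE s in lborel. W (s + h) = W s" for h
    using c[of h]
    by eventually_elim (simp add: W_def k algebra_simps cis_mult)
  then obtain \<gamma> where \<gamma>: "AE s in lborel. W s = \<gamma>"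
    using shift_invariant_const[of W] by auto
  show ?thesis
  proof
    have "norm (W s) = 1" for s by (simp add: W_def norm_mult nrm)
    moreover obtain s where "W s = \<gamma>" by (rule AE_real_ex[OF \<gamma>])
    ultimately show "norm \<gamma> = 1" by metis
    show "AE s in lborel. E s = \<gamma> * cis (k * s)"
      using \<gamma> by eventually_elim (auto simp: W_def algebra_simps cis_mult)
  qed
qed


lemma cis_const_imp_zero:
  assumes "AE s in lborel. cis (\<kappa> * s) = c"
  shows "\<kappa> = 0"
proof (rule ccontr)
  assume k: "\<kappa> \<noteq> 0"
  have "AE s in lborel. cis (\<kappa> * (s + 1 / \<kappa>)) = c"
    using assms by (subst AE_shift_iff) simp_all
  with assms have "AE s in lborel. cis (\<kappa> * s) * cis 1 = cis (\<kappa> * s)"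
  proof eventually_elim
    case (elim s)
    have "\<kappa> * (s + 1 / \<kappa>) = \<kappa> * s + 1" using k by (simp add: field_simps)
    then have "cis (\<kappa> * s) * cis 1 = cis (\<kappa> * (s + 1 / \<kappa>))" by (simp add: cis_mult)
    with elim show ?case by metis
  qed
  then obtain s where "cis (\<kappa> * s) * cis 1 = cis (\<kappa> * s)" by (rule AE_real_ex)
  then have "cis 1 = 1" by simp
  then have "sin (1 :: real) = 0" by (metis cis.simps(2) one_complex.simps(2))
  moreover have "sin (1 :: real) > 0" using pi_gt3 by (intro sin_gt_zero) auto
  ultimately show False by simp
qed

text \<open>Integration by parts with the primitive \<open>e y / (\<i> * K)\<close>: its derivative
  is \<open>e y\<close> plus a remainder of size \<open>2 * |q| * y / |K|\<close> caused by the
  quadratic term. The bound is small once \<open>K\<close>, the frequency at the left end, is large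
  compared with \<open>1 + |q| * r^2\<close>.\<close>

lemma oscillatory_integral_bound:
  assumes "K \<noteq> 0" "0 \<le> r"
  shows "norm (LBINT y:{0..r}. cis (K * y + q * y\<^sup>2)) \<le> 2 / \<bar>K\<bar> + 2 * \<bar>q\<bar> * r\<^sup>2 / \<bar>K\<bar>"
proof -
  define e where "e y = cis (K * y + q * y\<^sup>2)" for y :: real
  define R where "R y = complex_of_real (2 * q / K * y) * e y" for y
  have [measurable]: "e \<in> borel_measurable borel"
    unfolding e_def by (intro borel_measurable_continuous_onI continuous_intros)
  have [measurable]: "R \<in> borel_measurable borel"
    unfolding R_def by measurable
  have ne: "norm (e y) = 1" for y by (simp add: e_def)
  have nR: "norm (R y) \<le> 2 * \<bar>q\<bar> * r / \<bar>K\<bar>" if "y \<in> {0..r}" for y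
  proof -
    have "norm (R y) = \<bar>2 * q / K * y\<bar>" unfolding R_def norm_mult ne norm_of_real by simp
    also have "\<dots> = 2 * \<bar>q\<bar> / \<bar>K\<bar> * y" using that by (simp add: abs_mult)
    also have "\<dots> \<le> 2 * \<bar>q\<bar> / \<bar>K\<bar> * r" using that by (intro mult_left_mono) auto
    finally show ?thesis by simp
  qed
  have cR: "continuous_on {0..r} R"
    unfolding R_def e_def by (intro continuous_intros)
  have ie: "set_integrable lborel {0..r} e"
    by (rule set_integrable_bounded_Icc[where B=1]) (simp_all add: ne)
  have iR: "set_integrable lborel {0..r} R"
    unfolding set_integrable_def by (rule borel_integrable_compact[OF compact_Icc cR])
  define F where "F y = e y / (\<i> * K)" for y
  have "(F has_vector_derivative (e y + R y)) (at y within {0..r})" for y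
  proof -
    have "((\<lambda>y. K * y + q * y\<^sup>2) has_derivative (\<lambda>t. t * (K + 2 * q * y))) (at y within {0..r})"
      by (auto intro!: derivative_eq_intros simp: algebra_simps)
    from has_derivative_cis[OF this]
    have "(e has_vector_derivative (K + 2 * q * y) *\<^sub>R (\<i> * e y)) (at y within {0..r})"
      unfolding has_vector_derivative_def e_def by (simp add: mult.commute)
    then have "(F has_vector_derivative ((K + 2 * q * y) *\<^sub>R (\<i> * e y)) / (\<i> * K)) (at y within {0..r})"
      unfolding F_def by (rule has_vector_derivative_divide)
    moreover have "((K + 2 * q * y) *\<^sub>R (\<i> * e y)) / (\<i> * K) = e y + R y"
      using assms(1) by (simp add: R_def scaleR_conv_of_real field_simps)
    ultimately show ?thesis by simp
  qed
  then have "(LBINT y:{0..r}. e y + R y) = F r - F 0"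
    unfolding set_lebesgue_integral_def
    by (intro integral_FTC_Icc assms continuous_intros cR) (auto simp: e_def intro!: continuous_intros)
  then have "(LBINT y:{0..r}. e y) = F r - F 0 - (LBINT y:{0..r}. R y)"
    using set_integral_add(2)[OF ie iR] by (simp add: algebra_simps)
  also have "norm \<dots> \<le> norm (F r) + norm (F 0) + norm (LBINT y:{0..r}. R y)"
    using norm_triangle_ineq4[of "F r - F 0" "LBINT y:{0..r}. R y"] norm_triangle_ineq4[of "F r" "F 0"] by linarith
  also have "norm (LBINT y:{0..r}. R y) \<le> (LBINT y:{0..r}. norm (R y))"
    using iR by (rule set_integral_norm_bound)
  also have "\<dots> \<le> (LBINT y:{0..r}. 2 * \<bar>q\<bar> * r / \<bar>K\<bar>)"
    using iR nR set_integrable_bounded_Icc[of "\<lambda>_. 2 * \<bar>q\<bar> * r / \<bar>K\<bar>" "\<bar>2 * \<bar>q\<bar> * r / \<bar>K\<bar>\<bar>" 0 r]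
    by (intro set_integral_mono set_integrable_norm) auto
  finally show ?thesis
    using assms by (simp add: e_def F_def norm_divide norm_mult set_integral_const power2_eq_square mult_ac)
qed

text \<open>The frequency \<open>\<kappa> h\<close> of the shift ratio is additive in
  \<open>h\<close>. Near \<open>h = 0\<close> the autocorrelation is close to 1, which a fast
  oscillation would contradict; so \<kappa> is bounded there and hence linear. Removing the matching
  quadratic phase leaves a constant shift ratio.\<close>

lemma shift_ratio_linear_imp_quadratic_phase:
  fixes E :: "real \<Rightarrow> complex"
  assumes [measurable]: "E \<in> borel_measurable borel" and nrm: "\<And>s. norm (E s) = 1"
    and shift: "\<And>h. \<exists>c \<kappa>. AE s in lborel. E (s + h) = c * cis (\<kappa> * s) * E s"
  obtains \<gamma> q k where "norm \<gamma> = 1" "AE s in lborel. E s = \<gamma> * cis (q * s\<^sup>2 + k * s)"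
proof -
  obtain c \<kappa> where c: "\<And>h. AE s in lborel. E (s + h) = c h * cis (\<kappa> h * s) * E s"
    using shift by metis
  have En: "E s \<noteq> 0" and unit: "E s * cnj (E s) = 1" for s
    using nrm[of s] by (auto simp: unimodular_mult_cnj)
  have nc: "norm (c h) = 1" for h
  proof -
    obtain s where "E (s + h) = c h * cis (\<kappa> h * s) * E s" by (rule AE_real_ex[OF c[of h]])
    then have "norm (E (s + h)) = norm (c h) * norm (E s)" by (simp add: norm_mult)
    then show ?thesis by (simp add: nrm)
  qed
  have add: "\<kappa> (x + y) = \<kappa> x + \<kappa> y" for x y
  proof -
    have [measurable]: "(\<lambda>s. cis (\<kappa> y * s)) \<in> borel_measurable borel"
      by (intro borel_measurable_continuous_onI continuous_intros)
    have "AE s in lborel. E (s + x + y) = c y * cis (\<kappa> y * (s + x)) * E (s + x)"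
      using c[of y] by (subst AE_shift_iff[where P="\<lambda>s. E (s + y) = c y * cis (\<kappa> y * s) * E s"]) measurable
    with c[of "x + y"] c[of x]
    have "AE s in lborel. cis ((\<kappa> (x + y) - \<kappa> x - \<kappa> y) * s) = c x * c y * cis (\<kappa> y * x) / c (x + y)"
    proof eventually_elim
      case (elim s)
      have "c (x + y) * cis (\<kappa> (x + y) * s) = c x * c y * cis (\<kappa> y * x) * (cis (\<kappa> x * s) * cis (\<kappa> y * s))"
        using elim En[of s] by (simp add: add.assoc cis_mult algebra_simps)
      moreover have "cis (\<kappa> (x + y) * s)
          = cis ((\<kappa> (x + y) - \<kappa> x - \<kappa> y) * s) * (cis (\<kappa> x * s) * cis (\<kappa> y * s))"
        by (simp add: cis_mult algebra_simps)
      ultimately have "(c (x + y) * cis ((\<kappa> (x + y) - \<kappa> x - \<kappa> y) * s)) * (cis (\<kappa> x * s) * cis (\<kappa> y * s))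
          = (c x * c y * cis (\<kappa> y * x)) * (cis (\<kappa> x * s) * cis (\<kappa> y * s))"
        by (metis mult.assoc)
      then have "c (x + y) * cis ((\<kappa> (x + y) - \<kappa> x - \<kappa> y) * s) = c x * c y * cis (\<kappa> y * x)"
        unfolding mult_cancel_right by (auto simp: cis_neq_zero)
      moreover have "c (x + y) \<noteq> 0" using nc[of "x + y"] by auto
      ultimately show ?case by (metis nonzero_mult_div_cancel_left)
    qed
    from cis_const_imp_zero[OF this] show ?thesis by simp
  qed
  obtain \<delta> where \<delta>: "\<delta> > 0" "\<And>h. \<bar>h\<bar> < \<delta> \<Longrightarrow> norm ((LBINT s:{0..1}. E (s + h) * cnj (E s)) - 1) < 1 / 2"
    using autocorrelation_near_one[of E "1 / 2"] nrm by auto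
  \<comment> \<open>The autocorrelation has modulus at least 1/2, the oscillatory integral at most
    \<open>2 / |\<kappa> h|\<close>; hence the constant 4.\<close>
  have bd: "\<bar>\<kappa> h\<bar> \<le> 4" if "\<bar>h\<bar> < \<delta>" for h
  proof (cases "\<kappa> h = 0")
    case False
    have [measurable]: "(\<lambda>s. c h * cis (\<kappa> h * s)) \<in> borel_measurable borel"
      by (intro borel_measurable_continuous_onI continuous_intros)
    have "AE s in lborel. E (s + h) * cnj (E s) = c h * cis (\<kappa> h * s)"
      using c[of h] by eventually_elim (simp add: mult.assoc unit)
    then have "(LBINT s:{0..1}. E (s + h) * cnj (E s)) = (LBINT s:{0..1}. c h * cis (\<kappa> h * s))"
      by (intro set_lebesgue_integral_cong_AE) auto
    also have "\<dots> = c h * (LBINT s:{0..1}. cis (\<kappa> h * s))" by simp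
    finally have eq: "norm (LBINT s:{0..1}. E (s + h) * cnj (E s)) = norm (LBINT s:{0..1}. cis (\<kappa> h * s))"
      by (simp add: norm_mult nc)
    have "norm (LBINT s:{0..1}. cis (\<kappa> h * s)) \<le> 2 / \<bar>\<kappa> h\<bar>"
      using oscillatory_integral_bound[of "\<kappa> h" 1 0] False by simp
    moreover have "norm (LBINT s:{0..1}. E (s + h) * cnj (E s)) \<ge> 1 / 2"
      using \<delta>(2)[OF that] norm_triangle_ineq2[of 1 "LBINT s:{0..1}. E (s + h) * cnj (E s)"]
      by (simp add: norm_minus_commute)
    ultimately have "1 / 2 \<le> 2 / \<bar>\<kappa> h\<bar>" using eq by linarith
    then show ?thesis using False by (simp add: field_simps)
  qed simp
  define q where "q = \<kappa> 1"
  have lin: "\<kappa> h = h * q" for h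
    unfolding q_def by (rule additive_bounded_imp_linear[OF add \<delta>(1) bd])
  \<comment> \<open>Shifting \<open>q / 2 * s^2\<close> by \<open>h\<close> produces the linear term
    \<open>q * h * s\<close>, which is exactly \<open>\<kappa> h * s\<close>.\<close>
  define W where "W s = E s * cis (- (q / 2 * s\<^sup>2))" for s
  have Wm: "W \<in> borel_measurable borel"
    unfolding W_def by measurable
  have "AE s in lborel. W (s + h) = (c h * cis (- (q / 2 * h\<^sup>2))) * W s" for h
    using c[of h]
  proof eventually_elim
    case (elim s)
    have "cis (\<kappa> h * s) * cis (- (q / 2 * (s + h)\<^sup>2)) = cis (- (q / 2 * h\<^sup>2)) * cis (- (q / 2 * s\<^sup>2))"
      unfolding cis_mult lin by (simp add: power2_eq_square field_simps)
    then have "c h * E s * (cis (\<kappa> h * s) * cis (- (q / 2 * (s + h)\<^sup>2)))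
      = c h * E s * (cis (- (q / 2 * h\<^sup>2)) * cis (- (q / 2 * s\<^sup>2)))" by simp
    then show ?case by (simp add: W_def elim mult_ac)
  qed
  then have Wshift: "\<exists>d. AE s in lborel. W (s + h) = d * W s" for h by blast
  have "norm (W s) = 1" for s by (simp add: W_def norm_mult nrm)
  from shift_ratio_const_imp_linear_phase[OF Wm this Wshift]
  obtain \<gamma> k where \<gamma>: "norm \<gamma> = 1" "AE s in lborel. W s = \<gamma> * cis (k * s)"
    by blast
  show ?thesis
  proof
    show "AE s in lborel. E s = \<gamma> * cis (q / 2 * s\<^sup>2 + k * s)"
      using \<gamma>(2)
    proof eventually_elim
      case (elim s)
      have "E s = W s * cis (q / 2 * s\<^sup>2)" by (simp add: W_def mult.assoc cis_mult)
      then show ?case by (simp add: elim mult.assoc cis_mult add.commute)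
    qed
  qed (rule \<gamma>(1))
qed

text \<open>A translation along a characteristic of the third wave leaves its factor unchanged.
  Dividing the translated identity by the original one equates a shift ratio of \<open>E1\<close>
  with an inverse shift ratio of \<open>E2\<close>; by separation of variables both are
  constant.\<close>

lemma three_wave_phase:
  fixes E1 E2 E3 :: "real \<Rightarrow> complex"
  assumes [measurable]: "E1 \<in> borel_measurable borel" "E2 \<in> borel_measurable borel" "E3 \<in> borel_measurable borel"
    and nrm: "\<And>s. norm (E1 s) = 1" "\<And>s. norm (E2 s) = 1" "\<And>s. norm (E3 s) = 1"
    and "a \<noteq> b" "a \<noteq> c"
    and ae: "AE p in lborel. E1 (fst p - a * snd p) * E2 (fst p - b * snd p) * E3 (fst p - c * snd p) = 1"
  obtains \<gamma> k where "norm \<gamma> = 1" "AE s in lborel. E1 s = \<gamma> * cis (k * s)"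
proof -
  have unit: "E1 s * cnj (E1 s) = 1" "E2 s * cnj (E2 s) = 1" for s
    using nrm(1,2)[of s] by (simp_all add: unimodular_mult_cnj)
  have ratio: "\<exists>d. AE s in lborel. E1 (s + h) = d * E1 s" for h
  proof -
    \<comment> \<open>During the time \<tau> the third characteristic drifts by \<open>h\<close>
      relative to the first.\<close>
    define \<tau> where "\<tau> = h / (c - a)"
    have \<tau>: "c * \<tau> - a * \<tau> = h" using \<open>a \<noteq> c\<close> left_diff_distrib[of c a \<tau>] by (simp add: \<tau>_def)
    have "Measurable.pred (borel \<Otimes>\<^sub>M borel)
        (\<lambda>p. E1 (fst p - a * snd p) * E2 (fst p - b * snd p) * E3 (fst p - c * snd p) = 1)"
      by measurable
    from AE_plane_translate[of "\<lambda>x t. E1 (x - a * t) * E2 (x - b * t) * E3 (x - c * t) = 1", OF this ae, of "c * \<tau>" \<tau>]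
    have "AE p in lborel. E1 (fst p - a * snd p + h) * E2 (fst p - b * snd p + (c - b) * \<tau>)
        * E3 (fst p - c * snd p) = 1"
      by (simp add: \<tau>[symmetric] algebra_simps)
    with ae have "AE p in lborel. E1 (fst p - a * snd p + h) * cnj (E1 (fst p - a * snd p))
        = cnj (E2 (fst p - b * snd p + (c - b) * \<tau>)) * E2 (fst p - b * snd p)"
    proof eventually_elim
      case (elim p)
      let ?A = "E1 (fst p - a * snd p)" and ?B = "E2 (fst p - b * snd p)" and ?C = "E3 (fst p - c * snd p)"
      let ?A' = "E1 (fst p - a * snd p + h)" and ?B' = "E2 (fst p - b * snd p + (c - b) * \<tau>)"
      have "?C \<noteq> 0" using nrm(3) by (metis norm_zero zero_neq_one)
      moreover have "(?A' * ?B') * ?C = (?A * ?B) * ?C" using elim by simp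
      ultimately have "?A' * ?B' = ?A * ?B" by simp
      then have "?A' * (?B' * cnj ?B') * cnj ?A = (?A * cnj ?A) * ?B * cnj ?B'"
        by (simp add: mult_ac)
      then show ?case by (simp add: unit mult_ac)
    qed
    from separated_characteristics_const[OF _ _ \<open>a \<noteq> b\<close> this]
    obtain d where "AE u in lborel. E1 (u + h) * cnj (E1 u) = d"
      by auto
    then have "AE u in lborel. E1 (u + h) = d * E1 u"
    proof eventually_elim
      case (elim u)
      have "E1 (u + h) = (E1 (u + h) * cnj (E1 u)) * E1 u"
        using unit(1)[of u] by (simp add: mult_ac)
      then show ?case using elim by simp
    qed
    then show ?thesis by blast
  qed
  show ?thesis
    using shift_ratio_const_imp_linear_phase[of E1, OF _ nrm(1) ratio] that by auto
qed

text \<open>Translating along a characteristic of the fourth wave removes its factor and leaves a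
  three-wave identity for the shift ratios \<open>?D1\<close>, \<open>?D2\<close>,
  \<open>?D3\<close>. So the shift ratio of \<open>E1\<close> is a linear phase and
  \<open>E1\<close> a quadratic one: each further wave raises the degree by one.\<close>

lemma four_wave_phase:
  fixes E1 E2 E3 E4 :: "real \<Rightarrow> complex"
  assumes [measurable]: "E1 \<in> borel_measurable borel" "E2 \<in> borel_measurable borel"
      "E3 \<in> borel_measurable borel" "E4 \<in> borel_measurable borel"
    and nrm: "\<And>s. norm (E1 s) = 1" "\<And>s. norm (E2 s) = 1" "\<And>s. norm (E3 s) = 1" "\<And>s. norm (E4 s) = 1"
    and "a \<noteq> b" "a \<noteq> c" "a \<noteq> d"
    and ae: "AE p in lborel. E1 (fst p - a * snd p) * E2 (fst p - b * snd p)
      * E3 (fst p - c * snd p) * E4 (fst p - d * snd p) = 1"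
  obtains \<gamma> q k where "norm \<gamma> = 1" "AE s in lborel. E1 s = \<gamma> * cis (q * s\<^sup>2 + k * s)"
proof -
  have unit: "E1 s * cnj (E1 s) = 1" for s
    using nrm(1)[of s] by (simp_all add: unimodular_mult_cnj)
  have ratio: "\<exists>e \<kappa>. AE s in lborel. E1 (s + h) = e * cis (\<kappa> * s) * E1 s" for h
  proof -
    define \<tau> where "\<tau> = h / (d - a)"
    have \<tau>: "d * \<tau> - a * \<tau> = h" using \<open>a \<noteq> d\<close> left_diff_distrib[of d a \<tau>] by (simp add: \<tau>_def)
    let ?D1 = "\<lambda>s. E1 (s + h) * cnj (E1 s)"
    let ?D2 = "\<lambda>s. E2 (s + (d - b) * \<tau>) * cnj (E2 s)"
    let ?D3 = "\<lambda>s. E3 (s + (d - c) * \<tau>) * cnj (E3 s)"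
    have "Measurable.pred (borel \<Otimes>\<^sub>M borel)
        (\<lambda>p. E1 (fst p - a * snd p) * E2 (fst p - b * snd p) * E3 (fst p - c * snd p) * E4 (fst p - d * snd p) = 1)"
      by measurable
    from AE_plane_translate[of "\<lambda>x t. E1 (x - a * t) * E2 (x - b * t) * E3 (x - c * t) * E4 (x - d * t) = 1",
        OF this ae, of "d * \<tau>" \<tau>]
    have "AE p in lborel. E1 (fst p - a * snd p + h) * E2 (fst p - b * snd p + (d - b) * \<tau>)
        * E3 (fst p - c * snd p + (d - c) * \<tau>) * E4 (fst p - d * snd p) = 1"
      by (simp add: \<tau>[symmetric] algebra_simps)
    with ae have "AE p in lborel. ?D1 (fst p - a * snd p) * ?D2 (fst p - b * snd p) * ?D3 (fst p - c * snd p) = 1"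
    proof eventually_elim
      case (elim p)
      let ?A = "E1 (fst p - a * snd p)" and ?B = "E2 (fst p - b * snd p)"
        and ?C = "E3 (fst p - c * snd p)" and ?D = "E4 (fst p - d * snd p)"
      have "?D * cnj ?D = 1"
        using nrm(4)[of "fst p - d * snd p"] by (simp add: unimodular_mult_cnj)
      have "(E1 (fst p - a * snd p + h) * E2 (fst p - b * snd p + (d - b) * \<tau>)
        * E3 (fst p - c * snd p + (d - c) * \<tau>)) * (cnj ?A * cnj ?B * cnj ?C) * (?D * cnj ?D) = 1"
      proof -
        have "(E1 (fst p - a * snd p + h) * E2 (fst p - b * snd p + (d - b) * \<tau>)
            * E3 (fst p - c * snd p + (d - c) * \<tau>)) * (cnj ?A * cnj ?B * cnj ?C) * (?D * cnj ?D)
          = (E1 (fst p - a * snd p + h) * E2 (fst p - b * snd p + (d - b) * \<tau>)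
            * E3 (fst p - c * snd p + (d - c) * \<tau>) * ?D) * cnj (?A * ?B * ?C * ?D)"
          by (simp only: complex_cnj_mult mult_ac)
        with elim show ?thesis by simp
      qed
      then show ?case using \<open>?D * cnj ?D = 1\<close> by (simp add: mult_ac)
    qed
    note ae' = this
    have n: "norm (?D1 s) = 1" "norm (?D2 s) = 1" "norm (?D3 s) = 1" for s
      by (simp_all add: norm_mult nrm)
    have "?D1 \<in> borel_measurable borel" "?D2 \<in> borel_measurable borel" "?D3 \<in> borel_measurable borel"
      by measurable
    from three_wave_phase[OF this n \<open>a \<noteq> b\<close> \<open>a \<noteq> c\<close> ae']
    obtain e \<kappa> where e: "AE s in lborel. ?D1 s = e * cis (\<kappa> * s)"
      by blast
    then have "AE s in lborel. E1 (s + h) = e * cis (\<kappa> * s) * E1 s"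
    proof eventually_elim
      case (elim s)
      have "E1 (s + h) = ?D1 s * E1 s" using unit[of s] by (simp add: mult.assoc mult.commute)
      then show ?case using elim by simp
    qed
    then show ?thesis by blast
  qed
  show ?thesis
    using shift_ratio_linear_imp_quadratic_phase[of E1, OF _ nrm(1) ratio] that by auto
qed

section \<open>Integrals of bounded functions over intervals\<close>

lemma AE_real_ex_Icc:
  assumes "AE x in (lborel :: real measure). P x" "a < b"
  obtains x where "x \<in> {a..b}" "P x"
proof (rule ccontr)
  assume "\<not> thesis"
  then have "AE x in lborel. x \<notin> {a..b}"
    using assms(1) that by (auto elim: eventually_mono)
  then have "emeasure lborel {a..b} = 0"
    by (subst AE_iff_measurable[symmetric, of "{a..b}" lborel "\<lambda>x. x \<notin> {a..b}"]) auto
  then show False using assms(2) by (simp add: emeasure_lborel_Icc_eq split: if_splits)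
qed

lemma set_integral_swap:
  fixes h :: "real \<Rightarrow> real \<Rightarrow> real"
  assumes [measurable]: "(\<lambda>p. h (fst p) (snd p)) \<in> borel_measurable (borel \<Otimes>\<^sub>M borel)"
    and B: "\<And>x y. \<bar>h x y\<bar> \<le> B"
  shows "(LBINT x:{a..b}. LBINT y:{c..d}. h x y) = (LBINT y:{c..d}. LBINT x:{a..b}. h x y)"
proof -
  have eq: "(\<lambda>p. indicator ({a..b} \<times> {c..d}) p *\<^sub>R h (fst p) (snd p))
      = (\<lambda>(x, y). indicator {a..b} x * indicator {c..d} y * h x y)"
    by (auto simp: indicator_def fun_eq_iff)
  have fin: "emeasure (lborel \<Otimes>\<^sub>M lborel) ({a..b} \<times> {c..d}) < \<infinity>"
    by (subst lborel.emeasure_pair_measure_Times) (auto simp: emeasure_lborel_Icc_eq ennreal_mult_less_top)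
  have "integrable (lborel \<Otimes>\<^sub>M lborel) (\<lambda>(x, y). indicator {a..b} x * indicator {c..d} y * h x y)"
    unfolding eq[symmetric] using fin B
    by (intro integrableI_bounded_set_indicator[where B=B]) (auto simp: borel_prod[symmetric])
  from lborel_pair.Fubini_integral[OF this]
  have "(\<integral>y. (\<integral>x. indicator {a..b} x * indicator {c..d} y * h x y \<partial>lborel) \<partial>lborel)
      = (\<integral>x. (\<integral>y. indicator {a..b} x * indicator {c..d} y * h x y \<partial>lborel) \<partial>lborel)" .
  moreover have "(\<integral>x. indicator {a..b} x * indicator {c..d} y * h x y \<partial>lborel)
      = indicator {c..d} y * (LBINT x:{a..b}. h x y)" for y
    unfolding set_lebesgue_integral_def
    by (subst integral_mult_right_zero[symmetric]) (simp add: mult_ac)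
  moreover have "(\<integral>y. indicator {a..b} x * indicator {c..d} y * h x y \<partial>lborel)
      = indicator {a..b} x * (LBINT y:{c..d}. h x y)" for x
    unfolding set_lebesgue_integral_def
    by (subst integral_mult_right_zero[symmetric]) (simp add: mult_ac)
  ultimately show ?thesis
    by (simp add: set_lebesgue_integral_def)
qed

lemma set_integral_abs_bound:
  fixes f :: "real \<Rightarrow> real"
  assumes "f \<in> borel_measurable borel" and B: "\<And>x. \<bar>f x\<bar> \<le> B" and "a \<le> b"
  shows "\<bar>LBINT x:{a..b}. f x\<bar> \<le> B * (b - a)"
proof -
  have i: "set_integrable lborel {a..b} f"
    by (rule set_integrable_bounded_Icc[where B=B]) (use assms in auto)
  have iB: "set_integrable lborel {a..b} (\<lambda>x. B)"
    by (rule set_integrable_bounded_Icc[where B="\<bar>B\<bar>"]) auto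
  have "\<bar>LBINT x:{a..b}. f x\<bar> \<le> (LBINT x:{a..b}. \<bar>f x\<bar>)"
    using set_integral_norm_bound[OF i] by simp
  also have "\<dots> \<le> (LBINT x:{a..b}. B)"
    by (rule set_integral_mono[OF set_integrable_abs[OF i] iB]) (rule B)
  finally show ?thesis using \<open>a \<le> b\<close> by (simp add: set_integral_const mult.commute)
qed

lemma set_integral_measurable:
  fixes h :: "real \<Rightarrow> real \<Rightarrow> real"
  assumes [measurable]: "(\<lambda>p. h (fst p) (snd p)) \<in> borel_measurable (borel \<Otimes>\<^sub>M borel)"
  shows "(\<lambda>x. LBINT y:{c..d}. h x y) \<in> borel_measurable borel"
proof -
  have [measurable]: "(\<lambda>(x, y). h x y) \<in> borel_measurable (borel \<Otimes>\<^sub>M borel)"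
    using assms by (simp add: case_prod_unfold)
  show ?thesis
    unfolding set_lebesgue_integral_def by measurable
qed

text \<open>Only two end pieces of length \<open>|c - c'|\<close> fail to cancel. The bound does not
  involve the length of the interval, so shifting a bounded wave is negligible in means over long
  intervals.\<close>

lemma integral_shift_diff_bound:
  fixes f :: "real \<Rightarrow> real"
  assumes [measurable]: "f \<in> borel_measurable borel" and B: "\<And>x. \<bar>f x\<bar> \<le> B"
  shows "\<bar>LBINT v:{p..q}. f (v + c) - f (v + c')\<bar> \<le> 2 * B * \<bar>c - c'\<bar>"
proof -
  have B0: "B \<ge> 0" using B[of 0] by linarith
  have *: "\<bar>(LBINT v:{p..q}. f (v + c)) - (LBINT v:{p..q}. f (v + c'))\<bar> \<le> 2 * B * (c' - c)" if "c \<le> c'" for c c'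
  proof -
    have si: "integrable lborel (\<lambda>v. indicator {a..b} v * f v)" for a b
      using set_integrable_bounded_Icc[of f B a b] B by (simp add: set_integrable_def)
    have ii: "integrable lborel (indicator {a..b} :: real \<Rightarrow> real)" for a b :: real
      by (rule integrable_real_indicator) (auto simp: emeasure_lborel_Icc_eq)
    have ib: "integrable lborel (\<lambda>v. B * (indicator {p + c..p + c'} v + indicator {q + c..q + c'} v))"
      by (intro integrable_mult_right Bochner_Integration.integrable_add ii)
    have J: "(\<integral>v. B * (indicator {p + c..p + c'} v + indicator {q + c..q + c'} v) \<partial>lborel) = 2 * B * (c' - c)"
      unfolding integral_mult_right_zero Bochner_Integration.integral_add[OF ii ii] using that by simp
    have "(LBINT v:{p..q}. f (v + c)) - (LBINT v:{p..q}. f (v + c'))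
        = (LBINT v:{p+c..q+c}. f v) - (LBINT v:{p+c'..q+c'}. f v)"
      by (simp add: set_integral_shift)
    also have "\<dots> = (\<integral>v. indicator {p+c..q+c} v * f v - indicator {p+c'..q+c'} v * f v \<partial>lborel)"
      unfolding set_lebesgue_integral_def real_scaleR_def
      by (rule Bochner_Integration.integral_diff[symmetric]) (rule si)+
    finally have eq: "(LBINT v:{p..q}. f (v + c)) - (LBINT v:{p..q}. f (v + c'))
        = (\<integral>v. indicator {p+c..q+c} v * f v - indicator {p+c'..q+c'} v * f v \<partial>lborel)" .
    have "\<bar>indicator {p+c..q+c} v * f v - indicator {p+c'..q+c'} v * f v\<bar>
        \<le> B * (indicator {p + c..p + c'} v + indicator {q + c..q + c'} v)" for v
      using B[of v] B0 that by (auto simp: indicator_def)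
    then have "norm (\<integral>v. indicator {p+c..q+c} v * f v - indicator {p+c'..q+c'} v * f v \<partial>lborel)
        \<le> (\<integral>v. B * (indicator {p + c..p + c'} v + indicator {q + c..q + c'} v) \<partial>lborel)"
      by (intro Bochner_Integration.integral_norm_bound_integral Bochner_Integration.integrable_diff si ib)
        (unfold real_norm_def)
    then show ?thesis unfolding real_norm_def eq J .
  qed
  have "(LBINT v:{p..q}. f (v + c) - f (v + c')) = (LBINT v:{p..q}. f (v + c)) - (LBINT v:{p..q}. f (v + c'))"
    by (rule set_integral_diff; rule set_integrable_bounded_Icc[where B=B]) (use B in auto)
  then show ?thesis
    using *[of c c'] *[of c' c] by (cases "c \<le> c'") (auto simp: abs_minus_commute)
qed

lemma integral_affine_shift_diff_bound:
  fixes f :: "real \<Rightarrow> real"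
  assumes [measurable]: "f \<in> borel_measurable borel" and B: "\<And>x. \<bar>f x\<bar> \<le> B" and "m \<noteq> 0"
  shows "\<bar>LBINT v:{p..q}. f (m * v + c) - f (m * v + c')\<bar> \<le> 2 * B * \<bar>c / m - c' / m\<bar>"
  using integral_shift_diff_bound[of "\<lambda>v. f (m * v)" B p q "c / m" "c' / m"] B \<open>m \<noteq> 0\<close>
  by (simp add: distrib_left)

section \<open>An integer-valued wave excludes phases\<close>

text \<open>Here \<open>s\<close> is the argument of the integer-valued wave \<open>f4\<close> and
  \<open>v\<close> that of \<open>f1\<close>; the other two arguments depend on both. When
  \<open>s\<close> changes, the integral of the field over a \<open>v\<close>-interval changes by
  the change of \<open>f4\<close> times the length, up to an error independent of the length. For a
  field in \<open>{0, 1}\<close> this leaves \<open>f4\<close> only two values \<open>z\<close> and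
  \<open>z + 1\<close>, and for each generic \<open>s\<close> the field differs from
  \<open>f4 s - z\<close> by a function of bounded L1 norm. Four values of \<open>s\<close> combine
  to cancel \<open>f2\<close> and \<open>f3\<close>, which bounds in L1 the increments of a first
  difference \<phi> of \<open>f1\<close>. The phase keeps \<open>|\<phi>|\<close> at least 1/2, so
  \<phi> would be nearly constant and nonzero over a long stretch, although its integrals are
  bounded.\<close>

lemma integer_wave_excludes_phase_aux:
  fixes f1 f2 f3 f4 :: "real \<Rightarrow> real"
  assumes [measurable]: "f1 \<in> borel_measurable borel" "f2 \<in> borel_measurable borel"
      "f3 \<in> borel_measurable borel" "f4 \<in> borel_measurable borel"
    and B: "\<And>s. \<bar>f1 s\<bar> \<le> B" "\<And>s. \<bar>f2 s\<bar> \<le> B" "\<And>s. \<bar>f3 s\<bar> \<le> B"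
    and r: "r2 \<noteq> 0" "r2 \<noteq> 1" "r3 \<noteq> 0" "r3 \<noteq> 1"
    and two: "AE s in lborel. AE v in lborel.
      f1 v + f2 ((1 - r2) * v + r2 * s) + f3 ((1 - r3) * v + r3 * s) + f4 s \<in> {0, 1}"
    and int: "AE s in lborel. f4 s - c \<in> \<int>"
    and nonconst: "\<not> (\<exists>z. AE s in lborel. f4 s = z)"
    and phase: "AE s in lborel. cis (2 * pi * f1 s) = \<gamma> * cis (k * s)" "k \<noteq> 0"
  shows False
proof -
  have B0: "B \<ge> 0" using B(1)[of 0] by linarith
  define m2 m3 where "m2 = 1 - r2" and "m3 = 1 - r3"
  have m: "m2 \<noteq> 0" "m3 \<noteq> 0" using r by (auto simp: m2_def m3_def)
  define F where "F s v = f1 v + f2 (m2 * v + r2 * s) + f3 (m3 * v + r3 * s) + f4 s" for s v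
  have [measurable]: "(\<lambda>p. F (fst p) (snd p)) \<in> borel_measurable (borel \<Otimes>\<^sub>M borel)"
    unfolding F_def by measurable
  have [measurable]: "F s \<in> borel_measurable borel" for s
    unfolding F_def by measurable
  define good where "good s \<longleftrightarrow> (AE v in lborel. F s v \<in> {0, 1}) \<and> f4 s - c \<in> \<int>" for s
  have good: "AE s in lborel. good s"
    using two int unfolding good_def F_def m2_def m3_def by eventually_elim simp
  have FB: "\<bar>F s v\<bar> \<le> 3 * B + \<bar>f4 s\<bar>" for s v
    unfolding F_def using B(1)[of v] B(2)[of "m2 * v + r2 * s"] B(3)[of "m3 * v + r3 * s"] by linarith
  have iF: "set_integrable lborel {p..q} (F s)" for s p q
    by (rule set_integrable_bounded_Icc[where B="3 * B + \<bar>f4 s\<bar>"]) (use FB in auto)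
  define K where "K = 2 * B * \<bar>r2 / m2\<bar> + 2 * B * \<bar>r3 / m3\<bar>"
  have K0: "K \<ge> 0" using B0 by (simp add: K_def)
  \<comment> \<open>Between the characteristics at \<open>s\<close> and \<open>s'\<close> the term
    \<open>f1\<close> cancels exactly, \<open>f2\<close> and \<open>f3\<close> cancel up to end
    pieces, and \<open>f4\<close> contributes its difference times the length.\<close>
  have D1: "\<bar>(LBINT v:{p..q}. F s v) - (LBINT v:{p..q}. F s' v) - (f4 s - f4 s') * (q - p)\<bar> \<le> K * \<bar>s - s'\<bar>"
    if "p \<le> q" for p q s s'
  proof -
    define g2 where "g2 v = f2 (m2 * v + r2 * s) - f2 (m2 * v + r2 * s')" for v
    define g3 where "g3 v = f3 (m3 * v + r3 * s) - f3 (m3 * v + r3 * s')" for v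
    have [measurable]: "g2 \<in> borel_measurable borel" "g3 \<in> borel_measurable borel"
      unfolding g2_def g3_def by measurable
    have "\<bar>g2 v\<bar> \<le> 2 * B" for v
      unfolding g2_def using B(2)[of "m2 * v + r2 * s"] B(2)[of "m2 * v + r2 * s'"] by linarith
    then have i2: "set_integrable lborel {p..q} g2"
      by (intro set_integrable_bounded_Icc[where B="2 * B"]) simp_all
    have "\<bar>g3 v\<bar> \<le> 2 * B" for v
      unfolding g3_def using B(3)[of "m3 * v + r3 * s"] B(3)[of "m3 * v + r3 * s'"] by linarith
    then have i3: "set_integrable lborel {p..q} g3"
      by (intro set_integrable_bounded_Icc[where B="2 * B"]) simp_all
    have ic: "set_integrable lborel {p..q} (\<lambda>v. f4 s - f4 s')"
      by (rule set_integrable_bounded_Icc[where B="\<bar>f4 s - f4 s'\<bar>"]) auto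
    have "(LBINT v:{p..q}. F s v) - (LBINT v:{p..q}. F s' v) = (LBINT v:{p..q}. F s v - F s' v)"
      using set_integral_diff(2)[OF iF iF] by simp
    also have "\<dots> = (LBINT v:{p..q}. g2 v + g3 v + (f4 s - f4 s'))"
      by (simp add: F_def g2_def g3_def algebra_simps)
    also have "\<dots> = (LBINT v:{p..q}. g2 v) + (LBINT v:{p..q}. g3 v) + (f4 s - f4 s') * (q - p)"
      using set_integral_add(2)[OF set_integral_add(1)[OF i2 i3] ic] set_integral_add(2)[OF i2 i3] that
      by (simp add: set_integral_const)
    finally have "(LBINT v:{p..q}. F s v) - (LBINT v:{p..q}. F s' v) - (f4 s - f4 s') * (q - p)
      = (LBINT v:{p..q}. g2 v) + (LBINT v:{p..q}. g3 v)" by simp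
    moreover have "\<bar>LBINT v:{p..q}. g2 v\<bar> \<le> 2 * B * \<bar>r2 / m2\<bar> * \<bar>s - s'\<bar>"
    proof -
      have "r2 * s / m2 - r2 * s' / m2 = r2 / m2 * (s - s')"
        by (simp add: diff_divide_distrib right_diff_distrib)
      then have "\<bar>r2 * s / m2 - r2 * s' / m2\<bar> = \<bar>r2 / m2\<bar> * \<bar>s - s'\<bar>"
        by (simp add: abs_mult)
      with integral_affine_shift_diff_bound[of f2 B m2 p q "r2 * s" "r2 * s'"] B(2) m(1)
      show ?thesis unfolding g2_def by (simp add: mult.assoc)
    qed
    moreover have "\<bar>LBINT v:{p..q}. g3 v\<bar> \<le> 2 * B * \<bar>r3 / m3\<bar> * \<bar>s - s'\<bar>"
    proof -
      have "r3 * s / m3 - r3 * s' / m3 = r3 / m3 * (s - s')"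
        by (simp add: diff_divide_distrib right_diff_distrib)
      then have "\<bar>r3 * s / m3 - r3 * s' / m3\<bar> = \<bar>r3 / m3\<bar> * \<bar>s - s'\<bar>"
        by (simp add: abs_mult)
      with integral_affine_shift_diff_bound[of f3 B m3 p q "r3 * s" "r3 * s'"] B(3) m(2)
      show ?thesis unfolding g3_def by (simp add: mult.assoc)
    qed
    ultimately show ?thesis
      unfolding K_def distrib_right by linarith
  qed
  have F01: "0 \<le> (LBINT v:{p..q}. F s v)" "(LBINT v:{p..q}. F s v) \<le> q - p" if "good s" "p \<le> q" for s p q
  proof -
    have ae: "AE v in lborel. F s v \<in> {0, 1}" using that(1) by (simp add: good_def)
    have ae01: "AE v\<in>{p..q} in lborel. 0 \<le> F s v" "AE v\<in>{p..q} in lborel. F s v \<le> 1"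
      by (rule eventually_mono[OF ae]; auto)+
    have i1: "set_integrable lborel {p..q} (\<lambda>v. 1 :: real)" "set_integrable lborel {p..q} (\<lambda>v. 0 :: real)"
      by (rule set_integrable_bounded_Icc[where B=1]; simp)+
    show "0 \<le> (LBINT v:{p..q}. F s v)"
      using set_integral_mono_AE[OF i1(2) iF ae01(1)] by simp
    show "(LBINT v:{p..q}. F s v) \<le> q - p"
      using set_integral_mono_AE[OF iF i1(1) ae01(2)] that(2)
      by (simp add: set_integral_const)
  qed
  \<comment> \<open>A difference of at least 2 would move the integral over length \<open>L\<close>
    by \<open>2 * L\<close>, up to the error \<open>L - 1\<close>, while integrals of a
    \<open>{0, 1}\<close>-valued function differ by at most \<open>L\<close>.\<close>
  have D2: "\<bar>f4 s - f4 s'\<bar> \<le> 1" if "good s" "good s'" for s s'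
  proof (rule ccontr)
    assume "\<not> \<bar>f4 s - f4 s'\<bar> \<le> 1"
    then have gt1: "1 < \<bar>f4 s - f4 s'\<bar>" by simp
    have "f4 s - f4 s' \<in> \<int>"
      using that Ints_diff[of "f4 s - c" "f4 s' - c"] by (auto simp: good_def)
    then obtain n :: int where n: "f4 s - f4 s' = of_int n" by (auto elim: Ints_cases)
    have "(1 :: real) < of_int \<bar>n\<bar>" using gt1 n by simp
    then have "2 \<le> \<bar>n\<bar>" by linarith
    then have "(2 :: real) \<le> of_int \<bar>n\<bar>" by linarith
    then have "\<bar>f4 s - f4 s'\<bar> \<ge> 2" using n by simp
    define L where "L = K * \<bar>s - s'\<bar> + 1"
    have L: "L > 0" using K0 by (simp add: L_def add_nonneg_pos)
    have "\<bar>f4 s - f4 s'\<bar> * L \<ge> 2 * L"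
      using \<open>\<bar>f4 s - f4 s'\<bar> \<ge> 2\<close> L by (intro mult_right_mono) auto
    moreover have "\<bar>f4 s - f4 s'\<bar> * L = \<bar>(f4 s - f4 s') * (L - 0)\<bar>" using L by (simp add: abs_mult)
    ultimately show False
      using D1[OF less_imp_le[OF L], of s s'] F01[OF that(1) less_imp_le[OF L]]
        F01[OF that(2) less_imp_le[OF L]] L_def by linarith
  qed
  obtain slo shi where s: "good slo" "good shi" "f4 shi = f4 slo + 1"
  proof -
    obtain s0 where s0: "good s0" by (rule AE_real_ex[OF good])
    have "\<exists>s. good s \<and> f4 s \<noteq> f4 s0"
    proof (rule ccontr)
      assume "\<not> ?thesis"
      then have "AE s in lborel. f4 s = f4 s0"
        using good by (auto elim: eventually_mono)
      with nonconst show False by blast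
    qed
    then obtain s1 where s1: "good s1" "f4 s1 \<noteq> f4 s0" by blast
    have "f4 s1 - f4 s0 \<in> \<int>"
      using s0 s1 Ints_diff[of "f4 s1 - c" "f4 s0 - c"] by (auto simp: good_def)
    then obtain n :: int where n: "f4 s1 - f4 s0 = of_int n" by (auto elim: Ints_cases)
    have "of_int \<bar>n\<bar> \<le> (1 :: real)" "n \<noteq> 0" using D2[OF s1(1) s0] s1(2) n by auto
    then have "n = 1 \<or> n = -1" by linarith
    then show ?thesis
      using that[of s0 s1] that[of s1 s0] s0 s1 n by auto
  qed
  define z where "z = f4 slo"
  have D3: "f4 s = z \<or> f4 s = z + 1" if "good s" for s
  proof -
    have "f4 s - z \<in> \<int>"
      using that s(1) Ints_diff[of "f4 s - c" "z - c"] by (auto simp: good_def z_def)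
    then obtain n :: int where n: "f4 s - z = of_int n" by (auto elim: Ints_cases)
    moreover have "\<bar>f4 s - z\<bar> \<le> 1" "\<bar>f4 s - z - 1\<bar> \<le> 1"
      using D2[OF that s(1)] D2[OF that s(2)] s(3) by (auto simp: z_def)
    ultimately have "of_int n \<ge> (0 :: real)" "of_int n \<le> (1 :: real)" by linarith+
    then have "n = 0 \<or> n = 1" by linarith
    with n show ?thesis by auto
  qed
  define M where "M s = K * (\<bar>s - slo\<bar> + \<bar>s - shi\<bar>)" for s
  \<comment> \<open>The field with \<open>f4\<close> replaced by its lower value \<open>z\<close>;
    it equals the field minus 0 or 1, according to the value of \<open>f4 s\<close>.\<close>
  define G where "G s v = f1 v + f2 (m2 * v + r2 * s) + f3 (m3 * v + r3 * s) + z" for s v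
  have [measurable]: "G s \<in> borel_measurable borel" for s
    unfolding G_def by measurable
  have GF: "G s v = F s v - (f4 s - z)" for s v by (simp add: G_def F_def)
  have GB: "\<bar>G s v\<bar> \<le> 3 * B + \<bar>z\<bar>" for s v
    unfolding G_def using B(1)[of v] B(2)[of "m2 * v + r2 * s"] B(3)[of "m3 * v + r3 * s"] by linarith
  have iG: "set_integrable lborel {p..q} (\<lambda>v. \<bar>G s (v + h)\<bar>)" for s p q h
    by (rule set_integrable_bounded_Icc[where B="3 * B + \<bar>z\<bar>"]) (use GB in auto)
  \<comment> \<open>If \<open>f4 s = z\<close>, compare with \<open>shi\<close>, where
    \<open>f4\<close> is larger by 1: the integral at \<open>s\<close> lies about
    \<open>q - p\<close> below one that is at most \<open>q - p\<close>, hence is bounded. The case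
    \<open>z + 1\<close> is the mirror image, with \<open>slo\<close>.\<close>
  have D4: "(LBINT v:{p..q}. \<bar>G s v\<bar>) \<le> M s" if "good s" "p \<le> q" for s p q
  proof -
    have ae: "AE v in lborel. F s v \<in> {0, 1}" using that(1) by (simp add: good_def)
    have i1: "set_integrable lborel {p..q} (\<lambda>v. 1 :: real)"
      by (rule set_integrable_bounded_Icc[where B=1]; simp)
    show ?thesis
    proof (cases "f4 s = z")
      case True
      have "(LBINT v:{p..q}. \<bar>G s v\<bar>) = (LBINT v:{p..q}. F s v)"
        using ae by (intro set_lebesgue_integral_cong_AE) (auto simp: GF True elim!: eventually_mono)
      also have "\<dots> \<le> K * \<bar>s - shi\<bar>"
        using D1[OF that(2), of s shi] F01(2)[OF s(2) that(2)] True s(3) by (simp add: z_def abs_le_iff)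
      also have "\<dots> \<le> M s" using K0 by (simp add: M_def mult_left_mono)
      finally show ?thesis .
    next
      case False
      then have f4: "f4 s = z + 1" using D3[OF that(1)] by simp
      have "(LBINT v:{p..q}. \<bar>G s v\<bar>) = (LBINT v:{p..q}. 1 - F s v)"
        using ae by (intro set_lebesgue_integral_cong_AE) (auto simp: GF f4 elim!: eventually_mono)
      also have "\<dots> = (q - p) - (LBINT v:{p..q}. F s v)"
        using set_integral_diff(2)[OF i1 iF, of s] that(2) by (simp add: set_integral_const)
      also have "\<dots> \<le> K * \<bar>s - slo\<bar>"
        using D1[OF that(2), of s slo] F01(1)[OF s(1) that(2)] f4 by (simp add: z_def abs_le_iff)
      also have "\<dots> \<le> M s" using K0 by (simp add: M_def mult_left_mono)
      finally show ?thesis .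
    qed
  qed
  \<comment> \<open>Half a period of the phase: a shift by \<eta> reverses its sign, so \<phi> takes
    values in \<open>\<int> + 1 / 2\<close>.\<close>
  define \<eta> where "\<eta> = pi / k"
  define \<phi> where "\<phi> v = f1 (v + \<eta>) - f1 v" for v
  have [measurable]: "\<phi> \<in> borel_measurable borel" unfolding \<phi>_def by measurable
  have \<phi>B: "\<bar>\<phi> v\<bar> \<le> 2 * B" for v
    unfolding \<phi>_def using B(1)[of v] B(1)[of "v + \<eta>"] by linarith
  have \<phi>_half: "AE v in lborel. 1 / 2 \<le> \<bar>\<phi> v\<bar>"
  proof -
    have "AE v in lborel. cis (2 * pi * f1 (v + \<eta>)) = \<gamma> * cis (k * (v + \<eta>))"
      using phase(1) by (subst AE_shift_iff[where P="\<lambda>s. cis (2 * pi * f1 s) = \<gamma> * cis (k * s)"]) measurable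
    with phase(1) show ?thesis
    proof eventually_elim
      case (elim v)
      have "k * (v + \<eta>) = k * v + pi" using phase(2) by (simp add: \<eta>_def field_simps)
      then have "cis (2 * pi * f1 (v + \<eta>)) = - cis (2 * pi * f1 v)"
        using elim by (simp flip: cis_mult)
      then have "cis (2 * pi * \<phi> v) = - 1"
        by (simp add: \<phi>_def right_diff_distrib flip: cis_divide)
      then have "cos (2 * pi * \<phi> v) = -1" by (simp add: complex_eq_iff)
      then obtain n :: int where n: "2 * pi * \<phi> v = of_int (2 * n + 1) * pi"
        by (auto simp: cos_eq_minus1 algebra_simps)
      then have "pi * (2 * \<phi> v) = pi * (2 * of_int n + 1)" by (simp add: algebra_simps)
      then have "2 * \<phi> v = 2 * of_int n + 1" unfolding mult_cancel_left using pi_neq_zero by blast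
      then have "\<phi> v = of_int n + 1 / 2" by simp
      moreover have "of_int n \<ge> (0 :: real) \<or> of_int n \<le> (-1 :: real)" by (cases "n \<ge> 0") auto
      ultimately show ?case by linarith
    qed
  qed
  \<comment> \<open>Chosen so that \<open>L / 2 - 1\<close> exceeds \<open>2 * B * |\<eta>|\<close>,
    the bound for the integral of \<phi> over any interval.\<close>
  define L where "L = 4 * B * \<bar>\<eta>\<bar> + 4"
  have L: "L > 0" using B0 by (simp add: L_def add_nonneg_pos)
  \<comment> \<open>Moving \<open>v\<close> by \<open>h\<close> and \<open>s\<close> by
    \<open>e2 * h\<close> leaves the argument of \<open>f2\<close> fixed, and \<open>e3\<close> does
    the same for \<open>f3\<close>. At the four corners of the resulting parallelogram both waves
    cancel.\<close>
  define e2 e3 where "e2 = - (m2 / r2)" and "e3 = - (m3 / r3)"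
  define M0 where "M0 = 4 * (K * (2 * (1 + \<bar>e3 * \<eta>\<bar> + \<bar>e2\<bar> * L) + \<bar>slo\<bar> + \<bar>shi\<bar>))"
  have M0: "M0 \<ge> 0" using K0 L by (simp add: M0_def)
  have D6: "(LBINT v:{p..q}. \<bar>\<phi> (v + h) - \<phi> v\<bar>) \<le> M0" if "p \<le> q" "h \<in> {0..L}" for p q h
  proof -
    have good': "AE s in lborel. good (s + c)" for c
    proof -
      obtain N where N: "N \<in> null_sets lborel" "{x \<in> space lborel. \<not> good x} \<subseteq> N"
        using good unfolding eventually_ae_filter by blast
      have [measurable]: "N \<in> sets borel" using N(1) by (simp add: null_sets_def)
      have "AE s in lborel. s \<notin> N" by (rule AE_not_in[OF N(1)])
      then have "AE s in lborel. s + c \<notin> N"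
        by (subst AE_shift_iff[where P="\<lambda>s. s \<notin> N"]) measurable
      then show ?thesis by (rule eventually_mono) (use N(2) in auto)
    qed
    have "AE s in lborel. good s \<and> good (s + e3 * \<eta>) \<and> good (s + e2 * h) \<and> good (s + (e3 * \<eta> + e2 * h))"
      using good good' by (intro AE_conjI) auto
    then obtain s where s': "s \<in> {0..1}" "good s" "good (s + e3 * \<eta>)" "good (s + e2 * h)" "good (s + (e3 * \<eta> + e2 * h))"
      by (rule AE_real_ex_Icc[of _ 0 1]) auto
    define s1 s2 s3 where "s1 = s + e3 * \<eta>" and "s2 = s + e2 * h" and "s3 = s + (e3 * \<eta> + e2 * h)"
    have diff: "\<phi> (v + h) - \<phi> v = G s3 (v + (\<eta> + h)) - G s1 (v + \<eta>) - G s2 (v + h) + G s (v + 0)" for v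
    proof -
      have "m2 * (v + (\<eta> + h)) + r2 * s3 = m2 * (v + \<eta>) + r2 * s1" "m2 * (v + h) + r2 * s2 = m2 * v + r2 * s"
        using r by (simp_all add: s1_def s2_def s3_def e2_def field_simps)
      moreover have "m3 * (v + (\<eta> + h)) + r3 * s3 = m3 * (v + h) + r3 * s2" "m3 * (v + \<eta>) + r3 * s1 = m3 * v + r3 * s"
        using r by (simp_all add: s1_def s2_def s3_def e3_def field_simps)
      ultimately show ?thesis
        by (simp add: G_def \<phi>_def add_ac)
    qed
    have Gs: "(LBINT v:{p..q}. \<bar>G s' (v + h')\<bar>) \<le> M0 / 4"
      if "good s'" "\<bar>s'\<bar> \<le> 1 + \<bar>e3 * \<eta>\<bar> + \<bar>e2\<bar> * L" for s' h'
    proof -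
      have "(LBINT v:{p..q}. \<bar>G s' (v + h')\<bar>) = (LBINT v:{p+h'..q+h'}. \<bar>G s' v\<bar>)"
        by (rule set_integral_shift)
      also have "\<dots> \<le> M s'" using D4[OF that(1)] \<open>p \<le> q\<close> by simp
      also have "\<dots> \<le> M0 / 4"
        unfolding M_def M0_def using that(2) K0 by (simp, intro mult_left_mono) auto
      finally show ?thesis .
    qed
    have e2h: "\<bar>e2 * h\<bar> \<le> \<bar>e2\<bar> * L" using that(2) by (auto simp: abs_mult intro!: mult_left_mono)
    have b: "\<bar>s\<bar> \<le> 1 + \<bar>e3 * \<eta>\<bar> + \<bar>e2\<bar> * L" "\<bar>s1\<bar> \<le> 1 + \<bar>e3 * \<eta>\<bar> + \<bar>e2\<bar> * L"
      "\<bar>s2\<bar> \<le> 1 + \<bar>e3 * \<eta>\<bar> + \<bar>e2\<bar> * L" "\<bar>s3\<bar> \<le> 1 + \<bar>e3 * \<eta>\<bar> + \<bar>e2\<bar> * L"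
      using e2h s'(1) unfolding s1_def s2_def s3_def by auto
    have "(LBINT v:{p..q}. \<bar>\<phi> (v + h) - \<phi> v\<bar>)
      \<le> (LBINT v:{p..q}. (\<bar>G s3 (v + (\<eta> + h))\<bar> + \<bar>G s1 (v + \<eta>)\<bar>) + (\<bar>G s2 (v + h)\<bar> + \<bar>G s (v + 0)\<bar>))"
    proof (rule set_integral_mono)
      have "\<bar>\<phi> (v + h) - \<phi> v\<bar> \<le> 4 * B" for v
        using \<phi>B[of v] \<phi>B[of "v + h"] by linarith
      then show "set_integrable lborel {p..q} (\<lambda>v. \<bar>\<phi> (v + h) - \<phi> v\<bar>)"
        by (intro set_integrable_bounded_Icc[where B="4 * B"]) auto
      show "set_integrable lborel {p..q} (\<lambda>v. (\<bar>G s3 (v + (\<eta> + h))\<bar> + \<bar>G s1 (v + \<eta>)\<bar>) + (\<bar>G s2 (v + h)\<bar> + \<bar>G s (v + 0)\<bar>))"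
        by (intro set_integral_add iG)
      show "\<bar>\<phi> (v + h) - \<phi> v\<bar> \<le> (\<bar>G s3 (v + (\<eta> + h))\<bar> + \<bar>G s1 (v + \<eta>)\<bar>) + (\<bar>G s2 (v + h)\<bar> + \<bar>G s (v + 0)\<bar>)" for v
        unfolding diff by linarith
    qed
    also have "\<dots> = ((LBINT v:{p..q}. \<bar>G s3 (v + (\<eta> + h))\<bar>) + (LBINT v:{p..q}. \<bar>G s1 (v + \<eta>)\<bar>))
        + ((LBINT v:{p..q}. \<bar>G s2 (v + h)\<bar>) + (LBINT v:{p..q}. \<bar>G s (v + 0)\<bar>))"
      by (simp only: set_integral_add[OF iG iG]
          set_integral_add(2)[OF set_integral_add(1)[OF iG iG] set_integral_add(1)[OF iG iG]])
    also have "\<dots> \<le> M0"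
      using Gs[of s3 "\<eta> + h"] Gs[of s1 \<eta>] Gs[of s2 h] Gs[of s 0] s' b
      unfolding s1_def s2_def s3_def by linarith
    finally show ?thesis .
  qed
  \<comment> \<open>Averaging the L1 bound over the shifts \<open>h\<close> yields a point
    \<open>v\<close> after which \<phi> stays close to \<open>\<phi> v\<close> in mean; for this the
    length \<open>A\<close> has to exceed \<open>L * M0\<close>.\<close>
  define g where "g v = (LBINT h:{0..L}. \<bar>\<phi> (v + h) - \<phi> v\<bar>)" for v
  define A where "A = L * M0 + 1"
  have A: "A > 0" using L M0 by (simp add: A_def add_nonneg_pos)
  have d\<phi>B: "\<bar>\<phi> (v + h) - \<phi> v\<bar> \<le> 4 * B" for v h
    using \<phi>B[of v] \<phi>B[of "v + h"] by linarith
  have i\<phi>: "set_integrable lborel {p..q} (\<lambda>h. \<bar>\<phi> (v + h) - \<phi> v\<bar>)" for v p q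
    by (rule set_integrable_bounded_Icc[where B="4 * B"]) (use d\<phi>B in auto)
  have [measurable]: "(\<lambda>p. \<bar>\<phi> (fst p + snd p) - \<phi> (fst p)\<bar>) \<in> borel_measurable (borel \<Otimes>\<^sub>M borel)"
    by measurable
  have g_int: "(LBINT v:{0..A}. g v) \<le> L * M0"
  proof -
    have "(LBINT v:{0..A}. g v) = (LBINT h:{0..L}. LBINT v:{0..A}. \<bar>\<phi> (v + h) - \<phi> v\<bar>)"
      unfolding g_def by (rule set_integral_swap[of "\<lambda>v h. \<bar>\<phi> (v + h) - \<phi> v\<bar>" "4 * B"]) (measurable, use d\<phi>B in auto)
    also have "\<dots> \<le> (LBINT h:{0..L}. M0)"
    proof (rule set_integral_mono)
      have "norm (LBINT v:{0..A}. \<bar>\<phi> (v + h) - \<phi> v\<bar>) \<le> 4 * B * A" for h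
        using set_integral_abs_bound[of "\<lambda>v. \<bar>\<phi> (v + h) - \<phi> v\<bar>" "4 * B" 0 A] d\<phi>B A by simp
      then show "set_integrable lborel {0..L} (\<lambda>h. LBINT v:{0..A}. \<bar>\<phi> (v + h) - \<phi> v\<bar>)"
        by (intro set_integrable_bounded_Icc[where B="4 * B * A"] set_integral_measurable) measurable
      show "set_integrable lborel {0..L} (\<lambda>h. M0)"
        by (rule set_integrable_bounded_Icc[where B=M0]) (use M0 in auto)
    qed (use D6 A in auto)
    also have "\<dots> = L * M0" using L by (simp add: set_integral_const)
    finally show ?thesis .
  qed
  obtain v where v: "g v \<le> 1" "1 / 2 \<le> \<bar>\<phi> v\<bar>"
  proof (rule ccontr)
    assume "\<not> thesis"
    then have ae: "AE v in lborel. 1 \<le> g v"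
      using \<phi>_half that by (auto elim!: eventually_mono simp: not_le) force
    have [measurable]: "g \<in> borel_measurable borel"
      unfolding g_def by (rule set_integral_measurable) measurable
    have "\<bar>g v\<bar> \<le> 4 * B * L" for v
      unfolding g_def using set_integral_abs_bound[of "\<lambda>h. \<bar>\<phi> (v + h) - \<phi> v\<bar>" "4 * B" 0 L] d\<phi>B L by simp
    then have ig: "set_integrable lborel {0..A} g"
      by (intro set_integrable_bounded_Icc[where B="4 * B * L"]) simp_all
    have i1: "set_integrable lborel {0..A} (\<lambda>v. 1 :: real)"
      by (rule set_integrable_bounded_Icc[where B=1]) simp_all
    have "(LBINT v:{0..A}. 1) \<le> (LBINT v:{0..A}. g v)"
      by (rule set_integral_mono_AE[OF i1 ig], rule eventually_mono[OF ae]) simp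
    with g_int A show False by (simp add: set_integral_const A_def)
  qed
  have [measurable]: "(\<lambda>h. \<phi> (v + h)) \<in> borel_measurable borel" by measurable
  have i1: "set_integrable lborel {0..L} (\<lambda>h. \<phi> (v + h) - \<phi> v)"
    by (rule set_integrable_bounded_Icc[where B="4 * B"]) (use d\<phi>B in auto)
  have i2: "set_integrable lborel {0..L} (\<lambda>h. \<phi> v)"
    by (rule set_integrable_bounded_Icc[where B="2 * B"]) (use \<phi>B in auto)
  have "(LBINT h:{0..L}. \<phi> (v + h)) = (LBINT h:{0..L}. \<phi> (v + h) - \<phi> v) + L * \<phi> v"
    using set_integral_add(2)[OF i1 i2] L by (simp add: set_integral_const)
  moreover have "\<bar>LBINT h:{0..L}. \<phi> (v + h) - \<phi> v\<bar> \<le> 1"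
    using set_integral_norm_bound[OF i1] v(1) by (simp add: g_def)
  moreover have "\<bar>LBINT h:{0..L}. \<phi> (v + h)\<bar> \<le> 2 * B * \<bar>\<eta>\<bar>"
    using integral_shift_diff_bound[of f1 B 0 L "v + \<eta>" v] B(1)
    by (simp add: \<phi>_def add_ac)
  moreover have "\<bar>L * \<phi> v\<bar> \<ge> L * (1 / 2)"
    using L v(2) unfolding abs_mult by (intro mult_mono) auto
  ultimately show False
    using L_def by linarith
qed

lemma integer_wave_excludes_phase:
  fixes f1 f2 f3 f4 :: "real \<Rightarrow> real"
  assumes [measurable]: "f1 \<in> borel_measurable borel" "f2 \<in> borel_measurable borel"
      "f3 \<in> borel_measurable borel" "f4 \<in> borel_measurable borel"
    and B: "\<And>s. \<bar>f1 s\<bar> \<le> B" "\<And>s. \<bar>f2 s\<bar> \<le> B" "\<And>s. \<bar>f3 s\<bar> \<le> B"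
    and speeds: "a \<noteq> b" "a \<noteq> c" "a \<noteq> d" "b \<noteq> d" "c \<noteq> d"
    and two: "AE p in lborel. f1 (fst p - a * snd p) + f2 (fst p - b * snd p)
      + f3 (fst p - c * snd p) + f4 (fst p - d * snd p) \<in> {0, 1}"
    and int: "AE s in lborel. f4 s - z \<in> \<int>"
    and nonconst: "\<not> (\<exists>z. AE s in lborel. f4 s = z)"
    and phase: "AE s in lborel. cis (2 * pi * f1 s) = \<gamma> * cis (k * s)" "k \<noteq> 0"
  shows False
proof -
  \<comment> \<open>Weights expressing \<open>x - b * t\<close> and \<open>x - c * t\<close> through
    \<open>x - a * t\<close> and \<open>x - d * t\<close>; distinctness of the speeds keeps them
    away from 0 and 1.\<close>
  define r2 r3 where "r2 = (a - b) / (a - d)" and "r3 = (a - c) / (a - d)"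
  have r: "r2 \<noteq> 0" "r2 \<noteq> 1" "r3 \<noteq> 0" "r3 \<noteq> 1"
    using speeds by (auto simp: r2_def r3_def field_simps)
  have lines: "(1 - r2) * (x - a * t) + r2 * (x - d * t) = x - b * t"
    "(1 - r3) * (x - a * t) + r3 * (x - d * t) = x - c * t" for x t
  proof -
    have "r2 * (a - d) = a - b" "r3 * (a - d) = a - c"
      using speeds by (simp_all add: r2_def r3_def)
    then have "r2 * (a - d) * t = (a - b) * t" "r3 * (a - d) * t = (a - c) * t" by simp_all
    then show "(1 - r2) * (x - a * t) + r2 * (x - d * t) = x - b * t"
      "(1 - r3) * (x - a * t) + r3 * (x - d * t) = x - c * t"
      by (simp_all add: algebra_simps)
  qed
  let ?Q = "\<lambda>u v. f1 v + f2 ((1 - r2) * v + r2 * u) + f3 ((1 - r3) * v + r3 * u) + f4 u \<in> {0, 1}"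
  have "Measurable.pred (borel \<Otimes>\<^sub>M borel) (\<lambda>p. ?Q (fst p) (snd p))"
    by measurable
  from AE_characteristics[of d a ?Q, OF _ this] speeds(3) two
  have "AE s in lborel. AE v in lborel. ?Q s v"
    by (simp add: lines)
  from integer_wave_excludes_phase_aux[OF assms(1-4) B r this int nonconst phase]
  show False .
qed

section \<open>Block means\<close>

text \<open>Serves the inequality \<open>0.0627 * pi\<^sup>2 \<le> 0.6246\<close>. It suffices that
  \<open>pi < 3.156\<close>, and the Taylor polynomial of the sine at
  \<open>0.526 = 3.156 / 6\<close> already exceeds \<open>sin (pi / 6) = 1 / 2\<close> by more than
  its error.\<close>

lemma pi_square_bound: "pi\<^sup>2 < 9.961"
proof -
  have "pi < 3.156"
  proof (rule ccontr)
    assume "\<not> pi < 3.156"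
    then have ge: "(0.526 :: real) \<le> pi / 6" by simp
    have "sin (0.526 :: real) \<le> sin (pi / 6)"
      using ge pi_gt_zero by (intro sin_monotone_2pi_le) auto
    also have "sin (pi / 6) = 1 / 2" by (rule sin_30)
    finally have "sin (0.526 :: real) \<le> 1 / 2" .
    moreover have "\<bar>sin (0.526 :: real) - (0.526 - 0.526 ^ 3 / 6)\<bar> \<le> 0.526 ^ 5 / 120"
      using Maclaurin_sin_bound[of "0.526" 5]
      by (simp add: lessThan_nat_numeral sin_coeff_def fact_numeral)
    ultimately show False by (simp add: power_numeral_reduce abs_le_iff)
  qed
  then have "pi\<^sup>2 \<le> 3.156\<^sup>2" using pi_gt_zero by (intro power_mono) auto
  then show ?thesis by (simp add: power2_eq_square)
qed

text \<open>The truncated power series of the squared arcsine. Its mean over a period in the form below,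
  \<open>5 / (8 pi\<^sup>2)\<close>, still exceeds \<open>1 / 16\<close>; the quadratic truncation alone would not.\<close>

lemma square_ge_sin_powers: "(sin t)\<^sup>2 + (sin t) ^ 4 / 3 \<le> (t :: real)\<^sup>2"
proof -
  define g where "g t = t\<^sup>2 - (sin t)\<^sup>2 - (sin t) ^ 4 / 3" for t :: real
  define g' where "g' t = 2 * t - 2 * sin t * cos t - 4 / 3 * (sin t) ^ 3 * cos t" for t :: real
  have dg: "(g has_real_derivative g' t) (at t)" for t
    unfolding g_def g'_def by (auto intro!: derivative_eq_intros simp: field_simps)
  have dg': "(g' has_real_derivative 16 / 3 * (sin t) ^ 4) (at t)" for t
  proof -
    have "(g' has_real_derivative (2 - (2 * cos t * cos t - 2 * sin t * sin t)
        - (4 * (sin t)\<^sup>2 * cos t * cos t - 4 / 3 * (sin t) ^ 3 * sin t))) (at t)"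
      unfolding g'_def by (auto intro!: derivative_eq_intros simp: field_simps power2_eq_square power3_eq_cube)
    moreover have "2 - (2 * cos t * cos t - 2 * sin t * sin t)
        - (4 * (sin t)\<^sup>2 * cos t * cos t - 4 / 3 * (sin t) ^ 3 * sin t) = 16 / 3 * (sin t) ^ 4"
    proof -
      have c: "cos t * cos t = 1 - sin t * sin t"
        using sin_cos_squared_add[of t] by (simp add: power2_eq_square)
      have "2 - (2 * cos t * cos t - 2 * sin t * sin t)
        - (4 * (sin t)\<^sup>2 * cos t * cos t - 4 / 3 * (sin t) ^ 3 * sin t)
        = 2 - (2 * (cos t * cos t) - 2 * sin t * sin t)
        - (4 * (sin t)\<^sup>2 * (cos t * cos t) - 4 / 3 * (sin t) ^ 3 * sin t)" by simp
      also have "\<dots> = 16 / 3 * (sin t) ^ 4"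
        unfolding c by (simp add: power2_eq_square power3_eq_cube power4_eq_xxxx algebra_simps)
      finally show ?thesis .
    qed
    ultimately show ?thesis by (simp only:)
  qed
  have mono: "g' s \<le> g' t" if "s \<le> t" for s t
    by (rule DERIV_nonneg_imp_nondecreasing[OF that]) (use dg' in \<open>auto intro!: exI[of _ "16 / 3 * (sin _) ^ 4"]\<close>)
  have g'0: "g' 0 = 0" by (simp add: g'_def)
  have nonneg: "g t \<ge> 0" if "t \<ge> 0" for t
  proof -
    have "g 0 \<le> g t"
    proof (rule DERIV_nonneg_imp_nondecreasing[OF that])
      fix x :: real assume "0 \<le> x"
      then have "g' x \<ge> 0" using mono[of 0 x] g'0 by simp
      then show "\<exists>y. (g has_real_derivative y) (at x) \<and> 0 \<le> y" using dg by blast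
    qed
    then show ?thesis by (simp add: g_def)
  qed
  have "g (- t) = g t" by (simp add: g_def)
  then have "g t \<ge> 0" using nonneg[of t] nonneg[of "- t"] by (cases "t \<ge> 0") auto
  then show ?thesis by (simp add: g_def)
qed

text \<open>With \<open>S = (sin (pi * y))^2\<close> the right-hand side is
  \<open>S + S^2 / 3\<close>. Written in cosines it is visibly 1-periodic in \<open>y\<close>, so at
  \<open>y = f s - c\<close> it depends only on the phase of \<open>f\<close>, and its harmonics
  average out.\<close>

lemma square_ge_trig:
  "pi\<^sup>2 * y\<^sup>2 \<ge> 5 / 8 - 2 / 3 * cos (2 * pi * y) + 1 / 24 * cos (4 * pi * y)"
proof -
  define S where "S = (sin (pi * y))\<^sup>2"
  have c2: "cos (2 * (pi * y)) = 1 - 2 * S"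
    using cos_double_sin[of "pi * y"] by (simp add: S_def)
  have "cos (2 * (2 * (pi * y))) = 2 * (1 - 2 * S)\<^sup>2 - 1"
    using cos_double_cos[of "2 * (pi * y)"] c2 by simp
  then have c4: "cos (4 * pi * y) = 2 * (1 - 2 * S)\<^sup>2 - 1" by (simp add: mult.assoc)
  have "5 / 8 - 2 / 3 * cos (2 * pi * y) + 1 / 24 * cos (4 * pi * y) = S + S\<^sup>2 / 3"
    unfolding c4 using c2 by (simp add: mult.assoc power2_eq_square field_simps)
  also have "\<dots> = (sin (pi * y))\<^sup>2 + (sin (pi * y)) ^ 4 / 3"
    by (simp add: S_def flip: power_mult)
  also have "\<dots> \<le> (pi * y)\<^sup>2" by (rule square_ge_sin_powers)
  finally show ?thesis by (simp add: power_mult_distrib)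
qed

section \<open>Integrals over a grid of blocks\<close>

lemma set_integral_combine:
  fixes f :: "real \<Rightarrow> real"
  assumes i: "set_integrable lborel {a..c} f" and "a \<le> b" "b \<le> c"
  shows "(LBINT x:{a..c}. f x) = (LBINT x:{a..b}. f x) + (LBINT x:{b..c}. f x)"
proof -
  have i1: "set_integrable lborel {a..b} f" and i2: "set_integrable lborel {b..c} f"
    using assms by (auto intro!: set_integrable_subset[OF i])
  have m: "(\<lambda>x. indicator {a..c} x * f x) \<in> borel_measurable lborel"
    "(\<lambda>x. indicator {a..b} x * f x + indicator {b..c} x * f x) \<in> borel_measurable lborel"
    using i i1 i2 unfolding set_integrable_def real_scaleR_def
    by (auto intro!: borel_measurable_integrable Bochner_Integration.integrable_add)
  have "(\<integral>x. indicator {a..c} x * f x \<partial>lborel)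
      = (\<integral>x. indicator {a..b} x * f x + indicator {b..c} x * f x \<partial>lborel)"
  proof (rule integral_cong_AE[OF m])
    show "AE x in lborel. indicator {a..c} x * f x = indicator {a..b} x * f x + indicator {b..c} x * f x"
      using AE_lborel_singleton[of b] by eventually_elim (use assms in \<open>auto simp: indicator_def\<close>)
  qed
  also have "\<dots> = (\<integral>x. indicator {a..b} x * f x \<partial>lborel) + (\<integral>x. indicator {b..c} x * f x \<partial>lborel)"
    using i1 i2 unfolding set_integrable_def real_scaleR_def
    by (rule Bochner_Integration.integral_add)
  finally show ?thesis by (simp add: set_lebesgue_integral_def)
qed

text \<open>Complete blocks contribute nonnegatively; only the incomplete blocks at the two ends can
  be negative, each by at most \<open>r * M\<close>.\<close>

lemma block_integral_lower_bound:
  fixes \<phi> :: "real \<Rightarrow> real"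
  assumes [measurable]: "\<phi> \<in> borel_measurable borel" and M: "\<And>x. \<bar>\<phi> x\<bar> \<le> M" and "r > 0"
    and blocks: "\<And>j::int. (LBINT x:{of_int j * r..of_int j * r + r}. \<phi> x) \<ge> 0"
    and "a \<le> b"
  shows "(LBINT x:{a..b}. \<phi> x) \<ge> - 2 * r * M"
proof -
  have M0: "M \<ge> 0" using M[of 0] by linarith
  have i: "set_integrable lborel {p..q} \<phi>" for p q
    by (rule set_integrable_bounded_Icc[where B=M]) (use M in auto)
  have short: "(LBINT x:{p..q}. \<phi> x) \<ge> - r * M" if "p \<le> q" "q \<le> p + r" for p q
  proof -
    have "\<bar>LBINT x:{p..q}. \<phi> x\<bar> \<le> M * (q - p)"
      by (rule set_integral_abs_bound) (use M that in auto)
    also have "\<dots> \<le> M * r" using M0 that by (intro mult_left_mono) auto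
    finally show ?thesis by (simp add: mult.commute abs_le_iff)
  qed
  have many: "(LBINT x:{of_int j * r..of_int j * r + of_nat n * r}. \<phi> x) \<ge> 0" for j :: int and n :: nat
  proof (induction n)
    case 0
    show ?case using set_integral_abs_bound[of \<phi> M "of_int j * r" "of_int j * r"] M by simp
  next
    case (Suc n)
    have e: "of_int j * r + of_nat n * r = of_int (j + int n) * r" by (simp add: algebra_simps)
    have split: "(LBINT x:{of_int j * r..of_int j * r + of_nat (Suc n) * r}. \<phi> x)
      = (LBINT x:{of_int j * r..of_int j * r + of_nat n * r}. \<phi> x)
        + (LBINT x:{of_int j * r + of_nat n * r..of_int j * r + of_nat (Suc n) * r}. \<phi> x)"
      by (rule set_integral_combine[OF i]) (use \<open>r > 0\<close> in \<open>auto simp: algebra_simps\<close>)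
    have last: "{of_int j * r + of_nat n * r..of_int j * r + of_nat (Suc n) * r}
        = {of_int (j + int n) * r..of_int (j + int n) * r + r}"
      by (simp add: algebra_simps)
    show ?case
      unfolding split last using Suc blocks[of "j + int n"] by (rule add_nonneg_nonneg)
  qed
  \<comment> \<open>\<open>j0\<close> and \<open>j1\<close> index the first grid point from
    \<open>a\<close> on and the last one up to \<open>b\<close>. If they come in the wrong order,
    the interval has length at most \<open>r\<close>.\<close>
  define j0 where "j0 = \<lceil>a / r\<rceil>"
  define j1 where "j1 = \<lfloor>b / r\<rfloor>"
  have j0: "a \<le> of_int j0 * r" "of_int j0 * r \<le> a + r"
  proof -
    have "a / r \<le> of_int j0" "of_int j0 < a / r + 1"
      using ceiling_correct[of "a / r"] by (simp_all add: j0_def)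
    then have "a / r * r \<le> of_int j0 * r" "of_int j0 * r \<le> (a / r + 1) * r"
      using \<open>r > 0\<close> by (simp_all add: mult_right_mono del: times_divide_eq_left)
    then show "a \<le> of_int j0 * r" "of_int j0 * r \<le> a + r"
      using \<open>r > 0\<close> by (simp_all add: distrib_right)
  qed
  have j1: "of_int j1 * r \<le> b" "b \<le> of_int j1 * r + r"
  proof -
    have "of_int j1 \<le> b / r" "b / r < of_int j1 + 1"
      using floor_correct[of "b / r"] by (simp_all add: j1_def)
    then have "of_int j1 * r \<le> b / r * r" "b / r * r \<le> (of_int j1 + 1) * r"
      using \<open>r > 0\<close> by (simp_all add: mult_right_mono del: times_divide_eq_left)
    then show "of_int j1 * r \<le> b" "b \<le> of_int j1 * r + r"
      using \<open>r > 0\<close> by (simp_all add: distrib_right)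
  qed
  show ?thesis
  proof (cases "j0 \<le> j1")
    case True
    then have le: "of_int j0 * r \<le> of_int j1 * r" using \<open>r > 0\<close> by (intro mult_right_mono) auto
    have n: "of_int j1 * r = of_int j0 * r + of_nat (nat (j1 - j0)) * r"
      using True by (simp add: algebra_simps)
    have "(LBINT x:{a..b}. \<phi> x) = (LBINT x:{a..of_int j0 * r}. \<phi> x) + (LBINT x:{of_int j0 * r..b}. \<phi> x)"
      by (rule set_integral_combine[OF i]) (use j0 j1 le in auto)
    also have "(LBINT x:{of_int j0 * r..b}. \<phi> x)
        = (LBINT x:{of_int j0 * r..of_int j1 * r}. \<phi> x) + (LBINT x:{of_int j1 * r..b}. \<phi> x)"
      by (rule set_integral_combine[OF i]) (use j0 j1 le in auto)
    finally show ?thesis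
      using short[OF j0] short[OF j1] many[of j0 "nat (j1 - j0)"] unfolding n[symmetric] by simp
  next
    case False
    then have "of_int (j1 + 1) * r \<le> of_int j0 * r" using \<open>r > 0\<close> by (intro mult_right_mono) auto
    then have "b \<le> a + 2 * r" and "of_int j1 * r + r \<le> a + r" using j0 j1 by (auto simp: algebra_simps)
    then have "b \<le> a + r" using j1 by linarith
    then have "(LBINT x:{a..b}. \<phi> x) \<ge> - r * M" using short \<open>a \<le> b\<close> by blast
    moreover have "r * M \<ge> 0" using M0 \<open>r > 0\<close> by simp
    ultimately show ?thesis by simp
  qed
qed

text \<open>The phase has frequency \<open>2 * q * a + k\<close> at the left end of the block, large
  enough that the first two harmonics have mean at most 1/2000. The periodic minorant then keeps its
  mean 5/8 up to \<open>(2 / 3 + 1 / 24) / 2000\<close>, so at least 0.6246, and division by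
  \<open>pi^2\<close> leaves 0.0627, just above 1/16. The constant \<open>c\<close> is arbitrary
  because it only rotates the phase.\<close>

lemma block_square_bound:
  fixes f :: "real \<Rightarrow> real"
  assumes [measurable]: "f \<in> borel_measurable borel" and B: "\<And>s. \<bar>f s\<bar> \<le> B"
    and phase: "AE s in lborel. cis (2 * pi * f s) = \<gamma> * cis (q * s\<^sup>2 + k * s)" and "norm \<gamma> = 1"
    and "r > 0" and K: "\<bar>2 * q * a + k\<bar> \<ge> 2000 * (2 + 2 * \<bar>q\<bar> * r\<^sup>2) / r"
  shows "(LBINT s:{a..a + r}. (f s - c)\<^sup>2) \<ge> 0.0627 * r"
proof -
  define K where "K = 2 * q * a + k"
  have Kpos: "\<bar>K\<bar> \<ge> 2000 * (2 + 2 * \<bar>q\<bar> * r\<^sup>2) / r" using K by (simp add: K_def)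
  have num: "2 + 2 * \<bar>q\<bar> * r\<^sup>2 > 0" by (simp add: add_pos_nonneg)
  then have "2000 * (2 + 2 * \<bar>q\<bar> * r\<^sup>2) / r > 0" using \<open>r > 0\<close> by simp
  then have K0: "K \<noteq> 0" using Kpos by linarith
  have Kb: "(2 + 2 * \<bar>q\<bar> * r\<^sup>2) / \<bar>K\<bar> \<le> r / 2000"
    using Kpos K0 \<open>r > 0\<close> by (simp add: field_simps)
  have c_i: "set_integrable lborel {a..b} (\<lambda>s. cos (m * (f s - c)))" for m a b
    by (rule set_integrable_bounded_Icc[where B=1]) simp_all
  \<comment> \<open>The harmonic of order \<open>n\<close> multiplies both \<open>K\<close> and
    \<open>q\<close> by \<open>n\<close>, which does not worsen the oscillatory bound.\<close>
  have trig: "\<bar>LBINT s:{a..a + r}. cos (2 * pi * of_nat n * (f s - c))\<bar> \<le> r / 2000" if n: "n \<ge> 1" for n :: nat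
  proof -
    define \<delta> where "\<delta> = \<gamma> ^ n * cis (of_nat n * (q * a\<^sup>2 + k * a)) * cis (- 2 * pi * of_nat n * c)"
    have n\<delta>: "norm \<delta> = 1" by (simp add: \<delta>_def norm_mult norm_power \<open>norm \<gamma> = 1\<close>)
    have "AE y in lborel. cis (2 * pi * f (y + a)) = \<gamma> * cis (q * (y + a)\<^sup>2 + k * (y + a))"
      using phase by (subst AE_shift_iff[where P="\<lambda>s. cis (2 * pi * f s) = \<gamma> * cis (q * s\<^sup>2 + k * s)"]) measurable
    then have ae: "AE y in lborel. cis (2 * pi * of_nat n * (f (y + a) - c))
        = \<delta> * cis (of_nat n * K * y + of_nat n * q * y\<^sup>2)"
    proof eventually_elim
      case (elim y)
      have "cis (2 * pi * of_nat n * (f (y + a) - c)) = cis (2 * pi * f (y + a)) ^ n * cis (- 2 * pi * of_nat n * c)"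
        by (simp add: Complex.DeMoivre cis_mult algebra_simps)
      also have "\<dots> = \<gamma> ^ n * cis (of_nat n * (q * (y + a)\<^sup>2 + k * (y + a))) * cis (- 2 * pi * of_nat n * c)"
        by (simp add: elim power_mult_distrib Complex.DeMoivre)
      also have "cis (of_nat n * (q * (y + a)\<^sup>2 + k * (y + a)))
          = cis (of_nat n * (q * a\<^sup>2 + k * a)) * cis (of_nat n * K * y + of_nat n * q * y\<^sup>2)"
        by (simp add: cis_mult K_def power2_eq_square algebra_simps)
      finally show ?case by (simp add: \<delta>_def mult_ac)
    qed
    have ci: "set_integrable lborel {0..r} (\<lambda>y. cis (2 * pi * of_nat n * (f (y + a) - c)))"
      by (rule set_integrable_bounded_Icc[where B=1]) simp_all
    have "(LBINT s:{a..a + r}. cos (2 * pi * of_nat n * (f s - c)))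
        = (LBINT y:{0..r}. cos (2 * pi * of_nat n * (f (y + a) - c)))"
      using set_integral_shift[of 0 r "\<lambda>s. cos (2 * pi * of_nat n * (f s - c))" a] by (simp add: add.commute)
    also have "\<dots> = (LBINT y:{0..r}. Re (cis (2 * pi * of_nat n * (f (y + a) - c))))" by simp
    also have "\<dots> = Re (LBINT y:{0..r}. cis (2 * pi * of_nat n * (f (y + a) - c)))"
      using ci unfolding set_lebesgue_integral_def set_integrable_def
      by (subst integral_Re[symmetric]) simp_all
    also have "\<bar>\<dots>\<bar> \<le> norm (LBINT y:{0..r}. cis (2 * pi * of_nat n * (f (y + a) - c)))"
      by (rule abs_Re_le_cmod)
    also have "(LBINT y:{0..r}. cis (2 * pi * of_nat n * (f (y + a) - c)))
        = (LBINT y:{0..r}. \<delta> * cis (of_nat n * K * y + of_nat n * q * y\<^sup>2))"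
      by (rule set_lebesgue_integral_cong_AE) (use ae in auto)
    also have "norm \<dots> = norm (LBINT y:{0..r}. cis (of_nat n * K * y + of_nat n * q * y\<^sup>2))"
      by (simp add: norm_mult n\<delta>)
    also have "\<dots> \<le> 2 / \<bar>of_nat n * K\<bar> + 2 * \<bar>of_nat n * q\<bar> * r\<^sup>2 / \<bar>of_nat n * K\<bar>"
      by (rule oscillatory_integral_bound) (use K0 n \<open>r > 0\<close> in auto)
    also have "\<dots> = 2 / of_nat n / \<bar>K\<bar> + 2 * \<bar>q\<bar> * r\<^sup>2 / \<bar>K\<bar>"
      using n K0 by (simp add: abs_mult field_simps)
    also have "\<dots> \<le> 2 / \<bar>K\<bar> + 2 * \<bar>q\<bar> * r\<^sup>2 / \<bar>K\<bar>"
      using n K0 by (intro add_mono divide_right_mono) (auto simp: field_simps)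
    also have "\<dots> = (2 + 2 * \<bar>q\<bar> * r\<^sup>2) / \<bar>K\<bar>" by (simp add: add_divide_distrib)
    finally show ?thesis using Kb by linarith
  qed
  have sq_i: "set_integrable lborel {a..a + r} (\<lambda>s. (f s - c)\<^sup>2)"
  proof (rule set_integrable_bounded_Icc[where B="(B + \<bar>c\<bar>)\<^sup>2"])
    fix s
    have "\<bar>f s - c\<bar> \<le> B + \<bar>c\<bar>" using B[of s] by linarith
    then have "\<bar>f s - c\<bar>\<^sup>2 \<le> (B + \<bar>c\<bar>)\<^sup>2" by (intro power_mono) auto
    then show "norm ((f s - c)\<^sup>2) \<le> (B + \<bar>c\<bar>)\<^sup>2" by simp
  qed simp
  have c_i': "set_integrable lborel {a..a + r} (\<lambda>s. m * cos (l * (f s - c)))" for m l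
    using c_i by simp
  have const_i: "set_integrable lborel {a..a + r} (\<lambda>s. 5 / 8 :: real)"
    by (rule set_integrable_bounded_Icc[where B=1]) simp_all
  let ?T = "\<lambda>s. (5 / 8 - 2 / 3 * cos (2 * pi * (f s - c))) + 1 / 24 * cos (4 * pi * (f s - c))"
  have T1: "set_integrable lborel {a..a + r} (\<lambda>s. 5 / 8 - 2 / 3 * cos (2 * pi * (f s - c)))"
    by (intro set_integral_diff const_i c_i')
  have "(LBINT s:{a..a + r}. ?T s) = 5 / 8 * r - 2 / 3 * (LBINT s:{a..a + r}. cos (2 * pi * (f s - c)))
      + 1 / 24 * (LBINT s:{a..a + r}. cos (4 * pi * (f s - c)))"
    unfolding set_integral_add(2)[OF T1 c_i'] set_integral_diff(2)[OF const_i c_i'] set_integral_mult_right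
    using \<open>r > 0\<close> by (simp add: set_integral_const)
  moreover have "(LBINT s:{a..a + r}. ?T s) \<le> (LBINT s:{a..a + r}. pi\<^sup>2 * (f s - c)\<^sup>2)"
  proof (rule set_integral_mono)
    show "set_integrable lborel {a..a + r} ?T" by (intro set_integral_add T1 c_i')
    show "set_integrable lborel {a..a + r} (\<lambda>s. pi\<^sup>2 * (f s - c)\<^sup>2)" using sq_i by simp
  qed (rule square_ge_trig)
  moreover have "(LBINT s:{a..a + r}. pi\<^sup>2 * (f s - c)\<^sup>2) = pi\<^sup>2 * (LBINT s:{a..a + r}. (f s - c)\<^sup>2)"
    by simp
  moreover have "\<bar>LBINT s:{a..a + r}. cos (2 * pi * (f s - c))\<bar> \<le> r / 2000"
    "\<bar>LBINT s:{a..a + r}. cos (4 * pi * (f s - c))\<bar> \<le> r / 2000"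
    using trig[of 1] trig[of 2] by (simp_all add: mult_ac)
  ultimately have "pi\<^sup>2 * (LBINT s:{a..a + r}. (f s - c)\<^sup>2) \<ge> 0.6246 * r"
    using \<open>r > 0\<close> by (simp add: abs_le_iff)
  moreover have "0.0627 * r * pi\<^sup>2 \<le> 0.6246 * r"
  proof -
    have "0.0627 * r * pi\<^sup>2 \<le> 0.0627 * r * 9.961"
      using pi_square_bound \<open>r > 0\<close> by (intro mult_left_mono) auto
    also have "\<dots> \<le> 0.6246 * r" using \<open>r > 0\<close> by simp
    finally show ?thesis .
  qed
  ultimately have "pi\<^sup>2 * (0.0627 * r) \<le> pi\<^sup>2 * (LBINT s:{a..a + r}. (f s - c)\<^sup>2)"
    by (simp only: mult.commute[of "pi\<^sup>2" "0.0627 * r"])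
  then show ?thesis by (rule mult_left_le_imp_le) simp
qed

text \<open>\<open>c\<close> consists of the means of \<open>f\<close> over the blocks of a grid.
  The last estimate concerns the diagonal terms \<open>\<psi> * (\<psi> + 2 * c) - \<psi>\<close>,
  with \<open>\<psi> = f - c\<close>, that arise from squaring the field: on a block
  \<open>c\<close> is constant and \<psi> has integral 0, so only the square of \<psi>
  survives.\<close>

lemma phase_block_decomposition:
  fixes f :: "real \<Rightarrow> real"
  assumes [measurable]: "f \<in> borel_measurable borel" and B: "\<And>s. \<bar>f s\<bar> \<le> B"
    and phase: "AE s in lborel. cis (2 * pi * f s) = \<gamma> * cis (q * s\<^sup>2 + k * s)" and "norm \<gamma> = 1"
    and qk: "q \<noteq> 0 \<or> k \<noteq> 0"
  obtains c K where "c \<in> borel_measurable borel" "\<And>s. \<bar>c s\<bar> \<le> B"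
    "\<And>a b. a \<le> b \<Longrightarrow> \<bar>LBINT s:{a..b}. f s - c s\<bar> \<le> K"
    "\<And>a b. a \<le> b \<Longrightarrow> (LBINT s:{a..b}. (f s - c s)\<^sup>2 - (f s - c s) + 2 * (f s - c s) * c s)
      \<ge> 0.0627 * (b - a) - K"
proof -
  \<comment> \<open>For a linear phase the frequency is constant and a block of length
    \<open>4000 / |k|\<close> serves everywhere. For a quadratic phase the local frequency grows
    with \<open>|j|\<close>, and unit blocks serve outside a bounded range of indices.\<close>
  obtain r J :: real where r: "r > 0" "J \<ge> 0"
    and far: "\<And>j::int. \<bar>of_int j\<bar> > J \<Longrightarrow> \<bar>2 * q * (of_int j * r) + k\<bar> \<ge> 2000 * (2 + 2 * \<bar>q\<bar> * r\<^sup>2) / r"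
  proof (cases "q = 0")
    case True
    then have "k \<noteq> 0" using qk by simp
    then show ?thesis
      by (intro that[of "4000 / \<bar>k\<bar>" 0]) (auto simp: True)
  next
    case False
    define \<Lambda> where "\<Lambda> = 2000 * (2 + 2 * \<bar>q\<bar>)"
    show ?thesis
    proof (rule that[of 1 "(\<Lambda> + \<bar>k\<bar>) / (2 * \<bar>q\<bar>)"])
      show "(\<Lambda> + \<bar>k\<bar>) / (2 * \<bar>q\<bar>) \<ge> 0" by (simp add: \<Lambda>_def)
      fix j :: int assume "\<bar>real_of_int j\<bar> > (\<Lambda> + \<bar>k\<bar>) / (2 * \<bar>q\<bar>)"
      then have "\<Lambda> + \<bar>k\<bar> < \<bar>real_of_int j\<bar> * (2 * \<bar>q\<bar>)" using False by (simp add: field_simps)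
      also have "\<dots> = \<bar>2 * q * real_of_int j\<bar>" by (simp add: abs_mult)
      finally show "\<bar>2 * q * (real_of_int j * 1) + k\<bar> \<ge> 2000 * (2 + 2 * \<bar>q\<bar> * 1\<^sup>2) / 1"
        by (simp add: \<Lambda>_def)
    qed simp
  qed
  have B0: "B \<ge> 0" using B[of 0] by linarith
  have fi: "set_integrable lborel {a..b} f" for a b
    by (rule set_integrable_bounded_Icc[where B=B]) (use B in auto)
  define C where "C j = (LBINT s:{of_int j * r..of_int j * r + r}. f s) / r" for j :: int
  define c where "c s = C \<lfloor>s / r\<rfloor>" for s
  have CB: "\<bar>C j\<bar> \<le> B" for j
  proof -
    have "\<bar>LBINT s:{of_int j * r..of_int j * r + r}. f s\<bar> \<le> B * (of_int j * r + r - of_int j * r)"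
      by (rule set_integral_abs_bound) (use B r in auto)
    then show ?thesis using r by (simp add: C_def field_simps)
  qed
  have cB: "\<bar>c s\<bar> \<le> B" for s by (simp add: c_def CB)
  have [measurable]: "c \<in> borel_measurable borel"
    unfolding c_def by measurable
  \<comment> \<open>At the right end of a closed block the floor has already jumped, hence one
    exceptional point.\<close>
  have c_block: "AE s in lborel. s \<in> {of_int j * r..of_int j * r + r} \<longrightarrow> c s = C j" for j
    using AE_lborel_singleton[of "of_int j * r + r"]
  proof eventually_elim
    case (elim s)
    have "\<lfloor>s / r\<rfloor> = j" if "s \<in> {of_int j * r..of_int j * r + r}"
      using that elim r by (intro floor_unique) (auto simp: field_simps)
    then show ?case by (auto simp: c_def)
  qed
  define \<psi> where "\<psi> s = f s - c s" for s
  have [measurable]: "\<psi> \<in> borel_measurable borel" unfolding \<psi>_def by measurable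
  have \<psi>B: "\<bar>\<psi> s\<bar> \<le> 2 * B" for s using B[of s] cB[of s] unfolding \<psi>_def by linarith
  have zero: "(LBINT s:{of_int j * r..of_int j * r + r}. \<psi> s) = 0" for j
  proof -
    have ci: "set_integrable lborel {of_int j * r..of_int j * r + r} (\<lambda>s. C j)"
      by (rule set_integrable_bounded_Icc[where B=B]) (use CB in auto)
    have "(LBINT s:{of_int j * r..of_int j * r + r}. \<psi> s) = (LBINT s:{of_int j * r..of_int j * r + r}. f s - C j)"
      using c_block[of j] by (intro set_lebesgue_integral_cong_AE) (auto simp: \<psi>_def elim: eventually_mono)
    also have "\<dots> = 0"
      unfolding set_integral_diff(2)[OF fi ci] using r by (simp add: set_integral_const C_def)
    finally show ?thesis .
  qed
  \<comment> \<open>Covers the blocks near the origin, where the phase may be slow. There the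
    missing 0.0627 is added back, at a bounded total cost.\<close>
  define \<omega> where "\<omega> s = (indicator {- (J + 1) * r..(J + 1) * r} s :: real)" for s
  define h where "h s = (\<psi> s)\<^sup>2 - \<psi> s + 2 * \<psi> s * c s" for s
  have [measurable]: "\<omega> \<in> borel_measurable borel" "h \<in> borel_measurable borel"
    unfolding \<omega>_def h_def by measurable
  have \<psi>sq: "(\<psi> s)\<^sup>2 \<le> 4 * B\<^sup>2" for s
  proof -
    have "\<bar>\<psi> s\<bar>\<^sup>2 \<le> (2 * B)\<^sup>2" using \<psi>B by (intro power_mono) auto
    then show ?thesis by (simp add: power_mult_distrib)
  qed
  have \<psi>c: "\<bar>\<psi> s * c s\<bar> \<le> 2 * B * B" for s
    unfolding abs_mult using \<psi>B cB B0 by (intro mult_mono) auto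
  define M where "M = 8 * B\<^sup>2 + 2 * B + 1"
  have M0: "M \<ge> 0" using B0 by (simp add: M_def)
  have gB: "\<bar>h s - 0.0627 + 0.0627 * \<omega> s\<bar> \<le> M" for s
  proof -
    have "\<bar>h s\<bar> \<le> 4 * B\<^sup>2 + 2 * B + 4 * (B * B)"
      using \<psi>sq[of s] \<psi>c[of s] \<psi>B[of s] zero_le_power2[of "\<psi> s"] unfolding h_def by linarith
    moreover have "\<omega> s = 0 \<or> \<omega> s = 1" by (simp add: \<omega>_def indicator_def)
    ultimately show ?thesis unfolding M_def power2_eq_square by (auto simp: abs_le_iff)
  qed
  have h_block: "(LBINT s:{of_int j * r..of_int j * r + r}. h s - 0.0627 + 0.0627 * \<omega> s) \<ge> 0" for j
  proof -
    let ?I = "{of_int j * r..of_int j * r + r}"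
    have sqi: "set_integrable lborel ?I (\<lambda>s. (\<psi> s)\<^sup>2)"
      by (rule set_integrable_bounded_Icc[where B="4 * B\<^sup>2"]) (use \<psi>sq in auto)
    have \<psi>i: "set_integrable lborel ?I (\<lambda>s. m * \<psi> s)" for m
      by (rule set_integrable_bounded_Icc[where B="\<bar>m\<bar> * (2 * B)"])
        (use \<psi>B in \<open>auto simp: abs_mult intro!: mult_left_mono\<close>)
    have \<omega>i: "set_integrable lborel ?I (\<lambda>s. 0.0627 * \<omega> s - 0.0627)"
      by (rule set_integrable_bounded_Icc[where B=1]) (auto simp: \<omega>_def indicator_def)
    have "(LBINT s:?I. h s - 0.0627 + 0.0627 * \<omega> s)
        = (LBINT s:?I. ((\<psi> s)\<^sup>2 + (2 * C j - 1) * \<psi> s) + (0.0627 * \<omega> s - 0.0627))"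
      using c_block[of j]
      by (intro set_lebesgue_integral_cong_AE) (auto simp: h_def algebra_simps elim: eventually_mono)
    also have "\<dots> = (LBINT s:?I. (\<psi> s)\<^sup>2) + (LBINT s:?I. 0.0627 * \<omega> s - 0.0627)"
      unfolding set_integral_add(2)[OF set_integral_add(1)[OF sqi \<psi>i] \<omega>i] set_integral_add(2)[OF sqi \<psi>i]
      by (simp add: zero)
    also have "\<dots> \<ge> 0"
    proof (cases "\<bar>of_int j\<bar> > J")
      case True
      have "(LBINT s:?I. (\<psi> s)\<^sup>2) = (LBINT s:?I. (f s - C j)\<^sup>2)"
        using c_block[of j] by (intro set_lebesgue_integral_cong_AE) (auto simp: \<psi>_def elim: eventually_mono)
      also have "\<dots> \<ge> 0.0627 * r"
        by (rule block_square_bound[OF _ B phase \<open>norm \<gamma> = 1\<close> r(1)]) (use far[OF True] in simp_all)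
      finally have "(LBINT s:?I. (\<psi> s)\<^sup>2) \<ge> 0.0627 * r" .
      moreover have "(LBINT s:?I. - 0.0627) \<le> (LBINT s:?I. 0.0627 * \<omega> s - 0.0627)"
        by (rule set_integral_mono[OF _ \<omega>i])
          (auto simp: \<omega>_def indicator_def intro!: set_integrable_bounded_Icc[where B=1])
      ultimately show ?thesis using r by (simp add: set_integral_const)
    next
      case False
      have "\<omega> s = 1" if "s \<in> ?I" for s
      proof -
        have "- J \<le> of_int j" "of_int j \<le> J" using False by auto
        have "- J * r \<le> of_int j * r" by (rule mult_right_mono) (use \<open>- J \<le> of_int j\<close> r in auto)
        moreover have "of_int j * r \<le> J * r" by (rule mult_right_mono) (use \<open>of_int j \<le> J\<close> r in auto)
        moreover have "(J + 1) * r = J * r + r" "- (J + 1) * r = - J * r - r" by (simp_all add: algebra_simps)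
        ultimately have "s \<in> {- (J + 1) * r..(J + 1) * r}"
          using that r unfolding atLeastAtMost_iff by linarith
        then show ?thesis by (simp add: \<omega>_def)
      qed
      then have "(LBINT s:?I. 0.0627 * \<omega> s - 0.0627) = (LBINT s:?I. 0 :: real)"
        by (intro set_lebesgue_integral_cong) auto
      moreover have "(LBINT s:?I. (\<psi> s)\<^sup>2) \<ge> 0"
        unfolding set_lebesgue_integral_def by (intro integral_nonneg_AE) (auto simp: indicator_def)
      ultimately show ?thesis by simp
    qed
    finally show ?thesis .
  qed
  \<comment> \<open>The summands account for the incomplete end blocks in the second estimate, for
    the range covered by \<omega>, and for the end blocks in the integral of \<psi>.\<close>
  define K where "K = 2 * r * M + 2 * (J + 1) * r + 4 * r * B"
  show ?thesis
  proof (rule that[of c K])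
    show "\<bar>LBINT s:{a..b}. f s - c s\<bar> \<le> K" if "a \<le> b" for a b
    proof -
      have "(LBINT s:{a..b}. \<psi> s) \<ge> - 2 * r * (2 * B)"
        by (rule block_integral_lower_bound[OF _ \<psi>B r(1) _ that]) (simp_all add: zero)
      moreover have "(LBINT s:{a..b}. - \<psi> s) \<ge> - 2 * r * (2 * B)"
      proof (rule block_integral_lower_bound[OF _ _ r(1) _ that])
        have "set_integrable lborel {a..b} \<psi>" for a b
          by (rule set_integrable_bounded_Icc[where B="2 * B"]) (use \<psi>B in auto)
        then show "0 \<le> (LBINT x:{of_int j * r..of_int j * r + r}. - \<psi> x)" for j :: int
          by (simp add: set_integral_uminus zero)
      qed (use \<psi>B in auto)
      moreover have "set_integrable lborel {a..b} \<psi>"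
        by (rule set_integrable_bounded_Icc[where B="2 * B"]) (use \<psi>B in auto)
      ultimately have "\<bar>LBINT s:{a..b}. \<psi> s\<bar> \<le> 4 * r * B"
        by (simp add: set_integral_uminus abs_le_iff)
      also have "\<dots> \<le> K" using r M0 by (simp add: K_def)
      finally show ?thesis by (simp add: \<psi>_def)
    qed
    show "(LBINT s:{a..b}. (f s - c s)\<^sup>2 - (f s - c s) + 2 * (f s - c s) * c s) \<ge> 0.0627 * (b - a) - K"
      if "a \<le> b" for a b
    proof -
      have hB: "\<bar>h s\<bar> \<le> M" for s
        using \<psi>sq[of s] \<psi>c[of s] \<psi>B[of s] zero_le_power2[of "\<psi> s"] unfolding h_def M_def power2_eq_square by linarith
      have hi: "set_integrable lborel {a..b} h"
        by (rule set_integrable_bounded_Icc[where B=M]) (use hB in auto)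
      have ci: "set_integrable lborel {a..b} (\<lambda>s. 0.0627 :: real)"
        by (rule set_integrable_bounded_Icc[where B=1]) auto
      have \<omega>i: "set_integrable lborel {a..b} (\<lambda>s. 0.0627 * \<omega> s)"
        by (rule set_integrable_bounded_Icc[where B=1]) (auto simp: \<omega>_def indicator_def)
      have "- 2 * r * M \<le> (LBINT s:{a..b}. h s - 0.0627 + 0.0627 * \<omega> s)"
        by (rule block_integral_lower_bound[OF _ gB r(1) h_block that]) simp
      also have "\<dots> = (LBINT s:{a..b}. h s) - 0.0627 * (b - a) + (LBINT s:{a..b}. 0.0627 * \<omega> s)"
        unfolding set_integral_add(2)[OF set_integral_diff(1)[OF hi ci] \<omega>i] set_integral_diff(2)[OF hi ci]
        using that by (simp add: set_integral_const)
      also have "(LBINT s:{a..b}. 0.0627 * \<omega> s) \<le> 2 * (J + 1) * r"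
      proof -
        have "(LBINT s:{a..b}. 0.0627 * \<omega> s) \<le> (\<integral>s. \<omega> s \<partial>lborel)"
          unfolding set_lebesgue_integral_def
        proof (rule integral_mono)
          show "integrable lborel (\<lambda>s. indicator {a..b} s *\<^sub>R (0.0627 * \<omega> s))"
            using \<omega>i by (simp add: set_integrable_def)
          show "integrable lborel \<omega>"
            unfolding \<omega>_def by (rule integrable_real_indicator) (auto simp: emeasure_lborel_Icc_eq)
        qed (auto simp: \<omega>_def indicator_def)
        also have "\<dots> = 2 * (J + 1) * r"
          unfolding \<omega>_def using r by (simp add: algebra_simps)
        finally show ?thesis .
      qed
      finally have "- 2 * r * M \<le> (LBINT s:{a..b}. h s) - 0.0627 * (b - a) + 2 * (J + 1) * r" by simp
      moreover have "4 * r * B \<ge> 0" using r B0 by simp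
      ultimately have "0.0627 * (b - a) - K \<le> (LBINT s:{a..b}. h s)"
        unfolding K_def by linarith
      then show ?thesis by (simp only: h_def \<psi>_def)
    qed
  qed (use cB in auto)
qed


section \<open>The variance of four phases\<close>

lemma integral_affine_interval_bound:
  fixes \<phi> :: "real \<Rightarrow> real"
  assumes K: "\<And>a b. a \<le> b \<Longrightarrow> \<bar>LBINT s:{a..b}. \<phi> s\<bar> \<le> K" and "m \<noteq> 0" "p \<le> q"
  shows "\<bar>LBINT t:{p..q}. \<phi> (v + m * t)\<bar> \<le> K / \<bar>m\<bar>"
proof -
  obtain l u where lu: "l \<le> u" "\<And>t. v + m * t \<in> {l..u} \<longleftrightarrow> t \<in> {p..q}"
  proof (cases "m > 0")
    case True
    then show ?thesis
      using \<open>p \<le> q\<close> by (intro that[of "v + m * p" "v + m * q"]) auto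
  next
    case False
    then have "m < 0" using \<open>m \<noteq> 0\<close> by simp
    then show ?thesis
      using \<open>p \<le> q\<close> by (intro that[of "v + m * q" "v + m * p"]) auto
  qed
  have "(LBINT s:{l..u}. \<phi> s) = \<bar>m\<bar> * (LBINT t:{p..q}. \<phi> (v + m * t))"
    unfolding set_lebesgue_integral_def
    by (subst lborel_integral_real_affine[OF \<open>m \<noteq> 0\<close>, of _ v]) (simp add: indicator_def lu(2) del: atLeastAtMost_iff)
  then show ?thesis
    using K[OF lu(1)] \<open>m \<noteq> 0\<close> by (simp add: abs_mult field_simps)
qed

section \<open>Integrals over large squares in space-time\<close>

definition square_integral :: "real \<Rightarrow> (real \<Rightarrow> real \<Rightarrow> real) \<Rightarrow> real" where
  "square_integral R h = (LBINT t:{-R..R}. LBINT x:{-R..R}. h x t)"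

definition bounded_plane :: "(real \<Rightarrow> real \<Rightarrow> real) \<Rightarrow> bool" where
  "bounded_plane h \<longleftrightarrow> (\<lambda>p. h (fst p) (snd p)) \<in> borel_measurable (borel \<Otimes>\<^sub>M borel)
     \<and> (\<exists>B. \<forall>x t. \<bar>h x t\<bar> \<le> B)"

lemma bounded_plane_add:
  assumes "bounded_plane h1" "bounded_plane h2"
  shows "bounded_plane (\<lambda>x t. h1 x t + h2 x t)"
proof -
  obtain B1 B2 where "\<And>x t. \<bar>h1 x t\<bar> \<le> B1" "\<And>x t. \<bar>h2 x t\<bar> \<le> B2"
    using assms unfolding bounded_plane_def by blast
  then have "\<bar>h1 x t + h2 x t\<bar> \<le> B1 + B2" for x t
    by (meson abs_triangle_ineq add_mono order_trans)
  with assms show ?thesis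
    unfolding bounded_plane_def by auto
qed

lemma bounded_plane_sum:
  assumes "finite A" "\<And>i. i \<in> A \<Longrightarrow> bounded_plane (h i)"
  shows "bounded_plane (\<lambda>x t. \<Sum>i\<in>A. h i x t)"
  using assms
proof (induction A rule: finite_induct)
  case empty
  then show ?case by (auto simp: bounded_plane_def)
qed (simp add: bounded_plane_add)

lemma bounded_plane_slices:
  assumes "bounded_plane h"
  shows "set_integrable lborel {a..b} (\<lambda>x. h x t)"
    and "set_integrable lborel {c..d} (\<lambda>t. LBINT x:{a..b}. h x t)"
proof -
  have m: "(\<lambda>p. h (fst p) (snd p)) \<in> borel_measurable (borel \<Otimes>\<^sub>M borel)"
    using assms by (simp add: bounded_plane_def)
  obtain B where B: "\<And>x t. \<bar>h x t\<bar> \<le> B" using assms unfolding bounded_plane_def by blast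
  have s: "(\<lambda>x. h x t) \<in> borel_measurable borel" for t
  proof -
    have "(\<lambda>x. (x, t)) \<in> borel \<rightarrow>\<^sub>M borel \<Otimes>\<^sub>M borel" by measurable
    from measurable_compose[OF this m] show ?thesis by simp
  qed
  show 1: "set_integrable lborel {a..b} (\<lambda>x. h x t)" for t
    by (rule set_integrable_bounded_Icc[where B=B]) (use s B in auto)
  have "(\<lambda>p. h (snd p) (fst p)) \<in> borel_measurable (borel \<Otimes>\<^sub>M borel)"
    using measurable_compose[OF measurable_Pair[OF measurable_snd measurable_fst] m] by simp
  then have 2: "(\<lambda>t. LBINT x:{a..b}. h x t) \<in> borel_measurable borel"
    by (rule set_integral_measurable[of "\<lambda>t x. h x t"])
  have "\<bar>LBINT x:{a..b}. h x t\<bar> \<le> B * \<bar>b - a\<bar>" for t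
    using set_integral_abs_bound[OF s B, of a b t] B[of 0 0]
    by (cases "a \<le> b") (auto simp: set_lebesgue_integral_def)
  with 2 show "set_integrable lborel {c..d} (\<lambda>t. LBINT x:{a..b}. h x t)"
    by (intro set_integrable_bounded_Icc[where B="B * \<bar>b - a\<bar>"]) auto
qed

lemma square_integral_add:
  assumes "bounded_plane h1" "bounded_plane h2"
  shows "square_integral R (\<lambda>x t. h1 x t + h2 x t) = square_integral R h1 + square_integral R h2"
  unfolding square_integral_def
  using assms by (simp add: bounded_plane_slices set_integral_add(2))

lemma square_integral_sum:
  assumes "finite A" "\<And>i. i \<in> A \<Longrightarrow> bounded_plane (h i)"
  shows "square_integral R (\<lambda>x t. \<Sum>i\<in>A. h i x t) = (\<Sum>i\<in>A. square_integral R (h i))"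
  using assms
proof (induction A rule: finite_induct)
  case empty
  then show ?case by (simp add: square_integral_def)
next
  case (insert i A)
  then show ?case by (simp add: square_integral_add bounded_plane_sum)
qed

lemma square_integral_le:
  assumes h: "bounded_plane h" and ae: "AE p in lborel. h (fst p) (snd p) \<le> M" and "R \<ge> 0"
  shows "square_integral R h \<le> 4 * R\<^sup>2 * M"
proof -
  have [measurable]: "(\<lambda>p. h (fst p) (snd p)) \<in> borel_measurable (borel \<Otimes>\<^sub>M borel)"
    using h by (simp add: bounded_plane_def)
  have ci: "set_integrable lborel {a..b} (\<lambda>x. m :: real)" for a b m :: real
    by (rule set_integrable_bounded_Icc[where B="\<bar>m\<bar>"]) auto
  have "Measurable.pred (borel \<Otimes>\<^sub>M borel) (\<lambda>p. h (fst p) (snd p) \<le> M)" by measurable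
  with ae have "AE t in lborel. AE x in lborel. h x t \<le> M"
    using AE_plane_iff(2)[of "\<lambda>x t. h x t \<le> M"] by blast
  then have "AE t in lborel. (LBINT x:{-R..R}. h x t) \<le> 2 * R * M"
  proof eventually_elim
    case (elim t)
    have "(LBINT x:{-R..R}. h x t) \<le> (LBINT x:{-R..R}. M)"
      by (rule set_integral_mono_AE[OF bounded_plane_slices(1)[OF h] ci], rule eventually_mono[OF elim]) simp
    then show ?case using \<open>R \<ge> 0\<close> by (simp add: set_integral_const)
  qed
  then have "square_integral R h \<le> (LBINT t:{-R..R}. 2 * R * M)"
    unfolding square_integral_def
    by (intro set_integral_mono_AE[OF bounded_plane_slices(2)[OF h] ci]) (auto elim: eventually_mono)
  then show ?thesis using \<open>R \<ge> 0\<close> by (simp add: set_integral_const power2_eq_square)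
qed

text \<open>Each horizontal slice of the square loses \<open>K\<close> once, so the total loss
  \<open>2 * R * K\<close> is of lower order than the area.\<close>

lemma square_integral_wave_ge:
  fixes g :: "real \<Rightarrow> real"
  assumes g: "\<And>a b. a \<le> b \<Longrightarrow> (LBINT s:{a..b}. g s) \<ge> l * (b - a) - K" and "R \<ge> 0"
    and b: "bounded_plane (\<lambda>x t. g (x - a * t))"
  shows "square_integral R (\<lambda>x t. g (x - a * t)) \<ge> 4 * R\<^sup>2 * l - 2 * R * K"
proof -
  have "(LBINT x:{-R..R}. g (x - a * t)) \<ge> 2 * R * l - K" for t
  proof -
    have "(LBINT x:{-R..R}. g (x - a * t)) = (LBINT s:{-R + - (a * t)..R + - (a * t)}. g s)"
      using set_integral_shift[of "-R" R g "- (a * t)"] by simp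
    also have "\<dots> \<ge> l * ((R + - (a * t)) - (-R + - (a * t))) - K"
      by (rule g) (use \<open>R \<ge> 0\<close> in simp)
    finally show ?thesis by (simp add: algebra_simps)
  qed
  then have "(LBINT t:{-R..R}. 2 * R * l - K) \<le> square_integral R (\<lambda>x t. g (x - a * t))"
    unfolding square_integral_def
    by (intro set_integral_mono bounded_plane_slices(2)[OF b])
      (auto intro!: set_integrable_bounded_Icc[where B="\<bar>2 * R * l - K\<bar>"])
  then show ?thesis using \<open>R \<ge> 0\<close> by (simp add: set_integral_const power2_eq_square algebra_simps)
qed

text \<open>On every line along which the second wave is constant, the first one averages out.\<close>

lemma square_integral_cross_bound:
  fixes \<phi> g :: "real \<Rightarrow> real"
  assumes [measurable]: "\<phi> \<in> borel_measurable borel" "g \<in> borel_measurable borel"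
    and M: "\<And>s. \<bar>\<phi> s\<bar> \<le> M" and N: "\<And>s. \<bar>g s\<bar> \<le> N"
    and K: "\<And>a b. a \<le> b \<Longrightarrow> \<bar>LBINT s:{a..b}. \<phi> s\<bar> \<le> K" and "a \<noteq> b" and "R \<ge> 0"
  shows "\<bar>square_integral R (\<lambda>x t. \<phi> (x - a * t) * g (x - b * t))\<bar> \<le> 2 * (1 + \<bar>b\<bar>) * N * (K / \<bar>b - a\<bar>) * R"
proof -
  \<comment> \<open>On the square \<open>|x - b * t|\<close> is at most \<open>S\<close>, so all
    shifted slices fit into \<open>{-S..S}\<close>, while \<omega> records the true domain.\<close>
  define S where "S = (1 + \<bar>b\<bar>) * R"
  have S: "S \<ge> 0" using \<open>R \<ge> 0\<close> by (simp add: S_def)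
  have K0: "K \<ge> 0" using K[of 0 0] by (metis abs_ge_zero order_refl order_trans)
  have N0: "N \<ge> 0" using N[of 0] by linarith
  have M0: "M \<ge> 0" using M[of 0] by linarith
  define \<omega> where "\<omega> v t = (indicator {-R..R} (v + b * t) :: real)" for v t
  have \<omega>01: "\<omega> v t = 0 \<or> \<omega> v t = 1" for v t by (simp add: \<omega>_def indicator_def)
  define h where "h v t = \<omega> v t * \<phi> (v + (b - a) * t) * g v" for v t
  have hm [measurable]: "(\<lambda>p. h (fst p) (snd p)) \<in> borel_measurable (borel \<Otimes>\<^sub>M borel)"
    unfolding h_def \<omega>_def by measurable
  have hB: "\<bar>h v t\<bar> \<le> M * N" for v t
  proof -
    have "\<bar>\<phi> (v + (b - a) * t) * g v\<bar> \<le> M * N"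
      unfolding abs_mult using M N M0 by (intro mult_mono) auto
    then show ?thesis using \<omega>01[of v t] M0 N0 by (auto simp: h_def)
  qed
  have slice: "(LBINT x:{-R..R}. \<phi> (x - a * t) * g (x - b * t)) = (LBINT v:{-S..S}. h v t)"
    if "t \<in> {-R..R}" for t
  proof -
    have "(LBINT x:{-R..R}. \<phi> (x - a * t) * g (x - b * t))
        = (LBINT x:{-R..R}. \<phi> ((x + - (b * t)) + (b - a) * t) * g (x + - (b * t)))"
      by (simp add: algebra_simps)
    also have "\<dots> = (LBINT v:{-R + - (b * t)..R + - (b * t)}. \<phi> (v + (b - a) * t) * g v)"
      by (rule set_integral_shift)
    also have "\<dots> = (LBINT v:{-S..S}. h v t)"
      unfolding set_lebesgue_integral_def
    proof (rule Bochner_Integration.integral_cong[OF refl])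
      fix v
      have bt: "\<bar>b * t\<bar> \<le> \<bar>b\<bar> * R"
        using that unfolding abs_mult by (intro mult_left_mono) auto
      have "v + b * t \<in> {-R..R} \<Longrightarrow> v \<in> {-S..S}"
        using bt by (auto simp: S_def algebra_simps abs_le_iff)
      then show "indicator {-R + - (b * t)..R + - (b * t)} v *\<^sub>R (\<phi> (v + (b - a) * t) * g v)
          = indicator {-S..S} v *\<^sub>R h v t"
        by (auto simp: h_def \<omega>_def indicator_def)
    qed
    finally show ?thesis .
  qed
  have "square_integral R (\<lambda>x t. \<phi> (x - a * t) * g (x - b * t)) = (LBINT t:{-R..R}. LBINT v:{-S..S}. h v t)"
    unfolding square_integral_def by (rule set_lebesgue_integral_cong) (use slice in auto)
  also have "\<dots> = (LBINT v:{-S..S}. LBINT t:{-R..R}. h v t)"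
    by (rule set_integral_swap[symmetric, OF hm hB])
  also have "\<bar>\<dots>\<bar> \<le> N * (K / \<bar>b - a\<bar>) * (S - - S)"
  proof (rule set_integral_abs_bound)
    show "(\<lambda>v. LBINT t:{-R..R}. h v t) \<in> borel_measurable borel"
      by (rule set_integral_measurable) measurable
    show "-S \<le> S" using S by simp
    fix v
    \<comment> \<open>The part of the line \<open>x - b * t = v\<close> inside the square. By
      convexity it is an interval, which the hypothesis on \<phi> requires.\<close>
    define T where "T = {t \<in> {-R..R}. v + b * t \<in> {-R..R}}"
    have "(LBINT t:{-R..R}. h v t) = g v * (LBINT t:T. \<phi> (v + (b - a) * t))"
    proof -
      have "(LBINT t:{-R..R}. h v t) = (\<integral>t. g v * (indicator T t * \<phi> (v + (b - a) * t)) \<partial>lborel)"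
        unfolding set_lebesgue_integral_def
        by (rule Bochner_Integration.integral_cong) (auto simp: h_def \<omega>_def T_def indicator_def)
      then show ?thesis by (simp add: set_lebesgue_integral_def)
    qed
    moreover have "\<bar>LBINT t:T. \<phi> (v + (b - a) * t)\<bar> \<le> K / \<bar>b - a\<bar>"
    proof (cases "T = {}")
      case True
      then show ?thesis using K0 by (simp add: set_lebesgue_integral_def)
    next
      case False
      have T_eq: "T = {-R..R} \<inter> (\<lambda>t. v + b * t) -` {-R..R}" by (auto simp: T_def)
      have "(\<lambda>t. v + b * t) -` {-R..R} = (\<lambda>t. b * t) -` {-R - v..R - v}" by auto
      then have "convex T"
        unfolding T_eq by (simp add: convex_linear_vimage convex_Int)
      moreover have "closed ((\<lambda>t. v + b * t) -` {-R..R})"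
        by (intro closed_vimage continuous_intros)
      then have "compact T"
        unfolding T_eq by (intro compact_Int_closed compact_Icc)
      ultimately obtain p q where T: "T = {p..q}"
        using is_interval_compact[of T] by (auto simp: is_interval_convex_1 cbox_interval)
      then have "p \<le> q" using False by auto
      then show ?thesis
        unfolding T using integral_affine_interval_bound[OF K] \<open>a \<noteq> b\<close> by simp
    qed
    ultimately show "\<bar>LBINT t:{-R..R}. h v t\<bar> \<le> N * (K / \<bar>b - a\<bar>)"
      using N N0 by (simp only: abs_mult) (intro mult_mono; simp)
  qed
  finally show ?thesis by (simp add: S_def mult_ac)
qed

text \<open>Split the field into \<open>Y + Z\<close>, the oscillating parts and the block means. A
  field equal to its square satisfies \<open>Y * (Y + 2 * Z) - Y = Z - Z * Z\<close>, which is at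
  most 1/4 whatever the means are. Expanded over pairs of waves, the left side has four diagonal
  terms of asymptotic mean at least 0.0627 each, and off-diagonal terms that integrate to O(R) over
  a square of area \<open>4 * R^2\<close>. But \<open>4 * 0.0627 > 1 / 4\<close>.\<close>

lemma four_phases_impossible:
  fixes f :: "nat \<Rightarrow> real \<Rightarrow> real" and a :: "nat \<Rightarrow> real"
  assumes D: "finite D" "card D = 4" and inj: "inj_on a D"
    and fm: "\<And>d. d \<in> D \<Longrightarrow> f d \<in> borel_measurable borel" and B: "\<And>d s. d \<in> D \<Longrightarrow> \<bar>f d s\<bar> \<le> B"
    and two: "AE p in lborel. (\<Sum>d\<in>D. f d (fst p - a d * snd p)) \<in> {0, 1}"
    and phase: "\<And>d. d \<in> D \<Longrightarrow> \<exists>\<gamma> q k. norm \<gamma> = 1 \<and> (q \<noteq> 0 \<or> k \<noteq> 0) \<and>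
      (AE s in lborel. cis (2 * pi * f d s) = \<gamma> * cis (q * s\<^sup>2 + k * s))"
  shows False
proof -
  define dec where "dec d c K \<longleftrightarrow> c \<in> borel_measurable borel \<and> (\<forall>s. \<bar>c s\<bar> \<le> B) \<and>
    (\<forall>a b. a \<le> b \<longrightarrow> \<bar>LBINT s:{a..b}. f d s - c s\<bar> \<le> K) \<and>
    (\<forall>a b. a \<le> b \<longrightarrow> (LBINT s:{a..b}. (f d s - c s)\<^sup>2 - (f d s - c s) + 2 * (f d s - c s) * c s)
      \<ge> 0.0627 * (b - a) - K)" for d c K
  have "\<exists>c K. dec d c K" if d: "d \<in> D" for d
  proof -
    obtain \<gamma> q k where ph: "norm \<gamma> = 1" "q \<noteq> 0 \<or> k \<noteq> 0"
      "AE s in lborel. cis (2 * pi * f d s) = \<gamma> * cis (q * s\<^sup>2 + k * s)"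
      using phase[OF d] by blast
    show ?thesis
    proof (rule phase_block_decomposition[OF fm[OF d] B[OF d] ph(3,1,2)])
      fix c K
      assume "c \<in> borel_measurable borel" "\<And>s. \<bar>c s\<bar> \<le> B"
        "\<And>a b. a \<le> b \<Longrightarrow> \<bar>LBINT s:{a..b}. f d s - c s\<bar> \<le> K"
        "\<And>a b. a \<le> b \<Longrightarrow> (LBINT s:{a..b}. (f d s - c s)\<^sup>2 - (f d s - c s) + 2 * (f d s - c s) * c s)
          \<ge> 0.0627 * (b - a) - K"
      then have "dec d c K" unfolding dec_def by blast
      then show ?thesis by blast
    qed
  qed
  then obtain c K where dec: "\<And>d. d \<in> D \<Longrightarrow> dec d (c d) (K d)"
    by metis
  have cm: "c d \<in> borel_measurable borel" and cB: "\<bar>c d s\<bar> \<le> B"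
    and K1: "a \<le> b \<Longrightarrow> \<bar>LBINT s:{a..b}. f d s - c d s\<bar> \<le> K d"
    and K2: "a \<le> b \<Longrightarrow>
      (LBINT s:{a..b}. (f d s - c d s)\<^sup>2 - (f d s - c d s) + 2 * (f d s - c d s) * c d s) \<ge> 0.0627 * (b - a) - K d"
    if "d \<in> D" for d s a b
    using dec[OF that] unfolding dec_def by blast+
  define \<psi> where "\<psi> d s = f d s - c d s" for d s
  \<comment> \<open>The second factor of a cross term. Boundedness is all that is asked of it, since
    the first factor averages out on the lines where \<open>w\<close> is constant.\<close>
  define w where "w d s = \<psi> d s + 2 * c d s" for d s
  define g where "g d s = (\<psi> d s)\<^sup>2 - \<psi> d s + 2 * \<psi> d s * c d s" for d s
  have \<psi>m [measurable]: "\<psi> d \<in> borel_measurable borel" and wm [measurable]: "w d \<in> borel_measurable borel"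
    and gm [measurable]: "g d \<in> borel_measurable borel" if "d \<in> D" for d
    using fm[OF that] cm[OF that] unfolding \<psi>_def w_def g_def by measurable
  have \<psi>B: "\<bar>\<psi> d s\<bar> \<le> 2 * B" and wB: "\<bar>w d s\<bar> \<le> 4 * B" if "d \<in> D" for d s
    using B[OF that, of s] cB[OF that, of s] unfolding \<psi>_def w_def by linarith+
  have gB: "\<bar>g d s\<bar> \<le> 2 * B * (4 * B + 1)" if "d \<in> D" for d s
  proof -
    have "g d s = \<psi> d s * (w d s - 1)" by (simp add: g_def w_def power2_eq_square algebra_simps)
    also have "\<bar>\<dots>\<bar> \<le> 2 * B * (4 * B + 1)"
      unfolding abs_mult
      by (rule mult_mono) (use \<psi>B[OF that, of s] wB[OF that, of s] in linarith)+
    finally show ?thesis .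
  qed
  define G where "G d x t = g d (x - a d * t)" for d x t
  define X where "X e x t = \<psi> (fst e) (x - a (fst e) * t) * w (snd e) (x - a (snd e) * t)" for e x t
  \<comment> \<open>Ordered pairs, because \<open>Y * (Y + 2 * Z)\<close> treats its two factors
    differently.\<close>
  define P where "P = {e \<in> D \<times> D. fst e \<noteq> snd e}"
  have finP: "finite P" using D(1) by (simp add: P_def)
  have bG: "bounded_plane (G d)" if "d \<in> D" for d
  proof -
    have "(\<lambda>p. g d (fst p - a d * snd p)) \<in> borel_measurable (borel \<Otimes>\<^sub>M borel)"
      by (rule measurable_compose[OF _ gm[OF that]]) measurable
    then show ?thesis unfolding bounded_plane_def G_def using gB[OF that] by blast
  qed
  have bX: "bounded_plane (X e)" if "e \<in> P" for e
  proof -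
    obtain d d' where e: "e = (d, d')" "d \<in> D" "d' \<in> D"
      using \<open>e \<in> P\<close> by (cases e) (auto simp: P_def)
    have "(\<lambda>p. \<psi> d (fst p - a d * snd p)) \<in> borel_measurable (borel \<Otimes>\<^sub>M borel)"
      by (rule measurable_compose[OF _ \<psi>m[OF e(2)]]) measurable
    moreover have "(\<lambda>p. w d' (fst p - a d' * snd p)) \<in> borel_measurable (borel \<Otimes>\<^sub>M borel)"
      by (rule measurable_compose[OF _ wm[OF e(3)]]) measurable
    moreover have "\<bar>\<psi> d s * w d' s'\<bar> \<le> 2 * B * (4 * B)" for s s'
      unfolding abs_mult
      by (rule mult_mono) (use \<psi>B[OF e(2), of s] wB[OF e(3), of s'] in linarith)+
    ultimately show ?thesis unfolding bounded_plane_def X_def e by auto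
  qed
  define H where "H x t = (\<Sum>d\<in>D. G d x t) + (\<Sum>e\<in>P. X e x t)" for x t
  have bGs: "bounded_plane (\<lambda>x t. \<Sum>d\<in>D. G d x t)" and bXs: "bounded_plane (\<lambda>x t. \<Sum>e\<in>P. X e x t)"
    using bounded_plane_sum[OF D(1), of G] bounded_plane_sum[OF finP, of X] bG bX by blast+
  have bH: "bounded_plane H" unfolding H_def by (rule bounded_plane_add[OF bGs bXs])
  have ae: "AE p in lborel. H (fst p) (snd p) \<le> 1 / 4"
    using two
  proof eventually_elim
    case (elim p)
    define y where "y d = \<psi> d (fst p - a d * snd p)" for d
    define z where "z d = c d (fst p - a d * snd p)" for d
    define Y where "Y = (\<Sum>d\<in>D. y d)"
    define Z where "Z = (\<Sum>d\<in>D. z d)"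
    have F: "(\<Sum>d\<in>D. f d (fst p - a d * snd p)) = Y + Z"
      unfolding Y_def Z_def sum.distrib[symmetric] y_def z_def \<psi>_def by simp
    have W: "Y + 2 * Z = (\<Sum>d'\<in>D. y d' + 2 * z d')"
      by (simp add: Y_def Z_def sum.distrib sum_distrib_left)
    have "Y * (Y + 2 * Z) = (\<Sum>d\<in>D. \<Sum>d'\<in>D. y d * (y d' + 2 * z d'))"
      unfolding W unfolding Y_def by (rule sum_product)
    also have "\<dots> = (\<Sum>e\<in>D \<times> D. y (fst e) * (y (snd e) + 2 * z (snd e)))"
      by (simp add: sum.cartesian_product case_prod_unfold)
    also have "D \<times> D = P \<union> (\<lambda>d. (d, d)) ` D" by (auto simp: P_def)
    also have "(\<Sum>e\<in>P \<union> (\<lambda>d. (d, d)) ` D. y (fst e) * (y (snd e) + 2 * z (snd e)))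
        = (\<Sum>e\<in>P. y (fst e) * (y (snd e) + 2 * z (snd e))) + (\<Sum>d\<in>D. y d * (y d + 2 * z d))"
      using finP D(1)
      by (subst sum.union_disjoint) (auto simp: P_def sum.reindex inj_on_def)
    finally have "Y * (Y + 2 * Z) - Y = H (fst p) (snd p)"
      unfolding H_def G_def X_def g_def w_def y_def[symmetric] z_def[symmetric] Y_def
      by (simp add: sum.distrib sum_subtractf power2_eq_square algebra_simps)
    moreover have "Y * (Y + 2 * Z) - Y = Z - Z * Z"
    proof -
      have "(Y + Z) * (Y + Z) = Y + Z" using elim unfolding F by auto
      then show ?thesis by (simp add: algebra_simps)
    qed
    moreover have "Z - Z * Z \<le> 1 / 4"
      using zero_le_square[of "Z - 1 / 2"] by (simp add: algebra_simps)
    ultimately show ?case by simp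
  qed
  define C where "C e = 2 * (1 + \<bar>a (snd e)\<bar>) * (4 * B) * (K (fst e) / \<bar>a (snd e) - a (fst e)\<bar>)" for e
  define T where "T = (\<Sum>d\<in>D. 2 * K d) + (\<Sum>e\<in>P. C e)"
  have low: "R\<^sup>2 * 1.0032 - R * T \<le> R\<^sup>2" if "R \<ge> 0" for R
  proof -
    have "4 * R\<^sup>2 * 0.0627 - 2 * R * K d \<le> square_integral R (G d)" if "d \<in> D" for d
    proof -
      have G: "G d = (\<lambda>x t. g d (x - a d * t))" by (simp add: G_def fun_eq_iff)
      have K2': "(LBINT s:{p..q}. g d s) \<ge> 0.0627 * (q - p) - K d" if "p \<le> q" for p q
        unfolding g_def \<psi>_def by (rule K2[OF \<open>d \<in> D\<close> that])
      show ?thesis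
        using square_integral_wave_ge[OF K2' \<open>R \<ge> 0\<close> bG[OF that, unfolded G]] unfolding G .
    qed
    then have "(\<Sum>d\<in>D. 4 * R\<^sup>2 * 0.0627 - 2 * R * K d) \<le> (\<Sum>d\<in>D. square_integral R (G d))"
      by (rule sum_mono)
    moreover have "(\<Sum>d\<in>D. 4 * R\<^sup>2 * 0.0627 - 2 * R * K d) = R\<^sup>2 * 1.0032 - R * (\<Sum>d\<in>D. 2 * K d)"
      using D(2) by (simp add: sum_subtractf sum_distrib_left mult_ac)
    moreover have "- (C e * R) \<le> square_integral R (X e)" if "e \<in> P" for e
    proof -
      obtain d d' where e: "e = (d, d')" "d \<in> D" "d' \<in> D" "d \<noteq> d'"
        using \<open>e \<in> P\<close> by (cases e) (auto simp: P_def)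
      then have "a d \<noteq> a d'" using inj by (auto dest: inj_onD)
      moreover have "\<bar>LBINT s:{p..q}. \<psi> d s\<bar> \<le> K d" if "p \<le> q" for p q
        unfolding \<psi>_def by (rule K1[OF e(2) that])
      ultimately have "\<bar>square_integral R (\<lambda>x t. \<psi> d (x - a d * t) * w d' (x - a d' * t))\<bar>
          \<le> 2 * (1 + \<bar>a d'\<bar>) * (4 * B) * (K d / \<bar>a d' - a d\<bar>) * R"
        using \<open>R \<ge> 0\<close>
        by (intro square_integral_cross_bound[OF \<psi>m[OF e(2)] wm[OF e(3)] \<psi>B[OF e(2)] wB[OF e(3)]]) auto
      moreover have "X e = (\<lambda>x t. \<psi> d (x - a d * t) * w d' (x - a d' * t))"
        by (simp add: X_def e fun_eq_iff)
      ultimately show ?thesis by (simp add: C_def e abs_le_iff)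
    qed
    then have "(\<Sum>e\<in>P. - (C e * R)) \<le> (\<Sum>e\<in>P. square_integral R (X e))"
      by (rule sum_mono)
    moreover have "(\<Sum>e\<in>P. - (C e * R)) = - (R * (\<Sum>e\<in>P. C e))"
      by (simp add: sum_negf sum_distrib_left mult_ac)
    moreover have "square_integral R H = (\<Sum>d\<in>D. square_integral R (G d)) + (\<Sum>e\<in>P. square_integral R (X e))"
      unfolding H_def square_integral_add[OF bGs bXs]
      using square_integral_sum[OF D(1), of G] square_integral_sum[OF finP, of X] bG bX by metis
    moreover have "square_integral R H \<le> 4 * R\<^sup>2 * (1 / 4)"
      by (rule square_integral_le[OF bH ae \<open>R \<ge> 0\<close>])
    ultimately show ?thesis unfolding T_def by (simp add: algebra_simps)
  qed
  \<comment> \<open>The surplus per unit of \<open>R^2\<close> is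
    \<open>0.0032 = 16 * 0.0627 - 1\<close>, and 1000 times this exceeds 1.\<close>
  define R where "R = (\<bar>T\<bar> + 1) * 1000"
  have "R > 0" by (simp add: R_def)
  have "R * (R * 0.0032) \<le> R * T"
    using low[of R] \<open>R > 0\<close> by (simp add: power2_eq_square algebra_simps)
  then have "R * 0.0032 \<le> T" using \<open>R > 0\<close> by (rule mult_left_le_imp_le)
  then show False unfolding R_def by (simp add: abs_if split: if_splits)
qed

section \<open>Phases of a solution\<close>

lemma AE_lebesgue_iff: "(AE x in lebesgue. P x) \<longleftrightarrow> (AE x in lborel. P x)"
  by (rule AE_completion_iff)

text \<open>Boundedness of the profiles is a pointwise hypothesis and has to survive the change of
  representative. Using the value \<open>f 0\<close> on the exceptional null set keeps the range
  inside that of \<open>f\<close>.\<close>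

lemma borel_representative:
  fixes f :: "real \<Rightarrow> real"
  assumes "f \<in> borel_measurable lebesgue"
  obtains g where "g \<in> borel_measurable borel" "AE s in lborel. f s = g s" "range g \<subseteq> range f"
proof -
  obtain g0 where g0: "g0 \<in> borel_measurable borel" "AE s in lborel. f s = g0 s"
    using completion_ex_borel_measurable_real[OF assms] by auto
  obtain N where N: "N \<in> null_sets lborel" "{s \<in> space lborel. f s \<noteq> g0 s} \<subseteq> N"
    using g0(2) unfolding eventually_ae_filter by blast
  have [measurable]: "N \<in> sets borel" using N(1) by (simp add: null_sets_def)
  have fg: "f s = g0 s" if "s \<notin> N" for s using N(2) that by auto
  show ?thesis
  proof (rule that[of "\<lambda>s. if s \<in> N then f 0 else g0 s"])
    show "(\<lambda>s. if s \<in> N then f 0 else g0 s) \<in> borel_measurable borel"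
      using g0(1) by measurable
    show "AE s in lborel. f s = (if s \<in> N then f 0 else g0 s)"
      using AE_not_in[OF N(1)] by eventually_elim (simp add: fg)
    show "range (\<lambda>s. if s \<in> N then f 0 else g0 s) \<subseteq> range f"
    proof (rule image_subsetI)
      fix s show "(if s \<in> N then f 0 else g0 s) \<in> range f"
        using fg[of s] rangeI[of f s] by (cases "s \<in> N") simp_all
    qed
  qed
qed

lemma wave_solution_borel:
  assumes "wave_solution n a f"
  obtains g where "\<forall>d\<in>{1..n}. g d \<in> borel_measurable borel \<and> (AE s in lborel. f d s = g d s) \<and>
      range (g d) \<subseteq> range (f d) \<and> \<not> (\<exists>c. AE s in lborel. g d s = c)"
    "AE p in lborel. superposition n a f (fst p) (snd p) = (\<Sum>d=1..n. g d (fst p - a d * snd p))"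
    "AE p in lborel. (\<Sum>d=1..n. g d (fst p - a d * snd p)) \<in> {0, 1}"
proof -
  have "\<forall>d\<in>{1..n}. \<exists>g. g \<in> borel_measurable borel \<and> (AE s in lborel. f d s = g s) \<and> range g \<subseteq> range (f d)"
  proof
    fix d assume "d \<in> {1..n}"
    then have "f d \<in> borel_measurable lebesgue" using assms by (simp add: wave_solution_def)
    then show "\<exists>g. g \<in> borel_measurable borel \<and> (AE s in lborel. f d s = g s) \<and> range g \<subseteq> range (f d)"
      by (rule borel_representative) blast
  qed
  from bchoice[OF this] obtain g where g: "\<And>d. d \<in> {1..n} \<Longrightarrow>
      g d \<in> borel_measurable borel \<and> (AE s in lborel. f d s = g d s) \<and> range (g d) \<subseteq> range (f d)"
    by blast
  have "AE p in lborel. \<forall>d\<in>{1..n}. f d (fst p - a d * snd p) = g d (fst p - a d * snd p)"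
  proof (rule AE_finite_allI)
    fix d assume "d \<in> {1..n}"
    then show "AE p in lborel. f d (fst p - a d * snd p) = g d (fst p - a d * snd p)"
      using AE_plane_characteristic[of "\<lambda>s. f d s = g d s"] g by blast
  qed simp
  then have eq: "AE p in lborel. superposition n a f (fst p) (snd p) = (\<Sum>d=1..n. g d (fst p - a d * snd p))"
    by (rule eventually_mono) (simp add: superposition_def)
  have "AE p in lborel. superposition n a f (fst p) (snd p) \<in> {0, 1}"
    using assms by (simp add: wave_solution_def AE_lebesgue_iff)
  with eq have two: "AE p in lborel. (\<Sum>d=1..n. g d (fst p - a d * snd p)) \<in> {0, 1}"
    by eventually_elim simp
  have nonconst: "\<not> (\<exists>c. AE s in lborel. g d s = c)" if d: "d \<in> {1..n}" for d
  proof
    assume "\<exists>c. AE s in lborel. g d s = c"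
    then obtain c where c: "AE s in lborel. g d s = c" by blast
    have "AE s in lborel. f d s = g d s" using g[OF d] by blast
    with c have "AE s in lborel. f d s = c" by eventually_elim simp
    then show False using assms d by (auto simp: wave_solution_def AE_lebesgue_iff)
  qed
  show ?thesis
    by (rule that[OF _ eq two]) (use g nonconst in blast)
qed

section \<open>Phases modulo 1 and the resonance relations\<close>

lemma unimodular_eq_cis:
  assumes "norm \<gamma> = 1"
  obtains c where "\<gamma> = cis (2 * pi * c)"
proof
  have "\<gamma> \<noteq> 0" using assms by auto
  then show "\<gamma> = cis (2 * pi * (Arg \<gamma> / (2 * pi)))"
    using assms by (simp add: cis_Arg sgn_eq)
qed

lemma cis_2pi_eq_1_iff: "cis (2 * pi * x) = 1 \<longleftrightarrow> x \<in> \<int>"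
proof
  assume "cis (2 * pi * x) = 1"
  then have "cos (2 * pi * x) = 1" by (simp add: complex_eq_iff)
  then obtain n :: int where "2 * pi * x = of_int n * 2 * pi"
    using cos_one_2pi_int by auto
  then have "2 * pi * x = 2 * pi * of_int n" by (simp add: mult_ac)
  then have "x = of_int n" by (simp only: mult_cancel_left) auto
  then show "x \<in> \<int>" by simp
next
  assume "x \<in> \<int>"
  then show "cis (2 * pi * x) = 1" by (simp add: cis_multiple_2pi)
qed

lemma phase_shift_Ints:
  assumes "norm \<gamma> = 1" "AE s in lborel. cis (2 * pi * g s) = \<gamma> * cis (2 * pi * h s)"
  obtains c where "AE s in lborel. g s - h s - c \<in> \<int>"
proof -
  obtain c where c: "\<gamma> = cis (2 * pi * c)" using unimodular_eq_cis[OF assms(1)] .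
  show ?thesis
  proof
    show "AE s in lborel. g s - h s - c \<in> \<int>"
      using assms(2)
    proof eventually_elim
      case (elim s)
      have "2 * pi * (g s - h s - c) = 2 * pi * g s - (2 * pi * c + 2 * pi * h s)"
        by (simp add: algebra_simps)
      then have "cis (2 * pi * (g s - h s - c)) = cis (2 * pi * g s) / (\<gamma> * cis (2 * pi * h s))"
        by (simp only: cis_divide[symmetric] cis_mult[symmetric] c)
      then show ?case
        unfolding cis_2pi_eq_1_iff[symmetric] by (simp add: elim c cis_neq_zero)
    qed
  qed
qed

text \<open>A constant phase is a fixed residue modulo 1, so integrality up to a constant becomes
  the vanishing of a wavenumber.\<close>

lemma integer_valued_iff_phase:
  assumes "AE s in lborel. f s = g s" "norm \<gamma> = 1"
    and phase: "AE s in lborel. cis (2 * pi * g s) = \<gamma> * cis (k * s)"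
  shows "integer_valued f \<longleftrightarrow> k = 0"
proof
  assume "integer_valued f"
  then obtain c where "AE s in lborel. f s - c \<in> \<int>" by (auto simp: integer_valued_def AE_lebesgue_iff)
  with assms(1) phase have "AE s in lborel. cis (k * s) = cis (2 * pi * c) / \<gamma>"
  proof eventually_elim
    case (elim s)
    have "cis (2 * pi * (g s - c)) = 1" using elim by (simp add: cis_2pi_eq_1_iff)
    then have "cis (2 * pi * g s) = cis (2 * pi * c)"
      by (simp add: right_diff_distrib cis_divide[symmetric] cis_neq_zero)
    moreover have "\<gamma> \<noteq> 0" using assms(2) by auto
    ultimately show ?case using elim by (simp add: field_simps)
  qed
  then show "k = 0" by (rule cis_const_imp_zero)
next
  assume "k = 0"
  then obtain c where "AE s in lborel. g s - 0 - c \<in> \<int>"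
    using phase_shift_Ints[of \<gamma> g "\<lambda>_. 0"] assms(2) phase by auto
  with assms(1) have "AE s in lborel. f s - c \<in> \<int>" by eventually_elim simp
  then show "integer_valued f" by (auto simp: integer_valued_def AE_lebesgue_iff)
qed

lemma plane_linear_phase_const:
  assumes "AE p in lborel. cis (A * fst p + B * snd p) = c"
  shows "A = 0" "B = 0"
proof -
  have m: "Measurable.pred (borel \<Otimes>\<^sub>M borel) (\<lambda>p. cis (A * fst p + B * snd p) = c)"
    by measurable
  obtain t where "AE x in lborel. cis (A * x + B * t) = c"
    using assms AE_plane_iff(2)[of "\<lambda>x t. cis (A * x + B * t) = c", OF m] AE_real_ex by blast
  then have "AE x in lborel. cis (A * x) = c / cis (B * t)"
    by (rule eventually_mono) (simp add: cis_mult[symmetric] cis_neq_zero field_simps)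
  then show "A = 0" by (rule cis_const_imp_zero)
  obtain x where "AE t in lborel. cis (A * x + B * t) = c"
    using assms AE_plane_iff(1)[of "\<lambda>x t. cis (A * x + B * t) = c", OF m] AE_real_ex by blast
  then have "AE t in lborel. cis (B * t) = c / cis (A * x)"
    by (rule eventually_mono) (simp add: cis_mult[symmetric] cis_neq_zero field_simps)
  then show "B = 0" by (rule cis_const_imp_zero)
qed

text \<open>Differencing along a translation turns the quadratic polynomial into a linear one, whose
  coefficients have to vanish for every translation vector.\<close>

lemma plane_quadratic_phase_const:
  assumes ae: "AE p in lborel. cis (\<alpha> * (fst p)\<^sup>2 + \<beta> * fst p * snd p + \<delta> * (snd p)\<^sup>2 + A * fst p + B * snd p) = c"
  shows "\<alpha> = 0" "\<beta> = 0" "\<delta> = 0" "A = 0" "B = 0"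
proof -
  define P where "P x t = \<alpha> * x\<^sup>2 + \<beta> * x * t + \<delta> * t\<^sup>2 + A * x + B * t" for x t
  have ae': "AE p in lborel. cis (P (fst p) (snd p)) = c" using ae by (simp add: P_def)
  have m: "Measurable.pred (borel \<Otimes>\<^sub>M borel) (\<lambda>p. cis (P (fst p) (snd p)) = c)"
    unfolding P_def by measurable
  have lin: "2 * \<alpha> * x0 + \<beta> * t0 = 0" "\<beta> * x0 + 2 * \<delta> * t0 = 0" for x0 t0
  proof -
    have "AE p in lborel. cis (P (fst p + x0) (snd p + t0)) = c"
      using AE_plane_translate[of "\<lambda>x t. cis (P x t) = c", OF m ae'] .
    with ae' have "AE p in lborel. cis ((2 * \<alpha> * x0 + \<beta> * t0) * fst p + (\<beta> * x0 + 2 * \<delta> * t0) * snd p) = cis (- P x0 t0)"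
    proof eventually_elim
      case (elim p)
      have "(2 * \<alpha> * x0 + \<beta> * t0) * fst p + (\<beta> * x0 + 2 * \<delta> * t0) * snd p
          = P (fst p + x0) (snd p + t0) - P (fst p) (snd p) + - P x0 t0"
        by (simp add: P_def power2_eq_square algebra_simps)
      then have "cis ((2 * \<alpha> * x0 + \<beta> * t0) * fst p + (\<beta> * x0 + 2 * \<delta> * t0) * snd p)
          = cis (P (fst p + x0) (snd p + t0)) / cis (P (fst p) (snd p)) * cis (- P x0 t0)"
        by (simp only: cis_divide cis_mult)
      moreover have "c \<noteq> 0" using elim(1) cis_neq_zero by metis
      ultimately show ?case using elim by simp
    qed
    from plane_linear_phase_const[OF this]
    show "2 * \<alpha> * x0 + \<beta> * t0 = 0" "\<beta> * x0 + 2 * \<delta> * t0 = 0" by blast+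
  qed
  show q: "\<alpha> = 0" "\<beta> = 0" "\<delta> = 0"
    using lin(1)[of 1 0] lin(1)[of 0 1] lin(2)[of 0 1] by auto
  have "AE p in lborel. cis (A * fst p + B * snd p) = c" using ae q by simp
  from plane_linear_phase_const[OF this] show "A = 0" "B = 0" by blast+
qed

text \<open>The product of the three phases is 1 and is also a single linear phase in
  \<open>(x, t)\<close>. The coefficients of \<open>x\<close> and of \<open>t\<close> give the
  relations between wavenumbers and between frequencies.\<close>

lemma three_wave_phases:
  assumes g: "\<And>d. d \<in> {1..3} \<Longrightarrow> g d \<in> borel_measurable borel" and inj: "inj_on a {1..3::nat}"
    and two: "AE p in lborel. (\<Sum>d=1..3. g d (fst p - a d * snd p)) \<in> {0, 1}"
  obtains \<gamma> k where "\<forall>d\<in>{1..3::nat}. norm (\<gamma> d) = 1 \<and>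
      (AE s in lborel. cis (2 * pi * g d s) = \<gamma> d * cis (k d * s))"
    "k 1 + k 2 + k 3 = 0" "k 1 * a 1 + k 2 * a 2 + k 3 * a 3 = 0"
proof -
  define E where "E d s = cis (2 * pi * g d s)" for d s
  have Em: "E d \<in> borel_measurable borel" if "d \<in> {1..3}" for d
    using g[OF that] unfolding E_def by measurable
  have En: "norm (E d s) = 1" for d s by (simp add: E_def)
  have set3: "{1..3::nat} = {1, 2, 3}" by auto
  have ne: "a 1 \<noteq> a 2" "a 1 \<noteq> a 3" "a 2 \<noteq> a 3"
    using inj unfolding set3 by (auto dest: inj_onD)
  have prod1: "AE p in lborel. E 1 (fst p - a 1 * snd p) * E 2 (fst p - a 2 * snd p) * E 3 (fst p - a 3 * snd p) = 1"
    using two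
  proof eventually_elim
    case (elim p)
    have "g 1 (fst p - a 1 * snd p) + g 2 (fst p - a 2 * snd p) + g 3 (fst p - a 3 * snd p) \<in> \<int>"
      using elim unfolding set3 by (auto simp: add.assoc)
    then have "cis (2 * pi * (g 1 (fst p - a 1 * snd p) + g 2 (fst p - a 2 * snd p) + g 3 (fst p - a 3 * snd p))) = 1"
      by (simp only: cis_2pi_eq_1_iff)
    then show ?case by (simp add: E_def cis_mult distrib_left)
  qed
  then have prod2: "AE p in lborel. E 2 (fst p - a 2 * snd p) * E 1 (fst p - a 1 * snd p) * E 3 (fst p - a 3 * snd p) = 1"
    and prod3: "AE p in lborel. E 3 (fst p - a 3 * snd p) * E 1 (fst p - a 1 * snd p) * E 2 (fst p - a 2 * snd p) = 1"
    by (simp_all add: mult_ac)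
  have mem: "1 \<in> {1..3::nat}" "2 \<in> {1..3::nat}" "3 \<in> {1..3::nat}" by auto
  obtain \<gamma>1 k1 where 1: "norm \<gamma>1 = 1" "AE s in lborel. E 1 s = \<gamma>1 * cis (k1 * s)"
    using three_wave_phase[OF Em[OF mem(1)] Em[OF mem(2)] Em[OF mem(3)] En En En _ _ prod1] ne by metis
  obtain \<gamma>2 k2 where 2: "norm \<gamma>2 = 1" "AE s in lborel. E 2 s = \<gamma>2 * cis (k2 * s)"
    using three_wave_phase[OF Em[OF mem(2)] Em[OF mem(1)] Em[OF mem(3)] En En En _ _ prod2] ne by metis
  obtain \<gamma>3 k3 where 3: "norm \<gamma>3 = 1" "AE s in lborel. E 3 s = \<gamma>3 * cis (k3 * s)"
    using three_wave_phase[OF Em[OF mem(3)] Em[OF mem(1)] Em[OF mem(2)] En En En _ _ prod3] ne by metis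
  from AE_plane_characteristic[OF 1(2), of "a 1"] AE_plane_characteristic[OF 2(2), of "a 2"]
    AE_plane_characteristic[OF 3(2), of "a 3"] prod1
  have "AE p in lborel. cis ((k1 + k2 + k3) * fst p + (- (k1 * a 1 + k2 * a 2 + k3 * a 3)) * snd p) = 1 / (\<gamma>1 * \<gamma>2 * \<gamma>3)"
  proof eventually_elim
    case (elim p)
    have "(k1 + k2 + k3) * fst p + (- (k1 * a 1 + k2 * a 2 + k3 * a 3)) * snd p
      = k1 * (fst p - a 1 * snd p) + k2 * (fst p - a 2 * snd p) + k3 * (fst p - a 3 * snd p)"
      by (simp add: algebra_simps)
    then have "(\<gamma>1 * \<gamma>2 * \<gamma>3) * cis ((k1 + k2 + k3) * fst p + (- (k1 * a 1 + k2 * a 2 + k3 * a 3)) * snd p) = 1"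
      using elim by (simp add: cis_mult[symmetric] mult_ac)
    moreover have "\<gamma>1 * \<gamma>2 * \<gamma>3 \<noteq> 0" using 1(1) 2(1) 3(1) by auto
    ultimately show ?case by (metis nonzero_mult_div_cancel_left)
  qed
  from plane_linear_phase_const[OF this] have k: "k1 + k2 + k3 = 0" "k1 * a 1 + k2 * a 2 + k3 * a 3 = 0"
    by simp_all
  define \<gamma> where "\<gamma> d = (if d = 1 then \<gamma>1 else if d = 2 then \<gamma>2 else \<gamma>3)" for d :: nat
  define k' where "k' d = (if d = 1 then k1 else if d = 2 then k2 else k3)" for d :: nat
  show ?thesis
  proof (rule that[of \<gamma> k'])
    show "\<forall>d\<in>{1..3::nat}. norm (\<gamma> d) = 1 \<and> (AE s in lborel. cis (2 * pi * g d s) = \<gamma> d * cis (k' d * s))"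
      unfolding set3 using 1 2 3 by (simp add: \<gamma>_def k'_def E_def)
  qed (use k in \<open>simp_all add: k'_def\<close>)
qed

text \<open>The coefficients of \<open>x^2\<close>, \<open>x * t\<close> and \<open>t^2\<close> in
  the total phase vanish; these are the first three moments of \<open>q\<close> over the
  speeds.\<close>

lemma four_wave_phases:
  assumes g: "\<And>d. d \<in> {1..4} \<Longrightarrow> g d \<in> borel_measurable borel" and inj: "inj_on a {1..4::nat}"
    and two: "AE p in lborel. (\<Sum>d=1..4. g d (fst p - a d * snd p)) \<in> {0, 1}"
  obtains \<gamma> q k where "\<forall>d\<in>{1..4::nat}. norm (\<gamma> d) = 1 \<and>
      (AE s in lborel. cis (2 * pi * g d s) = \<gamma> d * cis (q d * s\<^sup>2 + k d * s))"
    "(\<Sum>d=1..4. q d) = 0" "(\<Sum>d=1..4. q d * a d) = 0" "(\<Sum>d=1..4. q d * (a d)\<^sup>2) = 0"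
proof -
  define E where "E d s = cis (2 * pi * g d s)" for d s
  have Em: "E d \<in> borel_measurable borel" if "d \<in> {1..4}" for d
    using g[OF that] unfolding E_def by measurable
  have En: "norm (E d s) = 1" for d s by (simp add: E_def)
  have prod: "AE p in lborel. (\<Prod>d=1..4. E d (fst p - a d * snd p)) = 1"
    using two
  proof eventually_elim
    case (elim p)
    have "(\<Sum>d=1..4. g d (fst p - a d * snd p)) \<in> \<int>" using elim by auto
    then have "cis (2 * pi * (\<Sum>d=1..4. g d (fst p - a d * snd p))) = 1"
      by (simp only: cis_2pi_eq_1_iff)
    moreover have "cis (\<Sum>d\<in>D. h d) = (\<Prod>d\<in>D. cis (h d))" if "finite D" for D and h :: "nat \<Rightarrow> real"
      using that by (induction D rule: finite_induct) (simp_all add: cis_mult[symmetric])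
    ultimately show ?case by (simp add: E_def sum_distrib_left)
  qed
  have "\<exists>\<gamma> q k. norm \<gamma> = 1 \<and> (AE s in lborel. E d s = \<gamma> * cis (q * s\<^sup>2 + k * s))" if d: "d \<in> {1..4}" for d
  proof -
    have "card ({1..4::nat} - {d}) = 3" using d by simp
    then obtain x y z where xyz: "{1..4::nat} - {d} = {x, y, z}" "x \<noteq> y" "y \<noteq> z" "x \<noteq> z"
      unfolding card_3_iff by auto
    then have S: "{1..4::nat} = {d, x, y, z}" and nd: "d \<noteq> x" "d \<noteq> y" "d \<noteq> z" using d by blast+
    have mem: "x \<in> {1..4}" "y \<in> {1..4}" "z \<in> {1..4}" using S by auto
    have "AE p in lborel. E d (fst p - a d * snd p) * E x (fst p - a x * snd p)
        * E y (fst p - a y * snd p) * E z (fst p - a z * snd p) = 1"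
      using prod unfolding S using nd xyz(2-4) by (simp add: mult.assoc)
    moreover have "a d \<noteq> a x" "a d \<noteq> a y" "a d \<noteq> a z"
      using inj d mem nd by (auto dest: inj_onD)
    ultimately show ?thesis
      using four_wave_phase[OF Em[OF d] Em[OF mem(1)] Em[OF mem(2)] Em[OF mem(3)] En En En En, of "a d" "a x" "a y" "a z"]
      by metis
  qed
  then obtain \<gamma> q k where ph: "\<And>d. d \<in> {1..4} \<Longrightarrow> norm (\<gamma> d) = 1 \<and> (AE s in lborel. E d s = \<gamma> d * cis (q d * s\<^sup>2 + k d * s))"
    by metis
  define h where "h x t d = q d * (x - a d * t)\<^sup>2 + k d * (x - a d * t)" for x t d
  have "AE p in lborel. \<forall>d\<in>{1..4}. E d (fst p - a d * snd p) = \<gamma> d * cis (h (fst p) (snd p) d)"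
  proof (rule AE_finite_allI)
    fix d :: nat assume "d \<in> {1..4}"
    then show "AE p in lborel. E d (fst p - a d * snd p) = \<gamma> d * cis (h (fst p) (snd p) d)"
      using AE_plane_characteristic[of "\<lambda>s. E d s = \<gamma> d * cis (q d * s\<^sup>2 + k d * s)"] ph
      unfolding h_def by blast
  qed simp
  with prod have "AE p in lborel. cis ((\<Sum>d=1..4. q d) * (fst p)\<^sup>2 + (- 2 * (\<Sum>d=1..4. q d * a d)) * fst p * snd p
      + (\<Sum>d=1..4. q d * (a d)\<^sup>2) * (snd p)\<^sup>2 + (\<Sum>d=1..4. k d) * fst p + (- (\<Sum>d=1..4. k d * a d)) * snd p)
      = 1 / (\<Prod>d=1..4. \<gamma> d)"
  proof eventually_elim
    case (elim p)
    have cs: "cis (\<Sum>d\<in>D. h' d) = (\<Prod>d\<in>D. cis (h' d))" if "finite D" for D and h' :: "nat \<Rightarrow> real"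
      using that by (induction D rule: finite_induct) (simp_all add: cis_mult[symmetric])
    have "(\<Prod>d=1..4. \<gamma> d) * cis (\<Sum>d=1..4. h (fst p) (snd p) d) = 1"
      using elim by (simp add: cs prod.distrib[symmetric])
    moreover have "(\<Sum>d=1..4. h (fst p) (snd p) d) = (\<Sum>d=1..4. q d) * (fst p)\<^sup>2 + (- 2 * (\<Sum>d=1..4. q d * a d)) * fst p * snd p
      + (\<Sum>d=1..4. q d * (a d)\<^sup>2) * (snd p)\<^sup>2 + (\<Sum>d=1..4. k d) * fst p + (- (\<Sum>d=1..4. k d * a d)) * snd p"
      unfolding sum_distrib_right sum_distrib_left sum_negf[symmetric] sum.distrib[symmetric]
      by (rule sum.cong) (simp_all add: h_def power2_eq_square algebra_simps)
    moreover have "(\<Prod>d=1..4. \<gamma> d) \<noteq> 0"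
    proof
      assume "(\<Prod>d=1..4. \<gamma> d) = 0"
      then obtain d where d: "d \<in> {1..4}" "\<gamma> d = 0" using prod_zero_iff[of "{1..4}" \<gamma>] by blast
      then have "norm (0 :: complex) = 1" using ph[OF d(1)] by metis
      then show False by simp
    qed
    ultimately show ?case by (metis nonzero_mult_div_cancel_left)
  qed
  from plane_quadratic_phase_const[OF this]
  have "(\<Sum>d=1..4. q d) = 0" "(\<Sum>d=1..4. q d * a d) = 0" "(\<Sum>d=1..4. q d * (a d)\<^sup>2) = 0" by simp_all
  then show ?thesis
    using that[of \<gamma> q k] ph unfolding E_def by blast
qed

text \<open>By the moment relations the quadratic coefficients vanish all together or not at all. So
  if some profile is not integer-valued, then either every phase is nontrivial, or all phases are
  linear and a zero wavenumber occurs next to a nonzero one. The variance argument excludes the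
  former, the comparison with an integer-valued wave the latter.\<close>

lemma four_waves_integer_valued:
  assumes sol: "wave_solution 4 a f" and "bounded_profiles 4 f"
  shows "\<forall>d\<in>{1..4}. integer_valued (f d)"
proof (rule ccontr)
  assume not_int: "\<not> ?thesis"
  have inj: "inj_on a {1..4}" using sol by (simp add: wave_solution_def)
  obtain g where g: "\<forall>d\<in>{1..4}. g d \<in> borel_measurable borel \<and> (AE s in lborel. f d s = g d s) \<and>
      range (g d) \<subseteq> range (f d) \<and> \<not> (\<exists>c. AE s in lborel. g d s = c)"
    and two: "AE p in lborel. (\<Sum>d=1..4. g d (fst p - a d * snd p)) \<in> {0, 1}"
    by (rule wave_solution_borel[OF sol])
  have gm: "g d \<in> borel_measurable borel" and fg: "AE s in lborel. f d s = g d s"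
    and range: "range (g d) \<subseteq> range (f d)" and nonconst: "\<not> (\<exists>c. AE s in lborel. g d s = c)"
    if "d \<in> {1..4}" for d
    using bspec[OF g that] by - (elim conjE, assumption)+
  have "bounded (\<Union>d\<in>{1..4}. range (g d))"
  proof (rule bounded_UN)
    show "\<forall>d\<in>{1..4}. bounded (range (g d))"
    proof
      fix d :: nat assume d: "d \<in> {1..4}"
      then have "bounded (range (f d))" using assms(2) by (simp add: bounded_profiles_def)
      then show "bounded (range (g d))" by (rule bounded_subset[OF _ range[OF d]])
    qed
  qed simp
  then obtain B where "\<forall>y\<in>(\<Union>d\<in>{1..4}. range (g d)). norm y \<le> B"
    unfolding bounded_iff by blast
  then have B: "\<bar>g d s\<bar> \<le> B" if "d \<in> {1..4}" for d s
    using that unfolding real_norm_def[symmetric] by blast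
  obtain \<gamma> q k where g_ph: "\<forall>d\<in>{1..4}. norm (\<gamma> d) = 1 \<and>
      (AE s in lborel. cis (2 * pi * g d s) = \<gamma> d * cis (q d * s\<^sup>2 + k d * s))"
    and q: "(\<Sum>d=1..4. q d) = 0" "(\<Sum>d=1..4. q d * a d) = 0" "(\<Sum>d=1..4. q d * (a d)\<^sup>2) = 0"
    by (rule four_wave_phases[OF gm inj two])
  have \<gamma>: "norm (\<gamma> d) = 1"
    and ph: "AE s in lborel. cis (2 * pi * g d s) = \<gamma> d * cis (q d * s\<^sup>2 + k d * s)" if "d \<in> {1..4}" for d
    using bspec[OF g_ph that] by - (elim conjE, assumption)+
  have phases: False if "\<And>d. d \<in> {1..4} \<Longrightarrow> q d \<noteq> 0 \<or> k d \<noteq> 0"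
  proof (rule four_phases_impossible[of "{1..4}" a g B, OF _ _ inj gm B two])
    fix d :: nat assume d: "d \<in> {1..4}"
    show "\<exists>\<gamma> q k. norm \<gamma> = 1 \<and> (q \<noteq> 0 \<or> k \<noteq> 0) \<and>
        (AE s in lborel. cis (2 * pi * g d s) = \<gamma> * cis (q * s\<^sup>2 + k * s))"
      by (rule exI[of _ "\<gamma> d"], rule exI[of _ "q d"], rule exI[of _ "k d"])
        (intro conjI \<gamma>[OF d] that[OF d] ph[OF d])
  qed simp_all
  \<comment> \<open>Pairing the moments with the polynomial \<open>(X - a x) * (X - a y)\<close>
    removes the nodes \<open>x\<close> and \<open>y\<close> and leaves a relation between
    \<open>q d\<close> and \<open>q e\<close> with nonzero coefficients.\<close>
  have q0: "q d = 0 \<longleftrightarrow> q e = 0" if de: "d \<in> {1..4}" "e \<in> {1..4}" "d \<noteq> e" for d e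
  proof -
    have "card ({1..4::nat} - {d, e}) = 2" using de by (simp add: card_Diff_subset)
    then obtain x y where xy: "{1..4::nat} - {d, e} = {x, y}" "x \<noteq> y"
      unfolding card_2_iff by auto
    then have S: "{1..4::nat} = {d, e, x, y}" and nd: "d \<noteq> x" "d \<noteq> y" "e \<noteq> x" "e \<noteq> y" using de by blast+
    have mem: "x \<in> {1..4}" "y \<in> {1..4}" using S by auto
    have sum4: "(\<Sum>i=1..4. w i) = w d + w e + w x + w y" for w :: "nat \<Rightarrow> real"
      unfolding S using nd xy(2) de(3) by simp
    have "q d * ((a d - a x) * (a d - a y)) + q e * ((a e - a x) * (a e - a y))
      = (\<Sum>i=1..4. q i * (a i)\<^sup>2) - (a x + a y) * (\<Sum>i=1..4. q i * a i) + a x * a y * (\<Sum>i=1..4. q i)"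
      unfolding sum4 by (simp add: power2_eq_square algebra_simps)
    also have "\<dots> = 0" using q by simp
    finally have "q d * ((a d - a x) * (a d - a y)) = - (q e * ((a e - a x) * (a e - a y)))" by linarith
    moreover have "(a d - a x) * (a d - a y) \<noteq> 0" "(a e - a x) * (a e - a y) \<noteq> 0"
      using inj de mem nd by (auto dest: inj_onD)
    ultimately show ?thesis by (metis minus_equation_iff minus_zero mult_eq_0_iff)
  qed
  show False
  proof (cases "\<exists>d\<in>{1..4}. q d \<noteq> 0")
    case True
    then show False using q0 phases by metis
  next
    case False
    then have lin: "AE s in lborel. cis (2 * pi * g d s) = \<gamma> d * cis (k d * s)" if "d \<in> {1..4}" for d
      using ph[OF that] that by simp
    have intk: "integer_valued (f d) \<longleftrightarrow> k d = 0" if "d \<in> {1..4}" for d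
      using integer_valued_iff_phase[OF fg[OF that] \<gamma>[OF that] lin[OF that]] .
    obtain d where d: "d \<in> {1..4}" "k d \<noteq> 0" using not_int intk by blast
    obtain e where e: "e \<in> {1..4}" "k e = 0" using phases by blast
    have "d \<noteq> e" using d e by auto
    have "card ({1..4::nat} - {d, e}) = 2" using d e \<open>d \<noteq> e\<close> by (simp add: card_Diff_subset)
    then obtain x y where xy: "{1..4::nat} - {d, e} = {x, y}" "x \<noteq> y"
      unfolding card_2_iff by auto
    then have S: "{1..4::nat} = {d, x, y, e}" and nd: "d \<noteq> x" "d \<noteq> y" "e \<noteq> x" "e \<noteq> y" using d e by blast+
    have mem: "x \<in> {1..4}" "y \<in> {1..4}" using S by auto
    have sum4: "(\<Sum>i=1..4. w i) = w d + w x + w y + w e" for w :: "nat \<Rightarrow> real"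
      unfolding S using nd xy(2) \<open>d \<noteq> e\<close> by simp
    have two': "AE p in lborel. g d (fst p - a d * snd p) + g x (fst p - a x * snd p)
        + g y (fst p - a y * snd p) + g e (fst p - a e * snd p) \<in> {0, 1}"
      using two unfolding sum4 .
    obtain z where "AE s in lborel. f e s - z \<in> \<int>"
      using intk[OF e(1)] e(2) by (auto simp: integer_valued_def AE_lebesgue_iff)
    with fg[OF e(1)] have int: "AE s in lborel. g e s - z \<in> \<int>" by eventually_elim simp
    have ne: "a d \<noteq> a x" "a d \<noteq> a y" "a d \<noteq> a e" "a x \<noteq> a e" "a y \<noteq> a e"
      using inj d(1) e(1) mem nd \<open>d \<noteq> e\<close> by (auto dest: inj_onD)
    show False
      by (rule integer_wave_excludes_phase[OF gm[OF d(1)] gm[OF mem(1)] gm[OF mem(2)] gm[OF e(1)]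
          B[OF d(1)] B[OF mem(1)] B[OF mem(2)] ne two' int nonconst[OF e(1)] lin[OF d(1)] d(2)])
  qed
qed

section \<open>Floor rigidity and the sawtooth form\<close>

lemma AE_affine_not_Ints:
  assumes "k \<noteq> 0"
  shows "AE s in lborel. k * s + r \<notin> (\<int> :: real set)"
proof -
  have "countable (\<int> :: real set)" by (rule countable_int)
  then have N: "(\<int> :: real set) \<in> null_sets lborel" by (rule countable_imp_null_set_lborel)
  then have [measurable]: "(\<int> :: real set) \<in> sets borel" by (simp add: null_sets_def)
  have "AE s in lborel. s \<notin> (\<int> :: real set)" by (rule AE_not_in[OF N])
  then have "AE s in lborel. r + k * s \<notin> (\<int> :: real set)"
    using assms by (subst AE_affine_iff) simp_all
  then show ?thesis by (simp add: add.commute)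
qed

lemma frac_measurable [measurable]: "(frac :: real \<Rightarrow> real) \<in> borel_measurable borel"
  unfolding frac_def by measurable

lemma frac_minus: "x \<notin> \<int> \<Longrightarrow> frac (- x) = 1 - frac (x :: real)"
  by (simp add: frac_neg)

text \<open>The conjecture requires integer-valued functions whose distance from a linear function
  is bounded everywhere. Taking the floor provides both and changes the given expression only on a
  null set.\<close>

lemma floor_remainder:
  fixes h :: "real \<Rightarrow> real"
  assumes [measurable]: "h \<in> borel_measurable borel" and B: "\<And>s. \<bar>h s\<bar> \<le> B"
    and ints: "AE s in lborel. h s - m * s - c \<in> \<int>"
  defines "N \<equiv> \<lambda>s. \<lfloor>h s - m * s - c\<rfloor>"
  shows "N \<in> lebesgue \<rightarrow>\<^sub>M count_space UNIV"
    and "bounded (range (\<lambda>s. of_int (N s) + m * s))"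
    and "AE s in lborel. of_int (N s) = h s - m * s - c"
proof -
  have "N \<in> borel \<rightarrow>\<^sub>M count_space UNIV" unfolding N_def by measurable
  then show "N \<in> lebesgue \<rightarrow>\<^sub>M count_space UNIV" by (simp add: measurable_completion)
  have "\<bar>of_int (N s) + m * s\<bar> \<le> B + \<bar>c\<bar> + 1" for s
    using B[of s] floor_correct[of "h s - m * s - c"] unfolding N_def by linarith
  then show "bounded (range (\<lambda>s. of_int (N s) + m * s))"
    unfolding bounded_iff by auto
  show "AE s in lborel. of_int (N s) = h s - m * s - c"
    using ints by eventually_elim (auto simp: N_def elim: Ints_cases)
qed

text \<open>The wavenumbers are normalized to 1, 1 and -1. Since the functions \<open>N1\<close>,
  \<open>N2\<close>, \<open>N3\<close> then have slopes -1, -1 and 1, the conjecture is applied with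
  \<open>\<mu> = - 1\<close>. In the sum the linear parts cancel, which leaves a constant minus a
  sawtooth; testing two boxes fixes the constant.\<close>

lemma rigid_sawtooth:
  fixes H1 H2 H3 :: "real \<Rightarrow> real"
  assumes rigid: floor_rigidity
    and [measurable]: "H1 \<in> borel_measurable borel" "H2 \<in> borel_measurable borel" "H3 \<in> borel_measurable borel"
    and B: "\<And>s. \<bar>H1 s\<bar> \<le> B" "\<And>s. \<bar>H2 s\<bar> \<le> B" "\<And>s. \<bar>H3 s\<bar> \<le> B"
    and c: "AE s in lborel. H1 s - 1 * s - c1 \<in> \<int>" "AE s in lborel. H2 s - 1 * s - c2 \<in> \<int>"
      "AE s in lborel. H3 s - (- 1) * s - c3 \<in> \<int>"
    and two: "AE u in lborel. AE v in lborel. H1 u + H2 v + H3 (u + v) \<in> {0, 1}"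
  obtains \<rho>1 \<rho>2 where "AE u in lborel. AE v in lborel. H1 u + H2 v + H3 (u + v)
      = 1 - (frac (\<rho>1 - u) + frac (\<rho>2 - v) - frac (\<rho>1 - u + (\<rho>2 - v)))"
proof -
  define N1 where "N1 s = \<lfloor>H1 s - 1 * s - c1\<rfloor>" for s
  define N2 where "N2 s = \<lfloor>H2 s - 1 * s - c2\<rfloor>" for s
  define N3 where "N3 s = \<lfloor>H3 s - (- 1) * s - c3\<rfloor>" for s
  note N1 = floor_remainder[OF _ B(1) c(1), folded N1_def, simplified]
  note N2 = floor_remainder[OF _ B(2) c(2), folded N2_def, simplified]
  note N3 = floor_remainder[OF _ B(3) c(3), folded N3_def, simplified]
  have plane: "AE u in lborel. AE v in lborel. P (u + v)" if P: "AE w in lborel. P w" for P :: "real \<Rightarrow> bool"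
  proof -
    obtain N where N: "N \<in> null_sets lborel" "{s \<in> space lborel. \<not> P s} \<subseteq> N"
      using P unfolding eventually_ae_filter by blast
    have [measurable]: "N \<in> sets borel" using N(1) by (simp add: null_sets_def)
    have "AE w in lborel. w \<notin> N" by (rule AE_not_in[OF N(1)])
    then have "AE v in lborel. v + u \<notin> N" for u
      by (subst AE_shift_iff[where P="\<lambda>w. w \<notin> N"]) simp_all
    then have "AE v in lborel. P (u + v)" for u
      by (rule eventually_mono) (use N(2) in \<open>auto simp: add.commute\<close>)
    then show ?thesis by simp
  qed
  have sum_N: "AE u in lborel. AE v in lborel. of_int (N1 u + N2 v + N3 (u + v)) = H1 u + H2 v + H3 (u + v) - (c1 + c2 + c3)"
    using N1(3) plane[OF N3(3)]
  proof eventually_elim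
    case (elim u)
    from N2(3) elim(2) show ?case
      by eventually_elim (use elim(1) in simp)
  qed
  \<comment> \<open>The integer \<open>N1 u + N2 v + N3 (u + v)\<close> is 0 or 1 minus
    \<open>c1 + c2 + c3\<close>. So \<open>- (c1 + c2 + c3)\<close> is an integer, and the floor
    merely gives it the right type.\<close>
  define m where "m = \<lfloor>- (c1 + c2 + c3)\<rfloor>"
  have "AE u in lborel. AE v in lborel. N1 u + N2 v + N3 (u + v) \<in> {m, m + 1}"
    using sum_N two
  proof eventually_elim
    case (elim u)
    from elim show ?case
    proof eventually_elim
      case (elim v)
      then consider "of_int (N1 u + N2 v + N3 (u + v)) = - (c1 + c2 + c3)"
        | "of_int (N1 u + N2 v + N3 (u + v) - 1) = - (c1 + c2 + c3)" by auto
      then show ?case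
      proof cases
        case 1
        have "m = N1 u + N2 v + N3 (u + v)" unfolding m_def 1[symmetric] by (rule floor_of_int)
        then show ?thesis by simp
      next
        case 2
        have "m = N1 u + N2 v + N3 (u + v) - 1" unfolding m_def 2[symmetric] by (rule floor_of_int)
        then show ?thesis by simp
      qed
    qed
  qed
  moreover have "Measurable.pred (borel \<Otimes>\<^sub>M borel) (\<lambda>p. N1 (fst p) + N2 (snd p) + N3 (fst p + snd p) \<in> {m, m + 1})"
    unfolding N1_def N2_def N3_def by measurable
  ultimately have "AE p in lborel. N1 (fst p) + N2 (snd p) + N3 (fst p + snd p) \<in> {m, m + 1}"
    using AE_plane_iff(1)[of "\<lambda>u v. N1 u + N2 v + N3 (u + v) \<in> {m, m + 1}"] by blast
  then have "\<exists>m. AE p in lebesgue. N1 (fst p) + N2 (snd p) + N3 (fst p + snd p) \<in> {m, m + 1}"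
    by (auto simp: AE_lebesgue_iff)
  with rigid[unfolded floor_rigidity_def, rule_format, of "- 1" N1 N2 N3] N1(1,2) N2(1,2) N3(1,2)
  obtain \<rho>1 \<rho>2 e1 e2 e3 where
    r: "AE x in lebesgue. N1 x = \<lfloor>(-1) * x + \<rho>1\<rfloor> + e1" "AE x in lebesgue. N2 x = \<lfloor>(-1) * x + \<rho>2\<rfloor> + e2"
      "AE x in lebesgue. N3 x = - \<lfloor>(-1) * x + \<rho>1 + \<rho>2\<rfloor> + e3"
    by auto
  note r = r[unfolded AE_lebesgue_iff]
  define \<kappa> where "\<kappa> = c1 + c2 + c3 + of_int (e1 + e2 + e3)"
  define S where "S u v = frac (\<rho>1 - u) + frac (\<rho>2 - v) - frac (\<rho>1 - u + (\<rho>2 - v))" for u v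
  have eq: "AE u in lborel. AE v in lborel. H1 u + H2 v + H3 (u + v) = \<kappa> - S u v"
    using sum_N r(1) plane[OF r(3)]
  proof eventually_elim
    case (elim u)
    from elim(1,3) r(2) show ?case
    proof eventually_elim
      case (elim v)
      have "(-1) * (u + v) + \<rho>1 + \<rho>2 = \<rho>1 - u + (\<rho>2 - v)" by simp
      then have "N3 (u + v) = - \<lfloor>\<rho>1 - u + (\<rho>2 - v)\<rfloor> + e3" using elim(2) by (simp only:)
      moreover have "N1 u = \<lfloor>\<rho>1 - u\<rfloor> + e1" "N2 v = \<lfloor>\<rho>2 - v\<rfloor> + e2"
        using \<open>N1 u = \<lfloor>(-1) * u + \<rho>1\<rfloor> + e1\<close> elim(3) by (simp_all add: algebra_simps)
      ultimately show ?case
        using elim(1) unfolding S_def \<kappa>_def frac_def by simp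
    qed
  qed
  have "\<kappa> = 1"
  proof -
    have both: "AE u in lborel. AE v in lborel. \<kappa> - S u v \<in> {0, 1}"
      using eq two
    proof eventually_elim
      case (elim u)
      from elim show ?case by eventually_elim simp
    qed
    have ex: "\<exists>u\<in>{\<rho>1 - y..\<rho>1 - x}. \<exists>v\<in>{\<rho>2 - y..\<rho>2 - x}. \<kappa> - S u v \<in> {0, 1}" if "x < y" for x y
    proof -
      obtain u where u: "u \<in> {\<rho>1 - y..\<rho>1 - x}" "AE v in lborel. \<kappa> - S u v \<in> {0, 1}"
        using AE_real_ex_Icc[OF both, of "\<rho>1 - y" "\<rho>1 - x"] \<open>x < y\<close> by auto
      obtain v where "v \<in> {\<rho>2 - y..\<rho>2 - x}" "\<kappa> - S u v \<in> {0, 1}"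
        using AE_real_ex_Icc[OF u(2), of "\<rho>2 - y" "\<rho>2 - x"] \<open>x < y\<close> by auto
      with u(1) show ?thesis by blast
    qed
    \<comment> \<open>With fractional parts between 1/5 and 2/5 there is no carry and
      \<open>S u v = 0\<close>; between 3/5 and 4/5 there is one and \<open>S u v = 1\<close>. Only
      \<open>\<kappa> = 1\<close> is compatible with both.\<close>
    obtain u v where "u \<in> {\<rho>1 - 2/5..\<rho>1 - 1/5}" "v \<in> {\<rho>2 - 2/5..\<rho>2 - 1/5}" "\<kappa> - S u v \<in> {0, 1}"
      using ex[of "1/5" "2/5"] by auto
    moreover from this have "S u v = 0"
      by (simp add: S_def frac_eq[THEN iffD2])
    ultimately have 1: "\<kappa> \<in> {0, 1}" by simp
    obtain u v where uv: "u \<in> {\<rho>1 - 4/5..\<rho>1 - 3/5}" "v \<in> {\<rho>2 - 4/5..\<rho>2 - 3/5}" "\<kappa> - S u v \<in> {0, 1}"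
      using ex[of "3/5" "4/5"] by auto
    have "frac (\<rho>1 - u + (\<rho>2 - v)) = \<rho>1 - u + (\<rho>2 - v) - 1"
      using uv by (subst frac_unique_iff) auto
    moreover have "frac (\<rho>1 - u) = \<rho>1 - u" "frac (\<rho>2 - v) = \<rho>2 - v"
      using uv by (auto simp: frac_eq)
    ultimately have "S u v = 1" by (simp add: S_def)
    with uv(3) 1 show ?thesis by auto
  qed
  with eq show ?thesis
    unfolding S_def by (intro that[of \<rho>1 \<rho>2]) simp
qed

text \<open>Rescaling every argument by its wavenumber makes the third argument the sum of the other
  two, by the resonance. The rescaled field is the complement of a sawtooth with negated arguments.
  For negative wavenumbers this is the complement form as it stands; for positive ones
  \<open>frac (- x) = 1 - frac x\<close>, valid off the integers, turns it into a sawtooth.\<close>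

lemma three_waves_sawtooth:
  fixes h1 h2 h3 :: "real \<Rightarrow> real"
  assumes rigid: floor_rigidity
    and [measurable]: "h1 \<in> borel_measurable borel" "h2 \<in> borel_measurable borel" "h3 \<in> borel_measurable borel"
    and B: "\<And>s. \<bar>h1 s\<bar> \<le> B" "\<And>s. \<bar>h2 s\<bar> \<le> B" "\<And>s. \<bar>h3 s\<bar> \<le> B"
    and ne: "a1 \<noteq> a2" and k: "k1 * k2 > 0" "(k1 + k2) * a3 = k1 * a1 + k2 * a2"
    and n\<gamma>: "norm \<gamma>1 = 1" "norm \<gamma>2 = 1" "norm \<gamma>3 = 1"
    and phase: "AE s in lborel. cis (2 * pi * h1 s) = \<gamma>1 * cis (2 * pi * (k1 * s))"
      "AE s in lborel. cis (2 * pi * h2 s) = \<gamma>2 * cis (2 * pi * (k2 * s))"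
      "AE s in lborel. cis (2 * pi * h3 s) = \<gamma>3 * cis (2 * pi * (- (k1 + k2) * s))"
    and two: "AE p in lborel. h1 (fst p - a1 * snd p) + h2 (fst p - a2 * snd p) + h3 (fst p - a3 * snd p) \<in> {0, 1}"
  shows "\<exists>l1 l3 r1 r3. 0 < l1 \<and> 0 < l3 \<and> a3 = (l1 * a1 + l3 * a2) / (l1 + l3) \<and>
    ((AE p in lborel. h1 (fst p - a1 * snd p) + h2 (fst p - a2 * snd p) + h3 (fst p - a3 * snd p)
        = sawtooth_field l1 l3 r1 r3 a1 a2 (fst p) (snd p)) \<or>
     (AE p in lborel. h1 (fst p - a1 * snd p) + h2 (fst p - a2 * snd p) + h3 (fst p - a3 * snd p)
        = 1 - sawtooth_field l1 l3 r1 r3 a1 a2 (fst p) (snd p)))"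
proof -
  have k0: "k1 \<noteq> 0" "k2 \<noteq> 0" "k1 + k2 \<noteq> 0" using k(1) by (auto simp: zero_less_mult_iff)
  define H1 where "H1 u = h1 (0 + 1 / k1 * u)" for u
  define H2 where "H2 u = h2 (0 + 1 / k2 * u)" for u
  define H3 where "H3 u = h3 (0 + 1 / (k1 + k2) * u)" for u
  have [measurable]: "H1 \<in> borel_measurable borel" "H2 \<in> borel_measurable borel" "H3 \<in> borel_measurable borel"
    unfolding H1_def H2_def H3_def by measurable
  have Hk: "H1 (k1 * s) = h1 s" "H2 (k2 * s) = h2 s" "H3 ((k1 + k2) * s) = h3 s" for s
    using k0 by (simp_all add: H1_def H2_def H3_def)
  have "AE s in lborel. cis (2 * pi * H1 s) = \<gamma>1 * cis (2 * pi * (k1 * (0 + 1 / k1 * s)))"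
    unfolding H1_def
    by (rule AE_affine_iff[of "1 / k1" "\<lambda>s. cis (2 * pi * h1 s) = \<gamma>1 * cis (2 * pi * (k1 * s))" 0, THEN iffD2])
      (use k0 phase(1) in \<open>simp_all, measurable\<close>)
  then have "AE s in lborel. cis (2 * pi * H1 s) = \<gamma>1 * cis (2 * pi * (1 * s))" using k0 by simp
  from phase_shift_Ints[OF n\<gamma>(1) this] obtain c1 where c1: "AE s in lborel. H1 s - 1 * s - c1 \<in> \<int>" .
  have "AE s in lborel. cis (2 * pi * H2 s) = \<gamma>2 * cis (2 * pi * (k2 * (0 + 1 / k2 * s)))"
    unfolding H2_def
    by (rule AE_affine_iff[of "1 / k2" "\<lambda>s. cis (2 * pi * h2 s) = \<gamma>2 * cis (2 * pi * (k2 * s))" 0, THEN iffD2])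
      (use k0 phase(2) in \<open>simp_all, measurable\<close>)
  then have "AE s in lborel. cis (2 * pi * H2 s) = \<gamma>2 * cis (2 * pi * (1 * s))" using k0 by simp
  from phase_shift_Ints[OF n\<gamma>(2) this] obtain c2 where c2: "AE s in lborel. H2 s - 1 * s - c2 \<in> \<int>" .
  have "AE s in lborel. cis (2 * pi * H3 s) = \<gamma>3 * cis (2 * pi * (- (k1 + k2) * (0 + 1 / (k1 + k2) * s)))"
    unfolding H3_def
    by (rule AE_affine_iff[of "1 / (k1 + k2)" "\<lambda>s. cis (2 * pi * h3 s) = \<gamma>3 * cis (2 * pi * (- (k1 + k2) * s))" 0, THEN iffD2])
      (use k0 phase(3) in \<open>simp_all, measurable\<close>)
  moreover have "- \<sigma> * (0 + 1 / \<sigma> * s) = (- 1) * s" if "\<sigma> \<noteq> 0" for \<sigma> s :: real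
    using that by simp
  note this[OF k0(3)]
  ultimately have "AE s in lborel. cis (2 * pi * H3 s) = \<gamma>3 * cis (2 * pi * ((- 1) * s))" by (simp only:)
  from phase_shift_Ints[OF n\<gamma>(3) this] obtain c3 where c3: "AE s in lborel. H3 s - (- 1) * s - c3 \<in> \<int>" .
  have lines: "k1 * (x - a1 * t) + k2 * (x - a2 * t) = (k1 + k2) * (x - a3 * t)" for x t
  proof -
    have "(k1 + k2) * a3 * t = (k1 * a1 + k2 * a2) * t" by (simp add: k(2))
    then show ?thesis by (simp add: algebra_simps)
  qed
  \<comment> \<open>Nonzero scalings of the two characteristic coordinates preserve null
    sets.\<close>
  have transfer: "(AE p in lborel. Q (k1 * (fst p - a1 * snd p)) (k2 * (fst p - a2 * snd p)))
      \<longleftrightarrow> (AE u in lborel. AE v in lborel. Q u v)"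
    if Q: "Measurable.pred (borel \<Otimes>\<^sub>M borel) (\<lambda>p. Q (fst p) (snd p))" for Q
  proof -
    have "Measurable.pred (borel \<Otimes>\<^sub>M borel) (\<lambda>p. Q (k1 * fst p) (k2 * snd p))"
      by (rule pred_compose2[OF Q]; measurable)
    from AE_characteristics[of a1 a2 "\<lambda>u v. Q (k1 * u) (k2 * v)", OF ne this]
    have "(AE p in lborel. Q (k1 * (fst p - a1 * snd p)) (k2 * (fst p - a2 * snd p)))
      \<longleftrightarrow> (AE u in lborel. AE v in lborel. Q (k1 * u) (k2 * v))" .
    also have "\<dots> \<longleftrightarrow> (AE u in lborel. AE v in lborel. Q (k1 * u) v)"
    proof (rule AE_cong)
      fix u
      have "Measurable.pred borel (\<lambda>v. Q (k1 * u) v)" by (rule pred_compose2[OF Q]) simp_all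
      from AE_affine_iff[OF k0(2) this, of 0]
      show "(AE v in lborel. Q (k1 * u) (k2 * v)) \<longleftrightarrow> (AE v in lborel. Q (k1 * u) v)" by simp
    qed
    also have "\<dots> \<longleftrightarrow> (AE v in lborel. AE u in lborel. Q (k1 * u) v)"
      by (rule AE_swap) (rule pred_compose2[OF Q]; measurable)
    also have "\<dots> \<longleftrightarrow> (AE v in lborel. AE u in lborel. Q u v)"
    proof (rule AE_cong)
      fix v
      have "Measurable.pred borel (\<lambda>u. Q u v)" by (rule pred_compose2[OF Q]) simp_all
      from AE_affine_iff[OF k0(1) this, of 0]
      show "(AE u in lborel. Q (k1 * u) v) \<longleftrightarrow> (AE u in lborel. Q u v)" by simp
    qed
    also have "\<dots> \<longleftrightarrow> (AE u in lborel. AE v in lborel. Q u v)"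
      by (rule AE_swap[OF Q, symmetric])
    finally show ?thesis .
  qed
  have F: "H1 (k1 * (x - a1 * t)) + H2 (k2 * (x - a2 * t)) + H3 (k1 * (x - a1 * t) + k2 * (x - a2 * t))
      = h1 (x - a1 * t) + h2 (x - a2 * t) + h3 (x - a3 * t)" for x t
    unfolding lines Hk ..
  have "AE u in lborel. AE v in lborel. H1 u + H2 v + H3 (u + v) \<in> {0, 1}"
    by (subst transfer[of "\<lambda>u v. H1 u + H2 v + H3 (u + v) \<in> {0, 1}", symmetric])
      (measurable, use two in \<open>simp only: F\<close>)
  from rigid_sawtooth[OF rigid _ _ _ _ _ _ c1 c2 c3 this, of B]
  obtain \<rho>1 \<rho>2 where "AE u in lborel. AE v in lborel. H1 u + H2 v + H3 (u + v)
      = 1 - (frac (\<rho>1 - u) + frac (\<rho>2 - v) - frac (\<rho>1 - u + (\<rho>2 - v)))"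
    using B unfolding H1_def H2_def H3_def by (auto simp: measurable_compose)
  note ae = this
  have "Measurable.pred (borel \<Otimes>\<^sub>M borel) (\<lambda>p. H1 (fst p) + H2 (snd p) + H3 (fst p + snd p)
      = 1 - (frac (\<rho>1 - fst p) + frac (\<rho>2 - snd p) - frac (\<rho>1 - fst p + (\<rho>2 - snd p))))"
    by measurable
  from transfer[of "\<lambda>u v. H1 u + H2 v + H3 (u + v)
      = 1 - (frac (\<rho>1 - u) + frac (\<rho>2 - v) - frac (\<rho>1 - u + (\<rho>2 - v)))", OF this, THEN iffD2, OF ae]
  have S: "AE p in lborel. h1 (fst p - a1 * snd p) + h2 (fst p - a2 * snd p) + h3 (fst p - a3 * snd p)
      = 1 - (frac (\<rho>1 - k1 * (fst p - a1 * snd p)) + frac (\<rho>2 - k2 * (fst p - a2 * snd p))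
        - frac (\<rho>1 - k1 * (fst p - a1 * snd p) + (\<rho>2 - k2 * (fst p - a2 * snd p))))"
    by (simp only: F)
  have a3: "a3 = (k1 * a1 + k2 * a2) / (k1 + k2)" using k(2) k0(3) by (simp add: field_simps)
  show ?thesis
  proof (cases "k1 > 0")
    case True
    then have pos: "0 < k1" "0 < k2" using k(1) by (auto simp: zero_less_mult_iff)
    have "AE p in lborel. h1 (fst p - a1 * snd p) + h2 (fst p - a2 * snd p) + h3 (fst p - a3 * snd p)
        = sawtooth_field k1 k2 (- \<rho>1) (- \<rho>2) a1 a2 (fst p) (snd p)"
      using S AE_plane_characteristic[OF AE_affine_not_Ints[OF k0(1), of "- \<rho>1"], of a1]
        AE_plane_characteristic[OF AE_affine_not_Ints[OF k0(2), of "- \<rho>2"], of a2]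
        AE_plane_characteristic[OF AE_affine_not_Ints[OF k0(3), of "- \<rho>1 - \<rho>2"], of a3]
    proof eventually_elim
      case (elim p)
      define P where "P = k1 * (fst p - a1 * snd p) + - \<rho>1"
      define Q where "Q = k2 * (fst p - a2 * snd p) + - \<rho>2"
      have PQ: "(k1 + k2) * (fst p - a3 * snd p) + (- \<rho>1 - \<rho>2) = P + Q"
        unfolding lines[symmetric] P_def Q_def by simp
      have "\<rho>1 - k1 * (fst p - a1 * snd p) = - P" "\<rho>2 - k2 * (fst p - a2 * snd p) = - Q"
        "\<rho>1 - k1 * (fst p - a1 * snd p) + (\<rho>2 - k2 * (fst p - a2 * snd p)) = - (P + Q)"
        by (simp_all add: P_def Q_def)
      moreover have "P \<notin> \<int>" "Q \<notin> \<int>" "P + Q \<notin> \<int>"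
        using elim(2-4) unfolding PQ P_def[symmetric] Q_def[symmetric] by simp_all
      ultimately have "h1 (fst p - a1 * snd p) + h2 (fst p - a2 * snd p) + h3 (fst p - a3 * snd p)
          = frac P + frac Q - frac (P + Q)"
        using elim(1) frac_minus[of P] frac_minus[of Q] frac_minus[of "P + Q"] by (simp only:) simp
      also have "\<dots> = sawtooth_field k1 k2 (- \<rho>1) (- \<rho>2) a1 a2 (fst p) (snd p)"
      proof -
        have "k1 * (fst p - a1 * snd p) + k2 * (fst p - a2 * snd p) + - \<rho>1 + - \<rho>2 = P + Q"
          by (simp add: P_def Q_def)
        then show ?thesis unfolding sawtooth_field_def P_def[symmetric] Q_def[symmetric] by (simp only:)
      qed
      finally show ?case .
    qed
    then show ?thesis using pos a3 by blast
  next
    case False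
    then have pos: "0 < - k1" "0 < - k2" using k(1) by (auto simp: zero_less_mult_iff)
    have "AE p in lborel. h1 (fst p - a1 * snd p) + h2 (fst p - a2 * snd p) + h3 (fst p - a3 * snd p)
        = 1 - sawtooth_field (- k1) (- k2) \<rho>1 \<rho>2 a1 a2 (fst p) (snd p)"
      using S by (simp add: sawtooth_field_def algebra_simps)
    moreover have "a3 = (- k1 * a1 + - k2 * a2) / (- k1 + - k2)"
    proof -
      have "(- k1 * a1 + - k2 * a2) / (- k1 + - k2) = (- (k1 * a1 + k2 * a2)) / (- (k1 + k2))" by simp
      also have "\<dots> = (k1 * a1 + k2 * a2) / (k1 + k2)" by (rule minus_divide_divide)
      finally show ?thesis using a3 by simp
    qed
    ultimately show ?thesis using pos by blast
  qed
qed

text \<open>The two resonance relations make the wavenumbers all zero or all nonzero. In the latter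
  case two of the three share a sign; these are the non-inverted waves \<open>i\<close> and
  \<open>j\<close>.\<close>

lemma three_waves_classification:
  assumes sol: "wave_solution 3 a f"
  shows "(\<forall>d\<in>{1..3}. integer_valued (f d)) \<or>
    (\<forall>d\<in>{1..3}. \<not> integer_valued (f d)) \<and>
    (\<exists>i j m k1 k2 k3.
       {i, j, m} = {1, 2, 3} \<and> 0 < k1 * k2 \<and>
       linear_phase (f i) k1 \<and> linear_phase (f j) k2 \<and> linear_phase (f m) (- k3) \<and>
       k1 + k2 = k3 \<and> k1 * a i + k2 * a j = k3 * a m \<and>
       (floor_rigidity \<and> bounded_profiles 3 f \<longrightarrow>
          sawtooth_form a i j m (superposition 3 a f)))"
proof -
  have inj: "inj_on a {1..3}" using sol by (simp add: wave_solution_def)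
  have set3: "{1..3::nat} = {1, 2, 3}" by auto
  have ne: "a 1 \<noteq> a 2" "a 1 \<noteq> a 3" "a 2 \<noteq> a 3"
    using inj unfolding set3 by (auto dest: inj_onD)
  obtain g where g: "\<forall>d\<in>{1..3}. g d \<in> borel_measurable borel \<and> (AE s in lborel. f d s = g d s) \<and>
      range (g d) \<subseteq> range (f d) \<and> \<not> (\<exists>c. AE s in lborel. g d s = c)"
    and fg_sum: "AE p in lborel. superposition 3 a f (fst p) (snd p) = (\<Sum>d=1..3. g d (fst p - a d * snd p))"
    and two: "AE p in lborel. (\<Sum>d=1..3. g d (fst p - a d * snd p)) \<in> {0, 1}"
    by (rule wave_solution_borel[OF sol])
  have gm: "g d \<in> borel_measurable borel" and fg: "AE s in lborel. f d s = g d s"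
    and range: "range (g d) \<subseteq> range (f d)" if "d \<in> {1..3}" for d
    using bspec[OF g that] by - (elim conjE, assumption)+
  obtain \<gamma> k where ph: "\<forall>d\<in>{1..3::nat}. norm (\<gamma> d) = 1 \<and>
      (AE s in lborel. cis (2 * pi * g d s) = \<gamma> d * cis (k d * s))"
    and k: "k 1 + k 2 + k 3 = 0" "k 1 * a 1 + k 2 * a 2 + k 3 * a 3 = 0"
    by (rule three_wave_phases[OF gm inj two])
  have \<gamma>: "norm (\<gamma> d) = 1" and phase: "AE s in lborel. cis (2 * pi * g d s) = \<gamma> d * cis (k d * s)"
    if "d \<in> {1..3}" for d
    using bspec[OF ph that] by - (elim conjE, assumption)+
  have intk: "integer_valued (f d) \<longleftrightarrow> k d = 0" if "d \<in> {1..3}" for d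
    by (rule integer_valued_iff_phase[OF fg[OF that] \<gamma>[OF that] phase[OF that]])
  \<comment> \<open>Eliminating one wave from the two relations leaves a proportion whose
    coefficients are nonzero because the speeds are distinct.\<close>
  have e1: "k 1 * (a 1 - a 3) + k 2 * (a 2 - a 3) = 0"
  proof -
    have "k 1 * (a 1 - a 3) + k 2 * (a 2 - a 3)
        = (k 1 * a 1 + k 2 * a 2 + k 3 * a 3) - a 3 * (k 1 + k 2 + k 3)" by (simp add: algebra_simps)
    then show ?thesis using k by simp
  qed
  have e2: "k 1 * (a 1 - a 2) + k 3 * (a 3 - a 2) = 0"
  proof -
    have "k 1 * (a 1 - a 2) + k 3 * (a 3 - a 2)
        = (k 1 * a 1 + k 2 * a 2 + k 3 * a 3) - a 2 * (k 1 + k 2 + k 3)" by (simp add: algebra_simps)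
    then show ?thesis using k by simp
  qed
  have z: "k 1 = 0 \<longleftrightarrow> k 2 = 0" "k 1 = 0 \<longleftrightarrow> k 3 = 0"
    using e1 e2 ne by auto
  show ?thesis
  proof (cases "k 1 = 0")
    case True
    then show ?thesis using z intk unfolding set3 by auto
  next
    case False
    then have nz: "k 1 \<noteq> 0" "k 2 \<noteq> 0" "k 3 \<noteq> 0" using z by auto
    have "0 < k 1 * k 2 \<or> 0 < k 1 * k 3 \<or> 0 < k 2 * k 3"
      using nz by (auto simp: zero_less_mult_iff)
    then obtain i j m where ijm: "{i, j, m} = {1, 2, 3 :: nat}" "i \<noteq> j" "j \<noteq> m" "i \<noteq> m" "0 < k i * k j"
    proof (elim disjE)
      assume *: "0 < k 1 * k 2" show ?thesis by (rule that[of 1 2 3]) (use * in auto)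
    next
      assume *: "0 < k 1 * k 3" show ?thesis by (rule that[of 1 3 2]) (use * in auto)
    next
      assume *: "0 < k 2 * k 3" show ?thesis by (rule that[of 2 3 1]) (use * in auto)
    qed
    have S: "{1..3} = {i, j, m}" using ijm(1) set3 by simp
    have mem: "i \<in> {1..3}" "j \<in> {1..3}" "m \<in> {1..3}" unfolding S by auto
    have sum3: "(\<Sum>d=1..3. w d) = w i + w j + w m" for w :: "nat \<Rightarrow> real"
      unfolding S using ijm(2-4) by simp
    have k_sum: "k i + k j + k m = 0" "k i * a i + k j * a j + k m * a m = 0"
    proof -
      have w3: "(\<Sum>d=1..3. w d) = w 1 + w 2 + w 3" for w :: "nat \<Rightarrow> real"
        unfolding set3 by simp
      show "k i + k j + k m = 0" using k(1) sum3[of k] w3[of k] by linarith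
      show "k i * a i + k j * a j + k m * a m = 0"
        using k(2) sum3[of "\<lambda>d. k d * a d"] w3[of "\<lambda>d. k d * a d"] by linarith
    qed
    \<comment> \<open>Wavenumbers in turns instead of radians, to match the factor
      \<open>2 * pi\<close> in \<open>linear_phase\<close>.\<close>
    define k1 where "k1 = k i / (2 * pi)"
    define k2 where "k2 = k j / (2 * pi)"
    have K: "2 * pi * (k1 * s) = k i * s" "2 * pi * (k2 * s) = k j * s" for s
      by (simp_all add: k1_def k2_def)
    have km: "k m = - (k i + k j)" using k_sum(1) by linarith
    have Km: "2 * pi * (- (k1 + k2) * s) = k m * s" for s
    proof -
      have "2 * pi * (- (k1 + k2) * s) = - (2 * pi * (k1 * s) + 2 * pi * (k2 * s))" by (simp add: algebra_simps)
      then show ?thesis unfolding K km by (simp add: algebra_simps)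
    qed
    have pos: "0 < k1 * k2" using ijm(5) by (simp add: k1_def k2_def)
    have freq: "k1 * a i + k2 * a j = (k1 + k2) * a m"
    proof -
      have "k i * a i + k j * a j = (k i + k j) * a m" using k_sum(2) unfolding km by (simp add: algebra_simps)
      then show ?thesis by (simp add: k1_def k2_def add_divide_distrib[symmetric])
    qed
    have phi: "AE s in lborel. cis (2 * pi * g i s) = \<gamma> i * cis (2 * pi * (k1 * s))"
      and phj: "AE s in lborel. cis (2 * pi * g j s) = \<gamma> j * cis (2 * pi * (k2 * s))"
      and phm: "AE s in lborel. cis (2 * pi * g m s) = \<gamma> m * cis (2 * pi * (- (k1 + k2) * s))"
      using phase[OF mem(1)] phase[OF mem(2)] phase[OF mem(3)] unfolding K Km .
    have lin: "linear_phase (f d) l" if "d \<in> {1..3}" "AE s in lborel. cis (2 * pi * g d s) = \<gamma> d * cis (2 * pi * (l * s))" for d l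
    proof -
      have "AE s in lborel. cis (2 * pi * f d s) = \<gamma> d * cis (2 * pi * l * s)"
        using fg[OF that(1)] that(2) by eventually_elim (simp add: mult.assoc)
      then show ?thesis by (auto simp: linear_phase_def AE_lebesgue_iff)
    qed
    have saw: "sawtooth_form a i j m (superposition 3 a f)" if rb: "floor_rigidity" "bounded_profiles 3 f"
    proof -
      have "bounded (\<Union>d\<in>{1..3}. range (g d))"
      proof (rule bounded_UN)
        show "\<forall>d\<in>{1..3}. bounded (range (g d))"
        proof
          fix d :: nat assume d: "d \<in> {1..3}"
          then have "bounded (range (f d))" using rb(2) by (simp add: bounded_profiles_def)
          then show "bounded (range (g d))" by (rule bounded_subset[OF _ range[OF d]])
        qed
      qed simp
      then obtain B where "\<forall>y\<in>(\<Union>d\<in>{1..3}. range (g d)). norm y \<le> B"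
        unfolding bounded_iff by blast
      then have B: "\<bar>g d s\<bar> \<le> B" if "d \<in> {1..3}" for d s
        using that unfolding real_norm_def[symmetric] by blast
      have two': "AE p in lborel. g i (fst p - a i * snd p) + g j (fst p - a j * snd p) + g m (fst p - a m * snd p) \<in> {0, 1}"
        using two unfolding sum3 .
      have sup: "AE p in lborel. superposition 3 a f (fst p) (snd p)
          = g i (fst p - a i * snd p) + g j (fst p - a j * snd p) + g m (fst p - a m * snd p)"
        using fg_sum unfolding sum3 .
      have "a i \<noteq> a j" using inj mem ijm(2) by (auto dest: inj_onD)
      from three_waves_sawtooth[OF rb(1) gm[OF mem(1)] gm[OF mem(2)] gm[OF mem(3)] B[OF mem(1)] B[OF mem(2)]
          B[OF mem(3)] this pos freq[symmetric] \<gamma>[OF mem(1)] \<gamma>[OF mem(2)] \<gamma>[OF mem(3)] phi phj phm two']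
      obtain l1 l3 r1 r3 where l: "0 < l1" "0 < l3" "a m = (l1 * a i + l3 * a j) / (l1 + l3)"
        and alt: "(AE p in lborel. g i (fst p - a i * snd p) + g j (fst p - a j * snd p) + g m (fst p - a m * snd p)
            = sawtooth_field l1 l3 r1 r3 (a i) (a j) (fst p) (snd p)) \<or>
          (AE p in lborel. g i (fst p - a i * snd p) + g j (fst p - a j * snd p) + g m (fst p - a m * snd p)
            = 1 - sawtooth_field l1 l3 r1 r3 (a i) (a j) (fst p) (snd p))"
        by blast
      from alt have "(AE p in lborel. superposition 3 a f (fst p) (snd p)
            = sawtooth_field l1 l3 r1 r3 (a i) (a j) (fst p) (snd p)) \<or>
          (AE p in lborel. superposition 3 a f (fst p) (snd p)
            = 1 - sawtooth_field l1 l3 r1 r3 (a i) (a j) (fst p) (snd p))"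
      proof
        assume "AE p in lborel. g i (fst p - a i * snd p) + g j (fst p - a j * snd p) + g m (fst p - a m * snd p)
            = sawtooth_field l1 l3 r1 r3 (a i) (a j) (fst p) (snd p)"
        with sup have "AE p in lborel. superposition 3 a f (fst p) (snd p)
            = sawtooth_field l1 l3 r1 r3 (a i) (a j) (fst p) (snd p)"
          by eventually_elim simp
        then show ?thesis by blast
      next
        assume "AE p in lborel. g i (fst p - a i * snd p) + g j (fst p - a j * snd p) + g m (fst p - a m * snd p)
            = 1 - sawtooth_field l1 l3 r1 r3 (a i) (a j) (fst p) (snd p)"
        with sup have "AE p in lborel. superposition 3 a f (fst p) (snd p)
            = 1 - sawtooth_field l1 l3 r1 r3 (a i) (a j) (fst p) (snd p)"
          by eventually_elim simp
        then show ?thesis by blast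
      qed
      with l show ?thesis unfolding sawtooth_form_def AE_lebesgue_iff by blast
    qed
    have nonint: "\<forall>d\<in>{1..3}. \<not> integer_valued (f d)" using nz intk unfolding set3 by simp
    show ?thesis
      by (intro disjI2 conjI exI[of _ i] exI[of _ j] exI[of _ m] exI[of _ k1] exI[of _ k2] exI[of _ "k1 + k2"] impI)
        (rule nonint ijm(1) pos lin[OF mem(1) phi] lin[OF mem(2) phj] lin[OF mem(3) phm] refl freq
          | (erule conjE, erule (1) saw))+
  qed
qed

section \<open>Two waves\<close>

text \<open>Take two generic points at which the first profile has different values. For almost
  every \<open>v\<close> both sums lie in \<open>{0, 1}\<close>, so the smaller one is 0, and this
  determines \<open>g 2 v\<close>.\<close>

lemma no_two_wave_solution: "\<not> wave_solution 2 a f"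
proof
  assume sol: "wave_solution 2 a f"
  obtain g where g: "\<forall>d\<in>{1..2}. g d \<in> borel_measurable borel \<and> (AE s in lborel. f d s = g d s) \<and>
      range (g d) \<subseteq> range (f d) \<and> \<not> (\<exists>c. AE s in lborel. g d s = c)"
    and two: "AE p in lborel. (\<Sum>d=1..2. g d (fst p - a d * snd p)) \<in> {0, 1}"
    by (rule wave_solution_borel[OF sol])
  have set2: "{1..2::nat} = {1, 2}" by auto
  have [measurable]: "g 1 \<in> borel_measurable borel" "g 2 \<in> borel_measurable borel"
    and nc: "\<not> (\<exists>c. AE s in lborel. g 1 s = c)" "\<not> (\<exists>c. AE s in lborel. g 2 s = c)"
    using g unfolding set2 by auto
  have ne: "a 1 \<noteq> a 2"
    using sol unfolding wave_solution_def set2 by (auto dest: inj_onD)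
  have "AE p in lborel. g 1 (fst p - a 1 * snd p) + g 2 (fst p - a 2 * snd p) \<in> {0, 1}"
    using two unfolding set2 by simp
  moreover have "Measurable.pred (borel \<Otimes>\<^sub>M borel) (\<lambda>p. g 1 (fst p) + g 2 (snd p) \<in> {0, 1})"
    by measurable
  ultimately have ae: "AE u in lborel. AE v in lborel. g 1 u + g 2 v \<in> {0, 1}"
    using AE_characteristics[OF ne, of "\<lambda>u v. g 1 u + g 2 v \<in> {0, 1}"] by blast
  obtain u where u: "AE v in lborel. g 1 u + g 2 v \<in> {0, 1}" by (rule AE_real_ex[OF ae])
  have "\<exists>w. (AE v in lborel. g 1 w + g 2 v \<in> {0, 1}) \<and> g 1 w \<noteq> g 1 u"
  proof (rule ccontr)
    assume "\<not> ?thesis"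
    then have "AE w in lborel. g 1 w = g 1 u"
      using ae by (auto elim: eventually_mono)
    with nc(1) show False by blast
  qed
  then obtain w where w: "AE v in lborel. g 1 w + g 2 v \<in> {0, 1}" "g 1 w \<noteq> g 1 u" by blast
  have "AE v in lborel. g 2 v = - min (g 1 u) (g 1 w)"
    using u w(1) by eventually_elim (use w(2) in auto)
  with nc(2) show False by blast
qed

section \<open>The sawtooth solution\<close>

text \<open>Nonconstancy modulo null sets is reduced to a pointwise check: two intervals of positive
  length on which the profile has no common value.\<close>

lemma wave_solutionI:
  assumes "n \<ge> 1" "inj_on a {1..n}"
    and "\<And>d. d \<in> {1..n} \<Longrightarrow> f d \<in> borel_measurable borel"
    and "\<And>d. d \<in> {1..n} \<Longrightarrow> \<exists>p q r s. p < q \<and> r < s \<and> (\<forall>x\<in>{p..q}. \<forall>y\<in>{r..s}. f d x \<noteq> f d y)"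
    and "AE p in lborel. superposition n a f (fst p) (snd p) \<in> {0, 1}"
  shows "wave_solution n a f"
proof -
  have "\<not> (\<exists>c. AE s in lebesgue. f d s = c)" if d: "d \<in> {1..n}" for d
  proof
    assume "\<exists>c. AE s in lebesgue. f d s = c"
    then obtain c where c: "AE s in lborel. f d s = c" by (auto simp: AE_lebesgue_iff)
    obtain p q r s where pq: "p < q" "r < s" "\<forall>x\<in>{p..q}. \<forall>y\<in>{r..s}. f d x \<noteq> f d y"
      using assms(4)[OF d] by blast
    obtain x where "x \<in> {p..q}" "f d x = c" by (rule AE_real_ex_Icc[OF c pq(1)])
    moreover obtain y where "y \<in> {r..s}" "f d y = c" by (rule AE_real_ex_Icc[OF c pq(2)])
    ultimately show False using pq(3) by metis
  qed
  with assms show ?thesis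
    unfolding wave_solution_def AE_lebesgue_iff by (simp add: measurable_completion)
qed

lemma weighted_mean_between:
  fixes a1 a2 a3 :: real
  assumes "a1 < a3" "0 < l1" "0 < l3" "a2 = (l1 * a1 + l3 * a3) / (l1 + l3)"
  shows "a1 < a2" "a2 < a3"
proof -
  have "l3 * a1 < l3 * a3" "l1 * a1 < l1 * a3" using assms by simp_all
  then have "a1 * (l1 + l3) < l1 * a1 + l3 * a3" "l1 * a1 + l3 * a3 < a3 * (l1 + l3)"
    by (simp_all add: algebra_simps)
  then show "a1 < a2" "a2 < a3"
    unfolding assms(4) using assms(2,3) by (simp_all add: pos_less_divide_eq pos_divide_less_eq)
qed

text \<open>\<open>frac p + frac q - frac (p + q)\<close> is the carry in the addition of fractional
  parts.\<close>

lemma sawtooth_field_two_valued: "sawtooth_field l1 l3 r1 r3 a1 a3 x t \<in> {0, 1}"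
proof -
  have "frac p + frac q - frac (p + q) \<in> {0, 1}" for p q :: real
    unfolding frac_add by auto
  from this[of "l1 * (x - a1 * t) + r1" "l3 * (x - a3 * t) + r3"]
  show ?thesis by (simp add: sawtooth_field_def algebra_simps)
qed

lemma frac_linear_separated:
  fixes l r :: real
  assumes "l > 0"
  shows "\<exists>p q p' q'. p < q \<and> p' < q' \<and> (\<forall>x\<in>{p..q}. \<forall>y\<in>{p'..q'}. frac (l * x + r) \<noteq> frac (l * y + r))"
proof (intro exI conjI ballI)
  show "(1/5 - r) / l < (2/5 - r) / l" "(3/5 - r) / l < (4/5 - r) / l"
    using assms by (simp_all add: divide_strict_right_mono)
  fix x y assume "x \<in> {(1/5 - r) / l..(2/5 - r) / l}" "y \<in> {(3/5 - r) / l..(4/5 - r) / l}"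
  then have "1/5 \<le> l * x + r" "l * x + r \<le> 2/5" "3/5 \<le> l * y + r" "l * y + r \<le> 4/5"
    using assms by (auto simp: field_simps)
  moreover from this have "frac (l * x + r) = l * x + r" "frac (l * y + r) = l * y + r"
    by (auto simp: frac_eq)
  ultimately show "frac (l * x + r) \<noteq> frac (l * y + r)" by linarith
qed

lemma sawtooth_solution:
  fixes a :: "nat \<Rightarrow> real"
  assumes "a 1 < a 3" "0 < l1" "0 < l3" and a2: "a 2 = (l1 * a 1 + l3 * a 3) / (l1 + l3)"
  shows "wave_solution 3 a (sawtooth_profiles l1 l3 r1 r3)"
    and "bounded_profiles 3 (sawtooth_profiles l1 l3 r1 r3)"
    and "superposition 3 a (sawtooth_profiles l1 l3 r1 r3) = sawtooth_field l1 l3 r1 r3 (a 1) (a 3)"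
proof -
  have set3: "{1..3::nat} = {1, 2, 3}" by auto
  note lt = weighted_mean_between[OF assms]
  have l: "l1 + l3 \<noteq> 0" "l1 + l3 > 0" using assms by auto
  show sup: "superposition 3 a (sawtooth_profiles l1 l3 r1 r3) = sawtooth_field l1 l3 r1 r3 (a 1) (a 3)"
  proof (intro ext)
    fix x t
    have "(l1 + l3) * a 2 = l1 * a 1 + l3 * a 3" using l by (simp add: a2)
    then have "(l1 + l3) * a 2 * t = (l1 * a 1 + l3 * a 3) * t" by simp
    then have "(l1 + l3) * (x - a 2 * t) + r1 + r3 = l1 * (x - a 1 * t) + l3 * (x - a 3 * t) + r1 + r3"
      by (simp add: algebra_simps)
    then show "superposition 3 a (sawtooth_profiles l1 l3 r1 r3) x t = sawtooth_field l1 l3 r1 r3 (a 1) (a 3) x t"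
      unfolding superposition_def set3 sawtooth_field_def by (simp add: sawtooth_profiles_def)
  qed
  have "\<bar>sawtooth_profiles l1 l3 r1 r3 d s\<bar> \<le> 1" for d s
    using frac_ge_0 frac_lt_1[THEN less_imp_le] by (auto simp: sawtooth_profiles_def)
  then show "bounded_profiles 3 (sawtooth_profiles l1 l3 r1 r3)"
    unfolding bounded_profiles_def bounded_iff by auto
  show "wave_solution 3 a (sawtooth_profiles l1 l3 r1 r3)"
  proof (rule wave_solutionI)
    show "inj_on a {1..3}" unfolding set3 using lt by (auto simp: inj_on_def)
    show "sawtooth_profiles l1 l3 r1 r3 d \<in> borel_measurable borel" for d
      unfolding sawtooth_profiles_def[abs_def] frac_def by measurable
    show "AE p in lborel. superposition 3 a (sawtooth_profiles l1 l3 r1 r3) (fst p) (snd p) \<in> {0, 1}"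
      unfolding sup by (intro AE_I2 sawtooth_field_two_valued)
    fix d :: nat assume "d \<in> {1..3}"
    then consider "d = 1" | "d = 2" | "d = 3" by force
    then show "\<exists>p q r s. p < q \<and> r < s \<and> (\<forall>x\<in>{p..q}. \<forall>y\<in>{r..s}.
        sawtooth_profiles l1 l3 r1 r3 d x \<noteq> sawtooth_profiles l1 l3 r1 r3 d y)"
    proof cases
      case 1
      then show ?thesis using frac_linear_separated[OF assms(2), of r1] by (simp add: sawtooth_profiles_def)
    next
      case 2
      then show ?thesis using frac_linear_separated[OF l(2), of "r1 + r3"] by (simp add: sawtooth_profiles_def add.assoc)
    next
      case 3
      then show ?thesis using frac_linear_separated[OF assms(3), of r3] by (simp add: sawtooth_profiles_def)
    qed
  qed simp
qed

section \<open>Three fronts\<close>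

lemma heaviside_measurable [measurable]: "heaviside \<in> borel_measurable borel"
  unfolding heaviside_def by measurable

lemma heaviside_simps: "0 \<le> s \<Longrightarrow> heaviside s = 1" "s < 0 \<Longrightarrow> heaviside s = 0"
  by (simp_all add: heaviside_def)

lemma AE_box:
  fixes Q :: "real \<Rightarrow> real \<Rightarrow> bool"
  assumes "AE u in lborel. AE v in lborel. Q u v" "p < q" "r < s"
  obtains u v where "u \<in> {p..q}" "v \<in> {r..s}" "Q u v"
proof -
  obtain u where u: "u \<in> {p..q}" "AE v in lborel. Q u v" by (rule AE_real_ex_Icc[OF assms(1,2)])
  obtain v where v: "v \<in> {r..s}" "Q u v" by (rule AE_real_ex_Icc[OF u(2) assms(3)])
  show ?thesis by (rule that[OF u(1) v])
qed

text \<open>If the third line misses the intersection of the first two, the three lines bound a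
  triangle, and the field takes a third value on it.\<close>

lemma two_valued_fronts_concurrent:
  assumes ae: "AE u in lborel. AE v in lborel.
      heaviside (u - a) + heaviside (v - b) - heaviside (\<alpha> * u + \<beta> * v - c) \<in> {y, z}"
    and pos: "\<alpha> > 0" "\<beta> > 0"
  shows "c = \<alpha> * a + \<beta> * b"
proof (rule ccontr)
  assume "c \<noteq> \<alpha> * a + \<beta> * b"
  define e where "e = c - (\<alpha> * a + \<beta> * b)"
  have val: "w \<in> {y, z}" if "p < q" "r < s"
    "\<And>u v. u \<in> {p..q} \<Longrightarrow> v \<in> {r..s} \<Longrightarrow>
      heaviside (u - a) + heaviside (v - b) - heaviside (\<alpha> * u + \<beta> * v - c) = w" for w p q r s
    by (rule AE_box[OF ae that(1,2)]) (use that(3) in auto)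
  have mono: "\<alpha> * p + \<beta> * r \<le> \<alpha> * u + \<beta> * v" "\<alpha> * u + \<beta> * v \<le> \<alpha> * q + \<beta> * s"
    if "u \<in> {p..q}" "v \<in> {r..s}" for u v p q r s
    using that pos by (auto intro!: add_mono mult_left_mono)
  show False
  proof (cases "e > 0")
    case True
    \<comment> \<open>The box with sides \<open>d1\<close> and \<open>d2\<close> above the corner
      \<open>(a, b)\<close> uses up only half of the gap \<open>e\<close>, so it stays before the
      third line; the values 0, 1 and 2 all occur.\<close>
    define d1 where "d1 = e / (4 * \<alpha>)"
    define d2 where "d2 = e / (4 * \<beta>)"
    have d: "d1 > 0" "d2 > 0" "\<alpha> * d1 = e / 4" "\<beta> * d2 = e / 4"
      using True pos by (simp_all add: d1_def d2_def)
    have "0 \<in> {y, z}"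
    proof (rule val[of "a - 2" "a - 1" "b - 2" "b - 1"])
      fix u v assume uv: "u \<in> {a - 2..a - 1}" "v \<in> {b - 2..b - 1}"
      have "\<alpha> * u + \<beta> * v < c" using mono(2)[OF uv] True pos e_def
        unfolding distrib_left right_diff_distrib by linarith
      then show "heaviside (u - a) + heaviside (v - b) - heaviside (\<alpha> * u + \<beta> * v - c) = 0"
        using uv by (simp add: heaviside_simps)
    qed simp_all
    moreover have "2 \<in> {y, z}"
    proof (rule val[of "a" "a + d1" "b" "b + d2"])
      fix u v assume uv: "u \<in> {a..a + d1}" "v \<in> {b..b + d2}"
      have "\<alpha> * u + \<beta> * v < c" using mono(2)[OF uv] True d e_def
        unfolding distrib_left right_diff_distrib by linarith
      then show "heaviside (u - a) + heaviside (v - b) - heaviside (\<alpha> * u + \<beta> * v - c) = 2"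
        using uv by (simp add: heaviside_simps)
    qed (use d in simp_all)
    moreover have "1 \<in> {y, z}"
    proof (rule val[of "a" "a + d1" "b - 2" "b - 1"])
      fix u v assume uv: "u \<in> {a..a + d1}" "v \<in> {b - 2..b - 1}"
      have "\<alpha> * u + \<beta> * v < c" using mono(2)[OF uv] True d pos e_def
        unfolding distrib_left right_diff_distrib by linarith
      then show "heaviside (u - a) + heaviside (v - b) - heaviside (\<alpha> * u + \<beta> * v - c) = 1"
        using uv by (simp add: heaviside_simps)
    qed (use d in simp_all)
    ultimately show False by auto
  next
    case False
    then have e: "e < 0" using \<open>c \<noteq> \<alpha> * a + \<beta> * b\<close> by (simp add: e_def)
    \<comment> \<open>Mirror image: just below the corner the third term is already switched on
      while the first two are not, which adds the value -1 to 0 and 1.\<close>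
    define d1 where "d1 = - e / (4 * \<alpha>)"
    define d2 where "d2 = - e / (4 * \<beta>)"
    have d: "d1 > 0" "d2 > 0" "\<alpha> * d1 = - e / 4" "\<beta> * d2 = - e / 4"
    proof -
      show "d1 > 0" "d2 > 0" unfolding d1_def d2_def by (rule divide_pos_pos; use e pos in simp)+
    qed (use pos in \<open>simp_all add: d1_def d2_def\<close>)
    have "- 1 \<in> {y, z}"
    proof (rule val[of "a - d1" "a - d1 / 2" "b - d2" "b - d2 / 2"])
      fix u v assume uv: "u \<in> {a - d1..a - d1 / 2}" "v \<in> {b - d2..b - d2 / 2}"
      have "c < \<alpha> * u + \<beta> * v" using mono(1)[OF uv] e d e_def
        unfolding distrib_left right_diff_distrib by linarith
      then show "heaviside (u - a) + heaviside (v - b) - heaviside (\<alpha> * u + \<beta> * v - c) = - 1"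
        using uv d by (simp add: heaviside_simps)
    qed (use d in simp_all)
    \<comment> \<open>A retreat of \<open>u\<close> by \<open>4 * d1\<close> makes up for the whole
      gap, so here all three terms are off.\<close>
    moreover have "0 \<in> {y, z}"
    proof (rule val[of "a - 8 * d1" "a - 4 * d1" "b - 2" "b - 1"])
      fix u v assume uv: "u \<in> {a - 8 * d1..a - 4 * d1}" "v \<in> {b - 2..b - 1}"
      have "\<alpha> * u + \<beta> * v < c" using mono(2)[OF uv] e d pos e_def
        unfolding distrib_left right_diff_distrib by linarith
      then show "heaviside (u - a) + heaviside (v - b) - heaviside (\<alpha> * u + \<beta> * v - c) = 0"
        using uv d by (simp add: heaviside_simps)
    qed (use d in simp_all)
    moreover have "1 \<in> {y, z}"
    proof (rule val[of "a" "a + 1" "b" "b + 1"])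
      fix u v assume uv: "u \<in> {a..a + 1}" "v \<in> {b..b + 1}"
      have "c < \<alpha> * u + \<beta> * v" using mono(1)[OF uv] e e_def
        unfolding distrib_left right_diff_distrib by linarith
      then show "heaviside (u - a) + heaviside (v - b) - heaviside (\<alpha> * u + \<beta> * v - c) = 1"
        using uv by (simp add: heaviside_simps)
    qed simp_all
    ultimately show False by auto
  qed
qed

lemma plane_fronts_concurrent:
  assumes "AE p in lebesgue.
      heaviside (fst p - a) + heaviside (snd p - b) - heaviside (fst p + snd p - c) \<in> {y, z}"
  shows "c = a + b"
proof -
  have m: "Measurable.pred (borel \<Otimes>\<^sub>M borel)
      (\<lambda>p. heaviside (fst p - a) + heaviside (snd p - b) - heaviside (fst p + snd p - c) \<in> {y, z})"
    by measurable
  have "AE u in lborel. AE v in lborel. heaviside (u - a) + heaviside (v - b) - heaviside (u + v - c) \<in> {y, z}"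
    using assms AE_plane_iff(1)[of "\<lambda>u v. heaviside (u - a) + heaviside (v - b) - heaviside (u + v - c) \<in> {y, z}", OF m]
    unfolding AE_lebesgue_iff by blast
  with two_valued_fronts_concurrent[of a b 1 1 c y z] show ?thesis by simp
qed

text \<open>If \<alpha> were negative, then for \<open>u\<close> far to the left the third term
  would be switched on while the first two are off, and the value -1 would occur.\<close>

lemma front_coefficient_nonneg:
  assumes ae: "AE u in lborel. AE v in lborel.
      heaviside (u - a) + heaviside (v - b) - heaviside (\<alpha> * u + \<beta> * v - c) \<in> {0, 1}"
    and "\<alpha> + \<beta> = 1"
  shows "\<alpha> \<ge> 0"
proof (rule ccontr)
  assume "\<not> \<alpha> \<ge> 0"
  then have \<alpha>: "\<alpha> < 0" and \<beta>: "\<beta> > 0" using assms(2) by auto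
  \<comment> \<open>Left of \<open>a\<close>, and so far out that
    \<open>\<alpha> * u + \<beta> * v \<ge> c\<close> for all \<open>u \<le> U\<close> and
    \<open>v \<ge> b - 2\<close>.\<close>
  define U where "U = min (a - 1) ((c + 1 - \<beta> * (b - 2)) / \<alpha>)"
  obtain u v where uv: "u \<in> {U - 1..U}" "v \<in> {b - 2..b - 1}"
    and val: "heaviside (u - a) + heaviside (v - b) - heaviside (\<alpha> * u + \<beta> * v - c) \<in> {0, 1}"
    by (rule AE_box[OF ae, of "U - 1" U "b - 2" "b - 1"]) auto
  have "u \<le> (c + 1 - \<beta> * (b - 2)) / \<alpha>" using uv by (auto simp: U_def)
  then have "\<alpha> * u \<ge> c + 1 - \<beta> * (b - 2)" using \<alpha> by (simp add: neg_le_divide_eq mult.commute)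
  moreover have "\<beta> * v \<ge> \<beta> * (b - 2)" using uv \<beta> by (intro mult_left_mono) auto
  ultimately have "\<alpha> * u + \<beta> * v - c \<ge> 0" by linarith
  moreover have "u < a" "v < b" using uv by (auto simp: U_def)
  ultimately show False using val by (simp add: heaviside_simps)
qed

text \<open>The argument of wave 2 is an affine combination of those of waves 1 and 3. Positive
  coefficients mean an intermediate speed, and the relation between the constants says that the
  second front passes through the crossing of the other two.\<close>

lemma front_solution_fan:
  assumes sol: "wave_solution 3 a (front_profiles c)"
  shows "min (a 1) (a 3) < a 2" "a 2 < max (a 1) (a 3)" "\<exists>x0 t0. \<forall>d\<in>{1..3}. x0 - a d * t0 = c d"
proof -
  have set3: "{1..3::nat} = {1, 2, 3}" by auto
  have inj: "inj_on a {1..3}" using sol by (simp add: wave_solution_def)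
  have ne: "a 1 \<noteq> a 2" "a 1 \<noteq> a 3" "a 2 \<noteq> a 3"
    using inj unfolding set3 by (auto dest: inj_onD)
  define \<alpha> where "\<alpha> = (a 2 - a 3) / (a 1 - a 3)"
  define \<beta> where "\<beta> = (a 1 - a 2) / (a 1 - a 3)"
  have sum1: "\<alpha> + \<beta> = 1" using ne by (simp add: \<alpha>_def \<beta>_def add_divide_distrib[symmetric])
  have a2: "a 2 = \<alpha> * a 1 + \<beta> * a 3"
  proof -
    have "(a 2 - a 3) * a 1 + (a 1 - a 2) * a 3 = a 2 * (a 1 - a 3)" by (simp add: algebra_simps)
    then show ?thesis using ne by (simp add: \<alpha>_def \<beta>_def add_divide_distrib[symmetric])
  qed
  have nz: "\<alpha> \<noteq> 0" "\<beta> \<noteq> 0" using ne by (auto simp: \<alpha>_def \<beta>_def)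
  have line: "\<alpha> * (x - a 1 * t) + \<beta> * (x - a 3 * t) = x - a 2 * t" for x t
  proof -
    have "\<alpha> * (x - a 1 * t) + \<beta> * (x - a 3 * t) = (\<alpha> + \<beta>) * x - (\<alpha> * a 1 + \<beta> * a 3) * t"
      by (simp add: algebra_simps)
    then show ?thesis unfolding sum1 a2[symmetric] by simp
  qed
  define Q where "Q u v \<longleftrightarrow> heaviside (u - c 1) + heaviside (v - c 3) - heaviside (\<alpha> * u + \<beta> * v - c 2) \<in> {0, 1}" for u v
  have m: "Measurable.pred (borel \<Otimes>\<^sub>M borel) (\<lambda>p. Q (fst p) (snd p))"
    unfolding Q_def by measurable
  have F: "superposition 3 a (front_profiles c) x t
      = heaviside (x - a 1 * t - c 1) + heaviside (x - a 3 * t - c 3) - heaviside (x - a 2 * t - c 2)" for x t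
    unfolding superposition_def set3 by (simp add: front_profiles_def)
  have "AE p in lborel. superposition 3 a (front_profiles c) (fst p) (snd p) \<in> {0, 1}"
    using sol by (simp add: wave_solution_def AE_lebesgue_iff)
  then have "AE p in lborel. Q (fst p - a 1 * snd p) (fst p - a 3 * snd p)"
    unfolding Q_def line F .
  then have ae: "AE u in lborel. AE v in lborel. Q u v"
    using AE_characteristics[OF ne(2) m] by blast
  then have ae': "AE v in lborel. AE u in lborel. Q u v"
    using AE_swap[OF m] by blast
  have "\<alpha> \<ge> 0" by (rule front_coefficient_nonneg[OF ae[unfolded Q_def] sum1])
  moreover have "\<beta> \<ge> 0"
    by (rule front_coefficient_nonneg[of "c 3" "c 1" \<beta> \<alpha> "c 2"])
      (use ae' sum1 in \<open>simp_all add: Q_def add.commute\<close>)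
  ultimately have pos: "\<alpha> > 0" "\<beta> > 0" using nz by auto
  have c2: "c 2 = \<alpha> * c 1 + \<beta> * c 3"
    by (rule two_valued_fronts_concurrent[OF ae[unfolded Q_def] pos])
  have "a 2 - a 1 = \<beta> * (a 3 - a 1)" "a 3 - a 2 = \<alpha> * (a 3 - a 1)"
  proof -
    have "\<alpha> * a 1 + \<beta> * a 1 = a 1" "\<alpha> * a 3 + \<beta> * a 3 = a 3"
      using sum1 by (simp_all flip: distrib_right)
    then show "a 2 - a 1 = \<beta> * (a 3 - a 1)" "a 3 - a 2 = \<alpha> * (a 3 - a 1)"
      unfolding a2 right_diff_distrib by linarith+
  qed
  then have s: "(0 < a 2 - a 1 \<longleftrightarrow> 0 < a 3 - a 1)" "(0 < a 3 - a 2 \<longleftrightarrow> 0 < a 3 - a 1)"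
    using pos by (simp_all add: zero_less_mult_iff)
  then show "min (a 1) (a 3) < a 2" "a 2 < max (a 1) (a 3)"
    using ne by (auto simp: min_def max_def)
  \<comment> \<open>Time and place at which the first and third fronts meet.\<close>
  define t0 where "t0 = (c 1 - c 3) / (a 3 - a 1)"
  define x0 where "x0 = c 1 + a 1 * t0"
  have t0: "(a 3 - a 1) * t0 = c 1 - c 3" using ne by (simp add: t0_def)
  have 1: "x0 - a 1 * t0 = c 1" by (simp add: x0_def)
  have 3: "x0 - a 3 * t0 = c 3" using t0 by (simp add: x0_def algebra_simps)
  have 2: "x0 - a 2 * t0 = c 2" unfolding line[symmetric] 1 3 c2 ..
  show "\<exists>x0 t0. \<forall>d\<in>{1..3}. x0 - a d * t0 = c d"
    unfolding set3 using 1 2 3 by auto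
qed

section \<open>Fans\<close>

lemma alternating_partial_sum: "(\<Sum>d=1..m. (-1) ^ (d - 1) :: real) = (if odd m then 1 else 0)"
  by (induction m) auto

text \<open>In the direction \<phi> the sign of \<open>x - a d * t\<close> is that of
  \<open>cos (\<phi> + \<beta> d)\<close> with \<open>\<beta> d = arctan (a d)\<close>, so front
  \<open>d\<close> lies at the angles \<open>\<plusminus> pi / 2 - \<beta> d\<close>. Each crossing
  flips one sign, in the order of the speeds, so the sum alternates between 1 and -1; for odd
  \<open>n\<close> this is consistent with the reversal of all signs after a half turn.\<close>

lemma fan_angles:
  fixes a :: "nat \<Rightarrow> real"
  assumes n: "odd n" and mono: "strict_mono_on {1..n} a"
  obtains \<theta> where "\<forall>j. \<theta> j < \<theta> (Suc j)" "\<forall>j. \<theta> (j + n) = \<theta> j + pi"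
    "\<forall>j. \<exists>d\<in>{1..n}. cos (\<theta> j) = a d * sin (\<theta> j)"
    "\<forall>j \<phi>. j < 2 * n \<and> \<theta> j < \<phi> \<and> \<phi> < \<theta> (Suc j) \<longrightarrow>
      (\<Sum>d=1..n. (-1) ^ (d - 1) * sgn (cos \<phi> - a d * sin \<phi>)) = (-1) ^ j"
proof -
  have n0: "n > 0" using n by (cases n) auto
  define \<beta> where "\<beta> d = arctan (a d)" for d
  have \<beta>_bd: "- pi / 2 < \<beta> d" "\<beta> d < pi / 2" for d
    using arctan_bounded[of "a d"] by (auto simp: \<beta>_def)
  have \<beta>_mono: "\<beta> d < \<beta> e" if "1 \<le> d" "d < e" "e \<le> n" for d e
    using that strict_mono_onD[OF mono, of d e] by (auto simp: \<beta>_def arctan_less_iff)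
  have \<beta>_mono': "\<beta> d \<le> \<beta> e" if "1 \<le> d" "d \<le> e" "e \<le> n" for d e
    using that \<beta>_mono[of d e] by (cases "d = e") auto
  \<comment> \<open>Faster fronts have smaller angles within a half turn, hence the reversed index
    \<open>n - j mod n\<close>; \<open>j div n\<close> counts half turns.\<close>
  define \<theta> where "\<theta> j = - pi / 2 - \<beta> (n - j mod n) + pi * of_nat (j div n)" for j
  have per: "\<theta> (j + n) = \<theta> j + pi" for j
    using n0 by (simp add: \<theta>_def algebra_simps)
  have small: "\<theta> j = - pi / 2 - \<beta> (n - j)" if "j < n" for j
    using that by (simp add: \<theta>_def)
  have last: "\<theta> n = pi / 2 - \<beta> n" using n0 by (simp add: \<theta>_def)
  have incr_small: "\<theta> j < \<theta> (Suc j)" if "j < n" for j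
  proof (cases "Suc j < n")
    case True
    then show ?thesis using \<beta>_mono[of "n - Suc j" "n - j"] by (simp add: small)
  next
    case False
    then have "j = n - 1" using that by simp
    then have "\<theta> j = - pi / 2 - \<beta> 1" "\<theta> (Suc j) = pi / 2 - \<beta> n" using n0 last by (simp_all add: small)
    then show ?thesis using \<beta>_bd(1)[of 1] \<beta>_bd(2)[of n] by simp
  qed
  have incr: "\<theta> j < \<theta> (Suc j)" for j
  proof (induction j rule: less_induct)
    case (less j)
    show ?case
    proof (cases "j < n")
      case False
      then have "\<theta> (j - n) < \<theta> (Suc (j - n))" using n0 by (intro less) auto
      then show ?thesis using False per[of "j - n"] per[of "Suc (j - n)"] by (simp add: Suc_diff_le)
    qed (rule incr_small)
  qed
  have le: "\<theta> i \<le> \<theta> j" if "i \<le> j" for i j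
    using lift_Suc_mono_le[of \<theta>, OF less_imp_le[OF incr] that] .
  have cos_rot: "sgn (cos \<phi> - a d * sin \<phi>) = sgn (cos (\<phi> + \<beta> d))" for \<phi> d
  proof -
    have pos: "cos (\<beta> d) > 0" using \<beta>_bd[of d] by (intro cos_gt_zero_pi) auto
    have "tan (\<beta> d) = a d" by (simp add: \<beta>_def arctan)
    then have "sin (\<beta> d) = a d * cos (\<beta> d)" using pos by (simp add: tan_def field_simps)
    then have "cos (\<phi> + \<beta> d) = cos (\<beta> d) * (cos \<phi> - a d * sin \<phi>)"
      by (simp add: cos_add algebra_simps)
    then show ?thesis using pos by (simp add: sgn_mult)
  qed
  have on_line: "\<exists>d\<in>{1..n}. cos (\<theta> j) = a d * sin (\<theta> j)" for j
  proof
    let ?d = "n - j mod n"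
    have "\<theta> j + \<beta> ?d = - pi / 2 + pi * of_nat (j div n)" by (simp add: \<theta>_def)
    also have "cos \<dots> = 0" by (simp add: cos_diff sin_npi2)
    finally have "sgn (cos (\<theta> j) - a ?d * sin (\<theta> j)) = 0" using cos_rot[of "\<theta> j" ?d] by simp
    then show "cos (\<theta> j) = a ?d * sin (\<theta> j)" by (simp add: sgn_0_0)
    show "?d \<in> {1..n}" using n0 mod_less_divisor[OF n0, of j] by simp
  qed
  have val_small: "(\<Sum>d=1..n. (-1) ^ (d - 1) * sgn (cos \<phi> - a d * sin \<phi>)) = (-1) ^ j"
    if j: "j < n" and \<phi>: "\<theta> j < \<phi>" "\<phi> < \<theta> (Suc j)" for j \<phi>
  proof -
    have up: "\<theta> (Suc j) \<le> pi / 2 - \<beta> n" using le[of "Suc j" n] j last by simp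
    have lo: "- pi / 2 - \<beta> n \<le> \<theta> j" using le[of 0 j] n0 small[of 0] by simp
    \<comment> \<open>In sector \<open>j\<close> of the first half turn the \<open>Suc j\<close>
      largest speeds have positive sign, all others negative.\<close>
    have s: "sgn (cos \<phi> - a d * sin \<phi>) = (if d \<le> n - Suc j then - 1 else 1)" if d: "d \<in> {1..n}" for d
    proof (cases "d \<le> n - Suc j")
      case True
      then have "Suc j < n" using d j by auto
      then have "\<theta> (Suc j) = - pi / 2 - \<beta> (n - Suc j)" by (rule small)
      then have "\<phi> + \<beta> d < - pi / 2" using \<phi>(2) \<beta>_mono'[of d "n - Suc j"] d True by auto
      moreover have "\<phi> + \<beta> d > - (3 * pi / 2)"
        using \<phi>(1) lo \<beta>_bd(2)[of n] \<beta>_bd(1)[of d] by linarith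
      ultimately have "cos (\<phi> + \<beta> d + pi) > 0" by (intro cos_gt_zero_pi) auto
      then have "cos (\<phi> + \<beta> d) < 0" by simp
      then show ?thesis using True by (simp add: cos_rot)
    next
      case False
      then have "n - j \<le> d" by auto
      then have "- pi / 2 < \<phi> + \<beta> d" using \<phi>(1) small[OF j] \<beta>_mono'[of "n - j" d] d j
        by (simp add: Suc_le_eq)
      moreover have "\<phi> + \<beta> d < pi / 2" using \<phi>(2) up \<beta>_mono'[of d n] d by auto
      ultimately have "cos (\<phi> + \<beta> d) > 0" by (intro cos_gt_zero_pi) auto
      then show ?thesis using False by (simp add: cos_rot)
    qed
    have "(\<Sum>d=1..n. (-1) ^ (d - 1) * sgn (cos \<phi> - a d * sin \<phi>))
        = (\<Sum>d=1..n. (-1) ^ (d - 1) - 2 * (if d \<in> {1..n - Suc j} then (-1) ^ (d - 1) else 0) :: real)"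
      by (rule sum.cong[OF refl]) (use s in auto)
    also have "\<dots> = (\<Sum>d=1..n. (-1) ^ (d - 1)) - 2 * (\<Sum>d\<in>{1..n} \<inter> {1..n - Suc j}. (-1) ^ (d - 1) :: real)"
      by (simp add: sum_subtractf sum_distrib_left[symmetric] sum.inter_restrict[symmetric] del: atLeastAtMost_iff Int_atLeastAtMost)
    also have "{1..n} \<inter> {1..n - Suc j} = {1..n - Suc j}" by auto
    \<comment> \<open>Alternating partial sums are 1 or 0 by parity, and as \<open>n\<close> is odd,
      \<open>n - Suc j\<close> has the parity of \<open>j\<close>.\<close>
    also have "(\<Sum>d=1..n. (-1) ^ (d - 1)) - 2 * (\<Sum>d=1..n - Suc j. (-1) ^ (d - 1) :: real) = (-1) ^ j"
    proof -
      have "odd (n - Suc j) \<longleftrightarrow> odd j" using n j by (auto simp: even_diff_nat)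
      then show ?thesis unfolding alternating_partial_sum using n by auto
    qed
    finally show ?thesis .
  qed
  \<comment> \<open>The second half turn is the antipode of the first: all signs are reversed, and
    \<open>(-1) ^ n = -1\<close>.\<close>
  have val: "(\<Sum>d=1..n. (-1) ^ (d - 1) * sgn (cos \<phi> - a d * sin \<phi>)) = (-1) ^ j"
    if j: "j < 2 * n" and \<phi>: "\<theta> j < \<phi>" "\<phi> < \<theta> (Suc j)" for j \<phi>
  proof (cases "j < n")
    case False
    define i where "i = j - n"
    have i: "j = i + n" "i < n" using False j by (auto simp: i_def)
    have "\<theta> i < \<phi> - pi" "\<phi> - pi < \<theta> (Suc i)"
      using \<phi> per[of i] per[of "Suc i"] by (auto simp: i(1))
    from val_small[OF i(2) this]
    have "(\<Sum>d=1..n. (-1) ^ (d - 1) * sgn (cos (\<phi> - pi) - a d * sin (\<phi> - pi))) = (-1) ^ i" .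
    moreover have "sgn (cos (\<phi> - pi) - a d * sin (\<phi> - pi)) = - sgn (cos \<phi> - a d * sin \<phi>)" for d
      using sgn_minus[of "cos \<phi> - a d * sin \<phi>"] by simp
    ultimately have "- (\<Sum>d=1..n. (-1) ^ (d - 1) * sgn (cos \<phi> - a d * sin \<phi>)) = (-1) ^ i"
      by (simp add: sum_negf)
    then show ?thesis using n by (simp add: i(1) power_add)
  qed (use val_small \<phi> in auto)
  show ?thesis by (rule that[of \<theta>]) (use incr per on_line val in auto)
qed

lemma polar_representation:
  fixes x t \<theta>0 :: real
  assumes "(x, t) \<noteq> (0, 0)"
  obtains r \<phi> where "r > 0" "\<theta>0 \<le> \<phi>" "\<phi> < \<theta>0 + 2 * pi" "x = r * cos \<phi>" "t = r * sin \<phi>"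
proof -
  define z where "z = Complex x t"
  have "z \<noteq> 0" using assms by (auto simp: z_def complex_eq_iff)
  define k where "k = \<lfloor>(Arg z - \<theta>0) / (2 * pi)\<rfloor>"
  define \<phi> where "\<phi> = Arg z - 2 * pi * of_int k"
  have "of_int k \<le> (Arg z - \<theta>0) / (2 * pi)" "(Arg z - \<theta>0) / (2 * pi) < of_int k + 1"
    unfolding k_def by linarith+
  then have "\<theta>0 \<le> \<phi>" "\<phi> < \<theta>0 + 2 * pi"
    by (simp_all add: \<phi>_def field_simps)
  moreover have "cis \<phi> = cis (Arg z)"
    unfolding \<phi>_def cis_divide[symmetric] by (simp add: cis_multiple_2pi)
  then have "z = of_real (norm z) * cis \<phi>"
    using \<open>z \<noteq> 0\<close> by (simp add: cis_Arg sgn_eq)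
  then have "x = norm z * cos \<phi>" "t = norm z * sin \<phi>"
    by (simp_all add: z_def complex_eq_iff)
  moreover have "norm z > 0" using \<open>z \<noteq> 0\<close> by simp
  ultimately show ?thesis using that by blast
qed

text \<open>Off the lines every point lies in an open sector, where the field is determined by the
  parity of the index; so the two families of alternate sectors carry the field and its complement.
  On the lines some sign vanishes and the field is neither 0 nor 1.\<close>

lemma alternating_field_sectors:
  fixes a :: "nat \<Rightarrow> real"
  assumes n: "odd n" and mono: "strict_mono_on {1..n} a"
  obtains \<theta> where "\<forall>j. \<theta> j < \<theta> (Suc j)" "\<forall>j. \<theta> (j + n) = \<theta> j + pi"
    "\<forall>x t. (\<forall>d\<in>{1..n}. x - a d * t \<noteq> 0) \<longrightarrow>
      alternating_field n a x t = indicator (\<Union>i<n. sector 0 (\<theta> (2 * i)) (\<theta> (2 * i + 1))) (x, t)"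
    "\<forall>x t. (\<forall>d\<in>{1..n}. x - a d * t \<noteq> 0) \<longrightarrow>
      1 - alternating_field n a x t = indicator (\<Union>i<n. sector 0 (\<theta> (2 * i + 1)) (\<theta> (2 * i + 2))) (x, t)"
proof -
  obtain \<theta> where incr: "\<forall>j. \<theta> j < \<theta> (Suc j)" and per: "\<forall>j. \<theta> (j + n) = \<theta> j + pi"
    and on_line: "\<forall>j. \<exists>d\<in>{1..n}. cos (\<theta> j) = a d * sin (\<theta> j)"
    and val: "\<forall>j \<phi>. j < 2 * n \<and> \<theta> j < \<phi> \<and> \<phi> < \<theta> (Suc j) \<longrightarrow>
      (\<Sum>d=1..n. (-1) ^ (d - 1) * sgn (cos \<phi> - a d * sin \<phi>)) = (-1) ^ j"
    by (rule fan_angles[OF assms])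
  have n0: "n > 0" using n by (cases n) auto
  have in_sector: "alternating_field n a x t = (if even j then 1 else 0)"
    if j: "j < 2 * n" and xt: "(x, t) \<in> sector 0 (\<theta> j) (\<theta> (Suc j))" for x t j
  proof -
    obtain r \<phi> where r: "r > 0" "\<theta> j < \<phi>" "\<phi> < \<theta> (Suc j)" "x = r * cos \<phi>" "t = r * sin \<phi>"
      using xt by (auto simp: sector_def)
    have "sgn (x - a d * t) = sgn (cos \<phi> - a d * sin \<phi>)" for d
    proof -
      have "x - a d * t = r * (cos \<phi> - a d * sin \<phi>)" using r by (simp add: algebra_simps)
      then show ?thesis using r(1) by (simp add: sgn_mult)
    qed
    then show ?thesis using val[rule_format, of j \<phi>] j r(2,3) by (simp add: alternating_field_def)
  qed
  have cover: "\<exists>j<2 * n. (x, t) \<in> sector 0 (\<theta> j) (\<theta> (Suc j))"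
    if off: "\<And>d. d \<in> {1..n} \<Longrightarrow> x - a d * t \<noteq> 0" for x t
  proof -
    have "(x, t) \<noteq> (0, 0)" using off[of 1] n0 by auto
    then obtain r \<phi> where r: "r > 0" "\<theta> 0 \<le> \<phi>" "\<phi> < \<theta> 0 + 2 * pi" "x = r * cos \<phi>" "t = r * sin \<phi>"
      by (rule polar_representation)
    have "\<theta> n = \<theta> 0 + pi" "\<theta> (n + n) = \<theta> n + pi" using spec[OF per, of 0] spec[OF per, of n] by simp_all
    moreover have "2 * n = n + n" by simp
    ultimately have "\<theta> (2 * n) = \<theta> 0 + 2 * pi" by (simp only:)
    then have "\<phi> < \<theta> (2 * n)" using r(3) by simp
    have "\<exists>j<m. \<theta> j \<le> \<phi> \<and> \<phi> < \<theta> (Suc j)" if "\<phi> < \<theta> m" for m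
      using that r(2)
    proof (induction m)
      case (Suc m)
      show ?case
      proof (cases "\<phi> < \<theta> m")
        case True
        then show ?thesis using Suc less_SucI by blast
      next
        case False
        then show ?thesis using Suc by (intro exI[of _ m]) auto
      qed
    qed simp
    then obtain j where j: "j < 2 * n" "\<theta> j \<le> \<phi>" "\<phi> < \<theta> (Suc j)" using \<open>\<phi> < \<theta> (2 * n)\<close> by blast
    have "\<phi> \<noteq> \<theta> j"
    proof
      assume "\<phi> = \<theta> j"
      then obtain d where "d \<in> {1..n}" "cos \<phi> = a d * sin \<phi>" using spec[OF on_line, of j] by auto
      then show False using off[of d] r by simp
    qed
    then have "(x, t) \<in> sector 0 (\<theta> j) (\<theta> (Suc j))"
    proof -
      have "(x, t) = 0 + r *\<^sub>R (cos \<phi>, sin \<phi>)" using r by (simp add: zero_prod_def)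
      moreover have "\<theta> j < \<phi>" using j(2) \<open>\<phi> \<noteq> \<theta> j\<close> by simp
      ultimately show ?thesis unfolding sector_def using r(1) j(3) by blast
    qed
    then show ?thesis using j(1) by blast
  qed
  have "alternating_field n a x t = indicator (\<Union>i<n. sector 0 (\<theta> (2 * i)) (\<theta> (2 * i + 1))) (x, t)
      \<and> 1 - alternating_field n a x t = indicator (\<Union>i<n. sector 0 (\<theta> (2 * i + 1)) (\<theta> (2 * i + 2))) (x, t)"
    if off: "\<And>d. d \<in> {1..n} \<Longrightarrow> x - a d * t \<noteq> 0" for x t
  proof
    obtain j where j: "j < 2 * n" "(x, t) \<in> sector 0 (\<theta> j) (\<theta> (Suc j))" using cover[OF off] by blast
    have alt: "alternating_field n a x t = (if even j then 1 else 0)" by (rule in_sector[OF j])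
    show "alternating_field n a x t = indicator (\<Union>i<n. sector 0 (\<theta> (2 * i)) (\<theta> (2 * i + 1))) (x, t)"
    proof (cases "even j")
      case True
      then obtain i where "j = 2 * i" by auto
      then have "(x, t) \<in> (\<Union>i<n. sector 0 (\<theta> (2 * i)) (\<theta> (2 * i + 1)))" using j by auto
      then show ?thesis using alt True by simp
    next
      case False
      have "(x, t) \<notin> (\<Union>i<n. sector 0 (\<theta> (2 * i)) (\<theta> (2 * i + 1)))"
      proof
        assume "(x, t) \<in> (\<Union>i<n. sector 0 (\<theta> (2 * i)) (\<theta> (2 * i + 1)))"
        then obtain i where "i < n" "(x, t) \<in> sector 0 (\<theta> (2 * i)) (\<theta> (Suc (2 * i)))" by auto
        then show False using in_sector[of "2 * i" x t] alt False by simp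
      qed
      then show ?thesis using alt False by simp
    qed
    show "1 - alternating_field n a x t = indicator (\<Union>i<n. sector 0 (\<theta> (2 * i + 1)) (\<theta> (2 * i + 2))) (x, t)"
    proof (cases "odd j")
      case True
      then obtain i where "j = 2 * i + 1" by (auto elim: oddE)
      then have "(x, t) \<in> (\<Union>i<n. sector 0 (\<theta> (2 * i + 1)) (\<theta> (2 * i + 2)))" using j by auto
      then show ?thesis using alt True by simp
    next
      case False
      have "(x, t) \<notin> (\<Union>i<n. sector 0 (\<theta> (2 * i + 1)) (\<theta> (2 * i + 2)))"
      proof
        assume "(x, t) \<in> (\<Union>i<n. sector 0 (\<theta> (2 * i + 1)) (\<theta> (2 * i + 2)))"
        then obtain i where "i < n" "(x, t) \<in> sector 0 (\<theta> (2 * i + 1)) (\<theta> (Suc (2 * i + 1)))" by auto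
        then show False using in_sector[of "2 * i + 1" x t] alt False by simp
      qed
      then show ?thesis using alt False by simp
    qed
  qed
  then show ?thesis by (intro that[OF incr per]) blast+
qed

lemma sector_translate: "(x, t) \<in> sector (x0, t0) \<alpha> \<beta> \<longleftrightarrow> (x - x0, t - t0) \<in> sector 0 \<alpha> \<beta>"
proof -
  have "(x, t) = (x0, t0) + r *\<^sub>R (cos \<phi>, sin \<phi>) \<longleftrightarrow> (x - x0, t - t0) = 0 + r *\<^sub>R (cos \<phi>, sin \<phi>)" for r \<phi>
    by auto
  then show ?thesis unfolding sector_def by simp
qed

lemma AE_off_lines:
  fixes a :: "'a \<Rightarrow> real" and x0 t0 :: real
  assumes "finite D"
  shows "AE p in lborel. \<forall>d\<in>D. fst p - x0 - a d * (snd p - t0) \<noteq> 0"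
proof (rule AE_finite_allI[OF assms])
  fix d
  have "AE s in lborel. s \<noteq> x0 - a d * t0" by (rule AE_lborel_singleton)
  from AE_plane_characteristic[OF this, of "a d"]
  show "AE p in lborel. fst p - x0 - a d * (snd p - t0) \<noteq> 0"
    by (rule eventually_mono) (simp add: algebra_simps)
qed

lemma alternating_fan_field:
  fixes a :: "nat \<Rightarrow> real"
  assumes n: "odd n" and mono: "strict_mono_on {1..n} a"
  shows "fan_field n (\<lambda>x t. alternating_field n a (x - x0) (t - t0))"
    and "fan_field n (\<lambda>x t. 1 - alternating_field n a (x - x0) (t - t0))"
proof -
  obtain \<theta> where incr: "\<forall>j. \<theta> j < \<theta> (Suc j)" and per: "\<forall>j. \<theta> (j + n) = \<theta> j + pi"
    and even: "\<forall>x t. (\<forall>d\<in>{1..n}. x - a d * t \<noteq> 0) \<longrightarrow>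
      alternating_field n a x t = indicator (\<Union>i<n. sector 0 (\<theta> (2 * i)) (\<theta> (2 * i + 1))) (x, t)"
    and odd: "\<forall>x t. (\<forall>d\<in>{1..n}. x - a d * t \<noteq> 0) \<longrightarrow>
      1 - alternating_field n a x t = indicator (\<Union>i<n. sector 0 (\<theta> (2 * i + 1)) (\<theta> (2 * i + 2))) (x, t)"
    by (rule alternating_field_sectors[OF assms])
  have off: "AE p in lborel. \<forall>d\<in>{1..n}. fst p - x0 - a d * (snd p - t0) \<noteq> 0"
    by (rule AE_off_lines) simp
  define A where "A = (\<Union>i<n. sector (x0, t0) (\<theta> (2 * i)) (\<theta> (2 * i + 1)))"
  \<comment> \<open>The complement is the fan rotated by one sector, that is, with the angles
    \<open>\<lambda>j. \<theta> (Suc j)\<close>.\<close>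
  define A' where "A' = (\<Union>i<n. sector (x0, t0) (\<theta> (Suc (2 * i))) (\<theta> (Suc (2 * i + 1))))"
  have "fan n A"
    unfolding fan_def A_def using n incr per by blast
  moreover have "AE p in lborel. alternating_field n a (fst p - x0) (snd p - t0) = indicator A p"
    using off
  proof eventually_elim
    case (elim p)
    then show ?case
      using even[rule_format, of "fst p - x0" "snd p - t0"] sector_translate[of "fst p" "snd p" x0 t0]
      by (simp add: A_def indicator_def)
  qed
  ultimately show "fan_field n (\<lambda>x t. alternating_field n a (x - x0) (t - t0))"
    unfolding fan_field_def AE_lebesgue_iff by blast
  have "\<forall>j<2 * n. \<theta> (Suc j) < \<theta> (Suc (Suc j))" "\<forall>j\<le>n. \<theta> (Suc (j + n)) = \<theta> (Suc j) + pi"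
    using incr per by (auto simp flip: add_Suc)
  then have "fan n A'"
    unfolding fan_def A'_def using n by (intro conjI exI[of _ "(x0, t0)"] exI[of _ "\<lambda>j. \<theta> (Suc j)"]) auto
  moreover have "AE p in lborel. 1 - alternating_field n a (fst p - x0) (snd p - t0) = indicator A' p"
    using off
  proof eventually_elim
    case (elim p)
    then show ?case
      using odd[rule_format, of "fst p - x0" "snd p - t0"] sector_translate[of "fst p" "snd p" x0 t0]
      by (simp add: A'_def indicator_def)
  qed
  ultimately show "fan_field n (\<lambda>x t. 1 - alternating_field n a (x - x0) (t - t0))"
    unfolding fan_field_def AE_lebesgue_iff by blast
qed

lemma fan_field_two_valued:
  assumes "fan_field k F"
  shows "AE p in lborel. F (fst p) (snd p) \<in> {0, 1}"
  using assms unfolding fan_field_def AE_lebesgue_iff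
  by (auto elim!: eventually_mono simp: indicator_def)

lemma alternating_solution:
  fixes a :: "nat \<Rightarrow> real"
  assumes n: "odd n" and mono: "strict_mono_on {1..n} a"
  shows "\<exists>f. wave_solution n a f \<and> bounded_profiles n f \<and> (\<forall>d\<in>{1..n}. step_profile (f d)) \<and>
    superposition n a f = alternating_field n a"
proof (intro exI conjI ballI)
  \<comment> \<open>The additive constant 1/2 of the field is absorbed into the first
    profile.\<close>
  define f :: "nat \<Rightarrow> real \<Rightarrow> real"
    where "f d s = 1 / 2 * ((-1) ^ (d - 1) * sgn s) + (if d = 1 then 1 / 2 else 0)" for d s
  have n0: "n \<ge> 1" using n by (cases n) auto
  show sup: "superposition n a f = alternating_field n a"
  proof (intro ext)
    fix x t
    have "(\<Sum>d=1..n. if d = 1 then 1 / 2 else 0 :: real) = 1 / 2" using n0 by simp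
    then show "superposition n a f x t = alternating_field n a x t"
      by (simp add: superposition_def f_def alternating_field_def sum.distrib sum_distrib_left)
  qed
  have "\<bar>f d s\<bar> \<le> 1" for d s
  proof -
    have "\<bar>(-1) ^ (d - 1) * sgn s\<bar> \<le> 1" by (simp add: abs_mult sgn_if)
    then show ?thesis unfolding f_def by (auto simp: abs_le_iff)
  qed
  then show "bounded_profiles n f" unfolding bounded_profiles_def bounded_iff by auto
  show "step_profile (f d)" for d
    unfolding step_profile_def
  proof (intro exI[of _ "{0}"] conjI allI impI)
    fix x y :: real assume "x < y \<and> {x..y} \<inter> {0} = {}"
    then have "0 < x \<or> y < 0" by force
    then have "sgn x = sgn y" using \<open>x < y \<and> _\<close> by auto
    then show "f d x = f d y" by (simp add: f_def)
  qed simp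
  show "wave_solution n a f"
  proof (rule wave_solutionI[OF n0])
    show "inj_on a {1..n}" by (rule strict_mono_on_imp_inj_on[OF mono])
    show "f d \<in> borel_measurable borel" for d
      unfolding f_def[abs_def] by measurable
    show "AE p in lborel. superposition n a f (fst p) (snd p) \<in> {0, 1}"
      unfolding sup using fan_field_two_valued[OF alternating_fan_field(1)[OF assms, of 0 0]] by simp
    show "\<exists>p q r s. p < q \<and> r < s \<and> (\<forall>x\<in>{p..q}. \<forall>y\<in>{r..s}. f d x \<noteq> f d y)" for d
      by (rule exI[of _ "-2"], rule exI[of _ "-1"], rule exI[of _ 1], rule exI[of _ 2]) (auto simp: f_def)
  qed
qed

section \<open>The three-front step field\<close>

lemma step_field_alternating:
  assumes "x - a 1 * t \<noteq> 0" "x - a 2 * t \<noteq> 0" "x - a 3 * t \<noteq> 0"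
  shows "step_field a x t = alternating_field 3 a x t"
proof -
  have "heaviside s = 1 / 2 + 1 / 2 * sgn s" if "s \<noteq> 0" for s
    using that by (cases "s > 0") (auto simp: heaviside_simps)
  moreover have "{1..3::nat} = {1, 2, 3}" by auto
  ultimately show ?thesis
    using assms by (simp add: step_field_def alternating_field_def)
qed

lemma step_field_two_valued:
  assumes "a 1 < a 2" "a 2 < a 3"
  shows "step_field a x t \<in> {0, 1}"
proof -
  \<comment> \<open>The argument of wave 2 lies between the other two, in an order given by the sign
    of \<open>t\<close>. So its Heaviside value lies between the other two values, and subtracting
    it from their sum leaves one of them.\<close>
  have "(x - a 3 * t \<le> x - a 2 * t \<and> x - a 2 * t \<le> x - a 1 * t) \<or> (x - a 1 * t \<le> x - a 2 * t \<and> x - a 2 * t \<le> x - a 3 * t)"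
    using assms by (cases "t \<ge> 0") (auto intro: mult_right_mono mult_right_mono_neg)
  then show ?thesis by (auto simp: step_field_def heaviside_def indicator_def)
qed

lemma step_solution:
  assumes a: "a 1 < a 2" "a 2 < a 3"
    and G: "G = (\<lambda>x t. step_field a (x - x0) (t - t0)) \<or> G = (\<lambda>x t. 1 - step_field a (x - x0) (t - t0))"
  shows "\<exists>f. wave_solution 3 a f \<and> bounded_profiles 3 f \<and>
      (\<forall>d\<in>{1..3}. step_profile (f d) \<and> integer_valued (f d)) \<and> superposition 3 a f = G"
    and "\<forall>x t. G x t \<in> {0, 1}" and "fan_field 3 G"
proof -
  have set3: "{1..3::nat} = {1, 2, 3}" by auto
  show two: "\<forall>x t. G x t \<in> {0, 1}"
  proof (intro allI)
    fix x t
    show "G x t \<in> {0, 1}" using G step_field_two_valued[of a "x - x0" "t - t0", OF a] by auto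
  qed
  have mono: "strict_mono_on {1..3} a" unfolding set3 using a by (auto simp: strict_mono_on_def)
  have off: "AE p in lborel. \<forall>d\<in>{1..3}. fst p - x0 - a d * (snd p - t0) \<noteq> 0"
    by (rule AE_off_lines) simp
  have alt: "AE p in lborel. step_field a (fst p - x0) (snd p - t0) = alternating_field 3 a (fst p - x0) (snd p - t0)"
    using off by (rule eventually_mono) (simp add: step_field_alternating set3)
  have fan_cong: "fan_field 3 F" if FF: "fan_field 3 F'" "AE p in lborel. F (fst p) (snd p) = F' (fst p) (snd p)" for F F'
  proof -
    obtain A where A: "fan 3 A" "AE p in lborel. F' (fst p) (snd p) = indicator A p"
      using FF(1) unfolding fan_field_def AE_lebesgue_iff by blast
    from FF(2) A(2) have "AE p in lborel. F (fst p) (snd p) = indicator A p" by eventually_elim simp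
    with A(1) show ?thesis unfolding fan_field_def AE_lebesgue_iff by blast
  qed
  have odd3: "odd (3 :: nat)" by simp
  show "fan_field 3 G"
    using G
  proof
    assume G: "G = (\<lambda>x t. step_field a (x - x0) (t - t0))"
    show ?thesis
      by (rule fan_cong[OF alternating_fan_field(1)[OF odd3 mono, of x0 t0]]) (use alt in \<open>simp add: G\<close>)
  next
    assume G: "G = (\<lambda>x t. 1 - step_field a (x - x0) (t - t0))"
    show ?thesis
      by (rule fan_cong[OF alternating_fan_field(2)[OF odd3 mono, of x0 t0]]) (use alt in \<open>simp add: G\<close>)
  qed
  \<comment> \<open>The field and its complement are treated together as a multiple \<sigma> of the
    step field plus a constant \<kappa>; the constant goes into the first profile.\<close>
  obtain \<sigma> \<kappa> :: int where \<sigma>: "\<sigma> = 1 \<or> \<sigma> = -1" and G\<sigma>: "\<And>x t. G x t = of_int \<sigma> * step_field a (x - x0) (t - t0) + of_int \<kappa>"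
    using G
  proof
    assume "G = (\<lambda>x t. step_field a (x - x0) (t - t0))"
    then show ?thesis by (intro that[of 1 0]) auto
  next
    assume "G = (\<lambda>x t. 1 - step_field a (x - x0) (t - t0))"
    then show ?thesis by (intro that[of "-1" 1]) auto
  qed
  define c where "c d = x0 - a d * t0" for d
  define f where "f d s = of_int \<sigma> * front_profiles c d s + of_int (if d = 1 then \<kappa> else 0)" for d s
  have fr: "front_profiles c d s = 0 \<or> front_profiles c d s = 1 \<or> front_profiles c d s = -1" for d s
    by (auto simp: front_profiles_def heaviside_def indicator_def)
  have sup: "superposition 3 a f = G"
  proof (intro ext)
    fix x t
    define h where "h d = heaviside ((x - x0) - a d * (t - t0))" for d
    have "x - a d * t - c d = (x - x0) - a d * (t - t0)" for d by (simp add: c_def algebra_simps)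
    then have fd: "f d (x - a d * t) = of_int \<sigma> * (if d = 2 then - h d else h d) + of_int (if d = 1 then \<kappa> else 0)" for d
      unfolding f_def front_profiles_def h_def by (simp only:)
    have sf: "step_field a (x - x0) (t - t0) = h 1 + h 3 - h 2" by (simp add: step_field_def h_def)
    show "superposition 3 a f x t = G x t"
      unfolding superposition_def set3 G\<sigma> fd sf by (simp add: algebra_simps)
  qed
  have "bounded_profiles 3 f"
  proof -
    have "\<bar>f d s\<bar> \<le> 1 + \<bar>of_int \<kappa>\<bar>" for d s
      using fr[of d s] \<sigma> by (auto simp: f_def abs_if)
    then show ?thesis unfolding bounded_profiles_def bounded_iff by auto
  qed
  moreover have "integer_valued (f d)" for d
    unfolding integer_valued_def
  proof (intro exI[of _ 0] AE_I2)
    fix s show "f d s - 0 \<in> \<int>" using fr[of d s] by (auto simp: f_def)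
  qed
  moreover have "step_profile (f d)" for d
    unfolding step_profile_def
  proof (intro exI[of _ "{c d}"] conjI allI impI)
    fix x y :: real assume "x < y \<and> {x..y} \<inter> {c d} = {}"
    then have "c d < x \<or> y < c d" "x < y" by force+
    then have "heaviside (x - c d) = heaviside (y - c d)" by (auto simp: heaviside_def indicator_def)
    then show "f d x = f d y" unfolding f_def front_profiles_def by (simp only:)
  qed simp
  moreover have "wave_solution 3 a f"
  proof (rule wave_solutionI)
    show "inj_on a {1..3}" by (rule strict_mono_on_imp_inj_on[OF mono])
    show "f d \<in> borel_measurable borel" for d
      unfolding f_def[abs_def] front_profiles_def by measurable
    show "AE p in lborel. superposition 3 a f (fst p) (snd p) \<in> {0, 1}"
      unfolding sup using two by simp
    show "\<exists>p q r s. p < q \<and> r < s \<and> (\<forall>x\<in>{p..q}. \<forall>y\<in>{r..s}. f d x \<noteq> f d y)" for d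
      by (rule exI[of _ "c d - 2"], rule exI[of _ "c d - 1"], rule exI[of _ "c d"], rule exI[of _ "c d + 1"])
        (use \<sigma> in \<open>auto simp: f_def front_profiles_def heaviside_simps\<close>)
  qed simp
  ultimately show "\<exists>f. wave_solution 3 a f \<and> bounded_profiles 3 f \<and>
      (\<forall>d\<in>{1..3}. step_profile (f d) \<and> integer_valued (f d)) \<and> superposition 3 a f = G"
    using sup by blast
qed

section \<open>Finitely many fronts\<close>

definition fdiff :: "real \<Rightarrow> (real \<Rightarrow> real) \<Rightarrow> real \<Rightarrow> real" where
  "fdiff h g s = g (s + h) - g s"

text \<open>If the second difference vanishes, \<open>g\<close> is linear along the progression
  \<open>s + k * h\<close>, and boundedness forces slope 0. Induction lowers the order of the
  vanishing difference.\<close>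

lemma fdiff_pow_zero_imp_fdiff_zero:
  assumes "\<And>s. \<bar>g s\<bar> \<le> B" "h > 0" "\<And>s. s \<ge> S \<Longrightarrow> (fdiff h ^^ Suc m) g s = 0" "s \<ge> S"
  shows "fdiff h g s = 0"
  using assms
proof (induction m arbitrary: g B s)
  case (Suc m)
  have "\<bar>fdiff h g s\<bar> \<le> 2 * B" for s
    using Suc.prems(1)[of s] Suc.prems(1)[of "s + h"] by (simp add: fdiff_def)
  moreover have "(fdiff h ^^ Suc m) (fdiff h g) s = 0" if "s \<ge> S" for s
    using Suc.prems(3)[OF that] by (simp add: funpow_swap1)
  ultimately have z: "fdiff h (fdiff h g) s = 0" if "s \<ge> S" for s
    using Suc.IH[of "fdiff h g" "2 * B" s] Suc.prems(2) that by blast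
  define c where "c = fdiff h g s"
  have pt: "s + of_nat k * h \<ge> S" for k
    using Suc.prems(2,4) by (simp add: add_increasing2)
  have c: "fdiff h g (s + of_nat k * h) = c" for k
  proof (induction k)
    case 0
    show ?case by (simp add: c_def)
  next
    case (Suc k)
    have e: "s + of_nat (Suc k) * h = s + of_nat k * h + h" by (simp add: algebra_simps)
    show ?case using z[OF pt[of k]] Suc unfolding e by (simp add: fdiff_def[of h "fdiff h g"])
  qed
  have lin: "g (s + of_nat k * h) = g s + of_nat k * c" for k
  proof (induction k)
    case (Suc k)
    have e: "s + of_nat (Suc k) * h = s + of_nat k * h + h" by (simp add: algebra_simps)
    show ?case using c[of k] Suc unfolding e by (simp add: fdiff_def algebra_simps)
  qed simp
  show "fdiff h g s = 0"
  proof (rule ccontr)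
    assume "fdiff h g s \<noteq> 0"
    then have "\<bar>c\<bar> > 0" by (simp add: c_def)
    then obtain k :: nat where k: "of_nat k * \<bar>c\<bar> > 2 * B"
      using reals_Archimedean3 by blast
    have "of_nat k * \<bar>c\<bar> = \<bar>g (s + of_nat k * h) - g s\<bar>" by (simp add: lin abs_mult)
    also have "\<dots> \<le> 2 * B" using Suc.prems(1)[of s] Suc.prems(1)[of "s + of_nat k * h"] by linarith
    finally show False using k by simp
  qed
qed simp

text \<open>A translation along the characteristics of \<open>e\<close>, subtracted from the
  original, cancels that wave and turns the others into differences; its duration is chosen so that
  wave \<open>d\<close> is differenced by exactly \<open>h\<close>. One wave is removed per step of
  the induction.\<close>

lemma wave_sum_const_imp_fdiff:
  fixes a :: "'i \<Rightarrow> real" and \<phi> :: "'i \<Rightarrow> real \<Rightarrow> real"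
  assumes "finite A" "d \<notin> A" "\<And>e. e \<in> A \<Longrightarrow> a e \<noteq> a d" "h > 0" "L \<ge> 0"
    and "\<And>x t. x \<ge> X + L * \<bar>t\<bar> \<Longrightarrow> (\<Sum>e\<in>insert d A. \<phi> e (x - a e * t)) = C"
  shows "\<exists>S. \<forall>s\<ge>S. (fdiff h ^^ Suc (card A)) (\<phi> d) s = 0"
  using assms
proof (induction A arbitrary: X \<phi> C rule: finite_induct)
  case empty
  have "\<phi> d s = C" if "s \<ge> X" for s
    using empty.prems(5)[of 0 s] that by simp
  then show ?case using empty.prems(3) by (auto simp: fdiff_def intro!: exI[of _ X])
next
  case (insert e A)
  define \<tau> where "\<tau> = h / (a e - a d)"
  have \<tau>: "(a e - a d) * \<tau> = h" using insert.prems(2)[of e] by (simp add: \<tau>_def)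
  define \<phi>' where "\<phi>' k s = \<phi> k (s + (a e - a k) * \<tau>) - \<phi> k s" for k s
  \<comment> \<open>Large enough that a point of the smaller cone and its translate both lie in the
    original one.\<close>
  define X' where "X' = X + \<bar>a e * \<tau>\<bar> + L * \<bar>\<tau>\<bar>"
  have "(\<Sum>k\<in>insert d A. \<phi>' k (x - a k * t)) = 0" if xt: "x \<ge> X' + L * \<bar>t\<bar>" for x t
  proof -
    have "L * \<bar>t + \<tau>\<bar> \<le> L * (\<bar>t\<bar> + \<bar>\<tau>\<bar>)" using insert.prems(4) by (intro mult_left_mono) auto
    then have "x + a e * \<tau> \<ge> X + L * \<bar>t + \<tau>\<bar>"
      using xt unfolding X'_def distrib_left by linarith
    then have 1: "(\<Sum>k\<in>insert d (insert e A). \<phi> k (x + a e * \<tau> - a k * (t + \<tau>))) = C"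
      by (rule insert.prems(5))
    have "L * \<bar>\<tau>\<bar> \<ge> 0" using insert.prems(4) by simp
    then have "x \<ge> X + L * \<bar>t\<bar>" using xt unfolding X'_def by linarith
    then have 2: "(\<Sum>k\<in>insert d (insert e A). \<phi> k (x - a k * t)) = C"
      by (rule insert.prems(5))
    have e: "x + a e * \<tau> - a k * (t + \<tau>) = x - a k * t + (a e - a k) * \<tau>" for k
      by (simp add: algebra_simps)
    have "(\<Sum>k\<in>insert d (insert e A). \<phi>' k (x - a k * t)) = 0"
      using 1 2 unfolding e by (simp add: \<phi>'_def sum_subtractf del: sum.insert)
    moreover have "insert d (insert e A) = insert e (insert d A)" by auto
    moreover have "e \<notin> insert d A" using insert.hyps insert.prems(1) by auto
    moreover have "\<phi>' e s = 0" for s by (simp add: \<phi>'_def)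
    ultimately show ?thesis using insert.hyps(1) by simp
  qed
  then have "\<exists>S. \<forall>s\<ge>S. (fdiff h ^^ Suc (card A)) (\<phi>' d) s = 0"
    using insert.prems by (intro insert.IH[of X' \<phi>' 0]) auto
  moreover have "\<phi>' d = fdiff h (\<phi> d)" by (simp add: \<phi>'_def fdiff_def fun_eq_iff \<tau>)
  ultimately show ?case
    using insert.hyps by (simp add: funpow_swap1)
qed

text \<open>By boundedness, a vanishing high difference means a vanishing first one:
  \<open>\<phi> d\<close> is eventually \<open>h\<close>-periodic for every \<open>h\<close>, with a
  threshold that depends on \<open>h\<close>. Period 1 removes this dependence: move both points far
  to the right by an integer, compare there, and move back.\<close>

lemma wave_eventually_const:
  fixes a :: "'i \<Rightarrow> real" and \<phi> :: "'i \<Rightarrow> real \<Rightarrow> real"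
  assumes "finite I" "d \<in> I" and inj: "inj_on a I" and B: "\<And>s. \<bar>\<phi> d s\<bar> \<le> B" and "L \<ge> 0"
    and const: "\<And>x t. x \<ge> X + L * \<bar>t\<bar> \<Longrightarrow> (\<Sum>e\<in>I. \<phi> e (x - a e * t)) = C"
  shows "\<exists>S A. \<forall>s\<ge>S. \<phi> d s = A"
proof -
  have per: "\<exists>S. \<forall>s\<ge>S. \<phi> d (s + h) = \<phi> d s" if "h > 0" for h
  proof -
    have I: "insert d (I - {d}) = I" using assms(2) by auto
    have ex: "\<exists>S. \<forall>s\<ge>S. (fdiff h ^^ Suc (card (I - {d}))) (\<phi> d) s = 0"
    proof (rule wave_sum_const_imp_fdiff[of _ _ a _ L X _ C])
      show "a e \<noteq> a d" if "e \<in> I - {d}" for e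
        using that inj assms(2) by (auto dest: inj_onD)
    qed (use assms(1) \<open>h > 0\<close> \<open>L \<ge> 0\<close> const assms(2) in \<open>simp_all add: I insert_absorb\<close>)
    then obtain S where S: "\<And>s. s \<ge> S \<Longrightarrow> (fdiff h ^^ Suc (card (I - {d}))) (\<phi> d) s = 0" by blast
    have "fdiff h (\<phi> d) s = 0" if "s \<ge> S" for s
      by (rule fdiff_pow_zero_imp_fdiff_zero[OF B \<open>h > 0\<close> S that])
    then show ?thesis by (auto simp: fdiff_def)
  qed
  obtain S where S: "\<And>s. s \<ge> S \<Longrightarrow> \<phi> d (s + 1) = \<phi> d s" using per[of 1] by auto
  have Sk: "\<phi> d (s + of_nat k) = \<phi> d s" if "s \<ge> S" for s k
  proof (induction k)
    case (Suc k)
    then show ?case using S[of "s + of_nat k"] that by (simp add: add_ac)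
  qed simp
  have "\<phi> d s = \<phi> d S" if s: "s > S" for s
  proof -
    obtain S' where S': "\<And>r. r \<ge> S' \<Longrightarrow> \<phi> d (r + (s - S)) = \<phi> d r" using per[of "s - S"] s by auto
    obtain k :: nat where k: "of_nat k \<ge> S' - S" using real_arch_simple by blast
    have "\<phi> d s = \<phi> d (s + of_nat k)" using Sk[of s k] s by simp
    also have "\<dots> = \<phi> d (S + of_nat k + (s - S))" by (simp add: algebra_simps)
    also have "\<dots> = \<phi> d (S + of_nat k)" using k by (intro S') simp
    also have "\<dots> = \<phi> d S" using Sk[of S k] by simp
    finally show ?thesis .
  qed
  then have "\<forall>s\<ge>S. \<phi> d s = \<phi> d S" by (auto simp: le_less)
  then show ?thesis by blast
qed

section \<open>Two-valued fields at points of continuity\<close>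

lemma AE_open_ex:
  fixes U :: "(real \<times> real) set"
  assumes "AE p in lebesgue. P p" "open U" "U \<noteq> {}"
  shows "\<exists>p\<in>U. P p"
proof (rule ccontr)
  assume "\<not> ?thesis"
  then have "U \<subseteq> {p. \<not> P p}" by auto
  moreover obtain N where "negligible N" "{p. \<not> P p} \<subseteq> N"
    using assms(1) unfolding eventually_ae_filter_negligible by blast
  ultimately have "negligible U" by (meson negligible_subset order_trans)
  then show False using open_not_negligible assms(2,3) by blast
qed

text \<open>An exception at a point of continuity would spread to an open set, which is not null.
  Off the fronts, "almost everywhere" thus becomes "everywhere".\<close>

lemma closed_value_at_continuity:
  fixes F :: "real \<times> real \<Rightarrow> real"
  assumes "AE p in lebesgue. F p \<in> K" "closed K" "isCont F p"
  shows "F p \<in> K"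
proof (rule ccontr)
  assume "F p \<notin> K"
  then obtain U where U: "open U" "p \<in> U" "\<forall>q\<in>U. F q \<in> - K"
    using assms(2,3) unfolding continuous_at_open by (metis ComplI open_Compl)
  then obtain q where "q \<in> U" "F q \<in> K" using AE_open_ex[OF assms(1) U(1)] by blast
  with U(3) show False by auto
qed

lemma isCont_wave:
  fixes g :: "real \<Rightarrow> real" and p :: "real \<times> real"
  assumes "isCont g (fst p - c * snd p)"
  shows "isCont (\<lambda>p. g (fst p - c * snd p)) p"
proof -
  have "isCont (\<lambda>p :: real \<times> real. fst p - c * snd p) p" by (intro continuous_intros)
  then show ?thesis using isCont_o2[where g = g] assms by blast
qed

lemma isCont_wave_sum:
  fixes f :: "'i \<Rightarrow> real \<Rightarrow> real" and p :: "real \<times> real"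
  assumes "\<And>d. d \<in> I \<Longrightarrow> isCont (f d) (fst p - a d * snd p)"
  shows "isCont (\<lambda>p. \<Sum>d\<in>I. f d (fst p - a d * snd p)) p"
  unfolding isCont_def
  by (intro tendsto_sum isContD isCont_wave assms)

text \<open>In a cone opening to the right, wide enough for all speeds, no profile has a
  discontinuity. There the field is continuous and two-valued, hence constant by connectedness, and
  constancy of the sum passes to the ends of the summands.\<close>

lemma two_valued_wave_sum_eventually_const:
  fixes a :: "'i \<Rightarrow> real" and f :: "'i \<Rightarrow> real \<Rightarrow> real"
  assumes I: "finite I" and inj: "inj_on a I" and B: "\<And>d s. d \<in> I \<Longrightarrow> \<bar>f d s\<bar> \<le> B"
    and cont: "\<And>d s. d \<in> I \<Longrightarrow> s > R \<Longrightarrow> isCont (f d) s"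
    and two: "\<And>x t. (\<forall>d\<in>I. isCont (f d) (x - a d * t)) \<Longrightarrow> (\<Sum>d\<in>I. f d (x - a d * t)) \<in> {0, 1}"
  shows "\<exists>S A. \<forall>d\<in>I. \<forall>s\<ge>S. f d s = A d"
proof -
  define L where "L = (\<Sum>d\<in>I. \<bar>a d\<bar>)"
  have L: "\<bar>a d\<bar> \<le> L" if "d \<in> I" for d
    unfolding L_def using I that by (intro member_le_sum) auto
  have L0: "L \<ge> 0" unfolding L_def by (intro sum_nonneg) auto
  \<comment> \<open>The slope \<open>L\<close> dominates all speeds, so on \<open>Q\<close> every
    argument \<open>x - a d * t\<close> exceeds \<open>R\<close>.\<close>
  define Q where "Q = {p :: real \<times> real. fst p \<ge> R + 1 + L * \<bar>snd p\<bar>}"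
  define F where "F p = (\<Sum>d\<in>I. f d (fst p - a d * snd p))" for p
  have far: "fst p - a d * snd p > R" if "p \<in> Q" "d \<in> I" for p d
  proof -
    have "\<bar>a d * snd p\<bar> \<le> L * \<bar>snd p\<bar>" unfolding abs_mult using L[OF that(2)] by (intro mult_right_mono) auto
    then show ?thesis using that(1) unfolding Q_def by auto
  qed
  have contF: "isCont F p" if "p \<in> Q" for p
    unfolding F_def
    by (intro isCont_wave_sum cont far that)
  have F01: "F p \<in> {0, 1}" if "p \<in> Q" for p
    unfolding F_def using two[of "fst p" "snd p"] cont far[OF that] by auto
  have "convex Q"
  proof (rule convexI)
    fix p q :: "real \<times> real" and u v :: real
    assume pq: "p \<in> Q" "q \<in> Q" and uv: "0 \<le> u" "0 \<le> v" "u + v = 1"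
    have "\<bar>u * snd p + v * snd q\<bar> \<le> u * \<bar>snd p\<bar> + v * \<bar>snd q\<bar>"
      using uv abs_triangle_ineq[of "u * snd p" "v * snd q"] by (simp add: abs_mult)
    then have "L * \<bar>u * snd p + v * snd q\<bar> \<le> L * (u * \<bar>snd p\<bar> + v * \<bar>snd q\<bar>)"
      using L0 by (rule mult_left_mono)
    moreover have "u * (R + 1 + L * \<bar>snd p\<bar>) + v * (R + 1 + L * \<bar>snd q\<bar>) \<le> u * fst p + v * fst q"
      using pq uv by (intro add_mono mult_left_mono) (auto simp: Q_def)
    moreover have "u * (R + 1 + L * \<bar>snd p\<bar>) + v * (R + 1 + L * \<bar>snd q\<bar>)
        = (u + v) * (R + 1) + L * (u * \<bar>snd p\<bar> + v * \<bar>snd q\<bar>)" by (simp add: algebra_simps)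
    ultimately show "u *\<^sub>R p + v *\<^sub>R q \<in> Q" using uv by (simp add: Q_def)
  qed
  then have "F constant_on Q"
  proof (intro continuous_finite_range_constant convex_connected)
    show "continuous_on Q F" using contF by (intro continuous_at_imp_continuous_on) auto
    have "F ` Q \<subseteq> {0, 1}" using F01 by auto
    then show "finite (F ` Q)" by (rule finite_subset) simp
  qed
  then obtain C where C: "\<And>p. p \<in> Q \<Longrightarrow> F p = C" by (auto simp: constant_on_def)
  have "\<exists>S A. \<forall>s\<ge>S. f d s = A" if d: "d \<in> I" for d
  proof (rule wave_eventually_const[where \<phi> = f and d = d and B = B, OF I d inj B[OF d] L0])
    fix x t assume "R + 1 + L * \<bar>t\<bar> \<le> x"
    then show "(\<Sum>e\<in>I. f e (x - a e * t)) = C"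
      using C[of "(x, t)"] by (simp add: Q_def F_def)
  qed
  then obtain S A where SA: "\<And>d s. d \<in> I \<Longrightarrow> s \<ge> S d \<Longrightarrow> f d s = A d" by metis
  show ?thesis
  proof (intro exI[of _ "\<Sum>d\<in>I. \<bar>S d\<bar>"] exI[of _ A] ballI allI impI)
    fix d s assume d: "d \<in> I" and s: "(\<Sum>d\<in>I. \<bar>S d\<bar>) \<le> s"
    have "\<bar>S d\<bar> \<le> (\<Sum>d\<in>I. \<bar>S d\<bar>)" using I d by (intro member_le_sum) auto
    then show "f d s = A d" using s by (intro SA[OF d]) linarith
  qed
qed

text \<open>By the balance, the total \<open>T\<close> differs from each \<open>J d\<close> by an
  even number, so all jumps have the parity of \<open>T\<close>. Were it odd, an even number of odd
  jumps would have an even sum. So every jump is even, and the bound leaves only 0.\<close>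

lemma balanced_jumps_zero:
  fixes J :: "'i \<Rightarrow> int" and a :: "'i \<Rightarrow> real"
  assumes I: "finite I" "even (card I)" and inj: "inj_on a I"
    and J: "\<And>d. d \<in> I \<Longrightarrow> \<bar>J d\<bar> \<le> 1"
    and bal: "\<And>d. d \<in> I \<Longrightarrow> (\<Sum>e\<in>{e \<in> I. a e < a d}. J e) = (\<Sum>e\<in>{e \<in> I. a e > a d}. J e)"
    and "d \<in> I"
  shows "J d = 0"
proof -
  define T where "T = (\<Sum>e\<in>I. J e)"
  have T: "T = 2 * (\<Sum>e\<in>{e \<in> I. a e < a d}. J e) + J d" if d: "d \<in> I" for d
  proof -
    have "I = {e \<in> I. a e < a d} \<union> ({e \<in> I. a e > a d} \<union> {d})"
      using inj_onD[OF inj _ _ d] d by (auto simp: not_less le_less)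
    then have "T = sum J ({e \<in> I. a e < a d} \<union> ({e \<in> I. a e > a d} \<union> {d}))"
      unfolding T_def by simp
    also have "\<dots> = (\<Sum>e\<in>{e \<in> I. a e < a d}. J e) + ((\<Sum>e\<in>{e \<in> I. a e > a d}. J e) + J d)"
      using I(1) by (subst sum.union_disjoint; force?)+
    finally show ?thesis using bal[OF d] by simp
  qed
  have "even T"
  proof (rule ccontr)
    assume "odd T"
    then have "odd (J e)" if "e \<in> I" for e using T[OF that] by simp
    then have "even (\<Sum>e\<in>I. J e + 1)" by (intro dvd_sum) simp
    then have "even (T + int (card I))" by (simp add: T_def sum.distrib)
    then show False using \<open>odd T\<close> I(2) by simp
  qed
  then have "even (J d)" using T[OF assms(6)] by simp
  then show ?thesis using J[OF assms(6)] by (auto elim!: evenE)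
qed

lemma no_even_front_solution:
  assumes n: "even n" and sol: "wave_solution n a f" and bd: "bounded_profiles n f"
    and fronts: "\<forall>d\<in>{1..n}. finitely_many_fronts (f d)"
  shows False
proof -
  define I where "I = {1..n}"
  have I: "finite I" "card I = n" by (simp_all add: I_def)
  have inj: "inj_on a I" using sol by (simp add: wave_solution_def I_def)
  have n2: "n \<ge> 2" using n sol by (auto simp: wave_solution_def elim!: evenE)
  have "bounded (\<Union>d\<in>I. range (f d))"
    using bd I by (intro bounded_UN) (auto simp: bounded_profiles_def I_def)
  then obtain B where "\<forall>y\<in>(\<Union>d\<in>I. range (f d)). norm y \<le> B"
    unfolding bounded_iff by blast
  then have B: "\<bar>f d s\<bar> \<le> B" if "d \<in> I" for d s
    using that unfolding real_norm_def[symmetric] by blast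
  define disc where "disc d = {s. \<not> isCont (f d) s}" for d
  have disc: "finite (disc d)" if "d \<in> I" for d
    using fronts that by (simp add: disc_def I_def finitely_many_fronts_def)
  have "bounded (\<Union>d\<in>I. disc d)"
    using I disc by (intro bounded_UN) (auto intro: finite_imp_bounded)
  then obtain R where "\<forall>y\<in>(\<Union>d\<in>I. disc d). norm y \<le> R"
    unfolding bounded_iff by blast
  then have R: "isCont (f d) s" if "d \<in> I" "\<bar>s\<bar> > R" for d s
    using that unfolding disc_def real_norm_def[symmetric] by fastforce
  have two: "(\<Sum>d\<in>I. f d (x - a d * t)) \<in> {0, 1}" if c: "\<forall>d\<in>I. isCont (f d) (x - a d * t)" for x t
  proof -
    define F where "F p = (\<Sum>d\<in>I. f d (fst p - a d * snd p))" for p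
    have "AE p in lebesgue. F p \<in> {0, 1}"
      using sol by (simp add: wave_solution_def superposition_def F_def I_def)
    moreover have "isCont F (x, t)"
      unfolding F_def
      by (intro isCont_wave_sum) (use c in simp)
    ultimately have "F (x, t) \<in> {0, 1}"
      by (intro closed_value_at_continuity) auto
    then show ?thesis by (simp add: F_def)
  qed
  have "\<exists>S A. \<forall>d\<in>I. \<forall>s\<ge>S. f d s = A d"
    by (rule two_valued_wave_sum_eventually_const[where f = f and R = R and B = B, OF I(1) inj B _ two]) (use R in auto)
  then obtain S1 A where A: "\<And>d s. d \<in> I \<Longrightarrow> s \<ge> S1 \<Longrightarrow> f d s = A d" by blast
  \<comment> \<open>The reflection \<open>(x, t) \<mapsto> (- x, - t)\<close> preserves the kind of
    field, so the result for the right ends of the profiles also gives the left ends.\<close>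
  have reflD: "isCont (\<lambda>s. g (- s)) s" if "isCont g (- s)" for g :: "real \<Rightarrow> real" and s :: real
    using that by (intro isCont_o2[where f = uminus and g = g]) simp_all
  have refl_cont: "isCont (\<lambda>s. f d (- s)) s \<longleftrightarrow> isCont (f d) (- s)" for d and s :: real
    using reflD[where g = "f d" and s = s] reflD[where g = "\<lambda>s. f d (- s)" and s = "- s"] by auto
  have "\<exists>S A. \<forall>d\<in>I. \<forall>s\<ge>S. f d (- s) = A d"
  proof (rule two_valued_wave_sum_eventually_const[where f = "\<lambda>d s. f d (- s)" and R = R and B = B, OF I(1) inj])
    fix x t assume "\<forall>d\<in>I. isCont (\<lambda>s. f d (- s)) (x - a d * t)"
    then show "(\<Sum>d\<in>I. f d (- (x - a d * t))) \<in> {0, 1}"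
      using two[of "- x" "- t"] by (simp add: refl_cont)
  qed (use R B refl_cont in auto)
  then obtain S2 Bm where Bm: "\<And>d s. d \<in> I \<Longrightarrow> s \<ge> S2 \<Longrightarrow> f d (- s) = Bm d" by blast
  define S where "S = \<bar>S1\<bar> + \<bar>S2\<bar> + \<bar>R\<bar> + 1"
  have fA: "f d s = A d" "isCont (f d) s" if "d \<in> I" "s \<ge> S" for d s
    using that A[of d s] R[of d s] by (auto simp: S_def)
  have fB: "f d s = Bm d" "isCont (f d) s" if "d \<in> I" "s \<le> - S" for d s
    using that Bm[of d "- s"] R[of d s] by (auto simp: S_def)
  \<comment> \<open>Following a characteristic of \<open>d\<close> for long positive time, slower
    waves are seen at their right ends and faster ones at their left ends; for negative time the
    roles are exchanged. \<open>Cp d\<close> and \<open>Cm d\<close> are the resulting sums of the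
    other waves.\<close>
  define Cp where "Cp d = (\<Sum>e\<in>I - {d}. if a e < a d then A e else Bm e)" for d
  define Cm where "Cm d = (\<Sum>e\<in>I - {d}. if a e < a d then Bm e else A e)" for d
  have strip: "f d s + Cp d \<in> {0, 1}" "f d s + Cm d \<in> {0, 1}" if d: "d \<in> I" and s: "isCont (f d) s" for d s
  proof -
    \<comment> \<open>\<open>m\<close> bounds the inverse speed differences, so after time \<tau>
      every other argument has moved by at least \<open>S + |s|\<close>, beyond all fronts.\<close>
    define m where "m = (\<Sum>e\<in>I. 1 / \<bar>a d - a e\<bar>)"
    have m0: "m \<ge> 0" unfolding m_def by (intro sum_nonneg) auto
    define \<tau> where "\<tau> = (S + \<bar>s\<bar>) * m"
    have big: "(a d - a e) * \<tau> \<ge> S + \<bar>s\<bar>" if e: "e \<in> I" "a e < a d" for e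
    proof -
      have "1 / \<bar>a d - a e\<bar> \<le> m" unfolding m_def using I e by (intro member_le_sum) auto
      then have "1 \<le> (a d - a e) * m" using e by (simp add: field_simps)
      then have "(S + \<bar>s\<bar>) * 1 \<le> (S + \<bar>s\<bar>) * ((a d - a e) * m)"
        by (intro mult_left_mono) (auto simp: S_def)
      then show ?thesis by (simp add: \<tau>_def mult_ac)
    qed
    have small: "(a d - a e) * \<tau> \<le> - (S + \<bar>s\<bar>)" if e: "e \<in> I" "a e > a d" for e
    proof -
      have "1 / \<bar>a d - a e\<bar> \<le> m" unfolding m_def using I e by (intro member_le_sum) auto
      then have "1 \<le> (a e - a d) * m" using e by (simp add: field_simps)
      then have "(S + \<bar>s\<bar>) * 1 \<le> (S + \<bar>s\<bar>) * ((a e - a d) * m)"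
        by (intro mult_left_mono) (auto simp: S_def)
      then show ?thesis by (simp add: \<tau>_def algebra_simps)
    qed
    have ne: "a e \<noteq> a d" if "e \<in> I - {d}" for e using that inj d by (auto dest: inj_onD)
    have line: "s + a d * t - a e * t = s + (a d - a e) * t" for e t by (simp add: algebra_simps)
    have sumd: "(\<Sum>e\<in>I. f e (s + a d * t - a e * t)) = f d s + (\<Sum>e\<in>I - {d}. f e (s + (a d - a e) * t))" for t
      using I d by (subst sum.remove[of I d]) (auto simp: line)
    have vp: "f e (s + (a d - a e) * \<tau>) = (if a e < a d then A e else Bm e)"
        "isCont (f e) (s + (a d - a e) * \<tau>)" if e: "e \<in> I - {d}" for e
    proof -
      show "f e (s + (a d - a e) * \<tau>) = (if a e < a d then A e else Bm e)"
        using fA(1)[of e] fB(1)[of e] big[of e] small[of e] ne[OF e] e by (auto simp: not_less)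
      show "isCont (f e) (s + (a d - a e) * \<tau>)"
        using fA(2)[of e] fB(2)[of e] big[of e] small[of e] ne[OF e] e by (cases "a e < a d") auto
    qed
    have vm: "f e (s + (a d - a e) * (- \<tau>)) = (if a e < a d then Bm e else A e)"
        "isCont (f e) (s + (a d - a e) * (- \<tau>))" if e: "e \<in> I - {d}" for e
    proof -
      show "f e (s + (a d - a e) * (- \<tau>)) = (if a e < a d then Bm e else A e)"
        using fA(1)[of e] fB(1)[of e] big[of e] small[of e] ne[OF e] e by (auto simp: not_less)
      show "isCont (f e) (s + (a d - a e) * (- \<tau>))"
        using fA(2)[of e] fB(2)[of e] big[of e] small[of e] ne[OF e] e by (cases "a e < a d") auto
    qed
    have "(\<Sum>e\<in>I. f e (s + a d * \<tau> - a e * \<tau>)) \<in> {0, 1}"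
    proof (rule two)
      show "\<forall>e\<in>I. isCont (f e) (s + a d * \<tau> - a e * \<tau>)"
        unfolding line using vp(2) s by (metis DiffI add.right_neutral cancel_comm_monoid_add_class.diff_cancel mult_zero_left singletonD)
    qed
    then show "f d s + Cp d \<in> {0, 1}" unfolding sumd Cp_def using vp(1) by simp
    have "(\<Sum>e\<in>I. f e (s + a d * (- \<tau>) - a e * (- \<tau>))) \<in> {0, 1}"
    proof (rule two)
      show "\<forall>e\<in>I. isCont (f e) (s + a d * (- \<tau>) - a e * (- \<tau>))"
        unfolding line using vm(2) s by (metis DiffI add.right_neutral cancel_comm_monoid_add_class.diff_cancel mult_zero_left singletonD)
    qed
    then show "f d s + Cm d \<in> {0, 1}" unfolding sumd Cm_def using vm(1) by simp
  qed
  have two_vals: "\<exists>s r. isCont (f d) s \<and> isCont (f d) r \<and> f d s \<noteq> f d r" if d: "d \<in> I" for d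
  proof (rule ccontr)
    assume *: "\<not> ?thesis"
    have "AE s in lborel. s \<notin> disc d"
      by (intro AE_not_in finite_imp_null_set_lborel disc d)
    moreover have "f d s = A d" if "s \<notin> disc d" for s
    proof -
      have "isCont (f d) s" using that by (simp add: disc_def)
      then have "f d s = f d S" using * fA(2)[OF d order_refl] by blast
      then show ?thesis using fA(1)[OF d order_refl] by simp
    qed
    ultimately have "AE s in lborel. f d s = A d" by (rule eventually_mono)
    then have "\<exists>c. AE s in lebesgue. f d s = c" unfolding AE_lebesgue_iff by (rule exI)
    moreover have "\<not> (\<exists>c. AE s in lebesgue. f d s = c)"
    proof -
      have "\<forall>d\<in>{1..n}. f d \<in> borel_measurable lebesgue \<and> \<not> (\<exists>c. AE s in lebesgue. f d s = c)"
        using sol unfolding wave_solution_def by (elim conjE)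
      from bspec[OF this d[unfolded I_def]] show ?thesis by (rule conjunct2)
    qed
    ultimately show False by contradiction
  qed
  \<comment> \<open>Two different values of \<open>f d\<close> become 0 and 1 after adding either
    sum, which determines that sum uniquely.\<close>
  have Ceq: "Cp d = Cm d" if d: "d \<in> I" for d
  proof -
    obtain s r where sr: "isCont (f d) s" "isCont (f d) r" "f d s \<noteq> f d r" using two_vals[OF d] by blast
    show ?thesis using strip[OF d sr(1)] strip[OF d sr(2)] sr(3) by auto
  qed
  define J where "J d = \<lfloor>A d - Bm d\<rfloor>" for d
  have J: "of_int (J d) = A d - Bm d" "\<bar>J d\<bar> \<le> 1" if d: "d \<in> I" for d
  proof -
    have "A d + Cp d \<in> {0, 1}" "Bm d + Cp d \<in> {0, 1}"
      using strip(1)[OF d, of S] strip(1)[OF d, of "- S"] fA[OF d, of S] fB[OF d, of "- S"] by auto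
    then have "A d - Bm d = of_int 0 \<or> A d - Bm d = of_int 1 \<or> A d - Bm d = of_int (- 1)" by auto
    then have "\<exists>j::int. \<bar>j\<bar> \<le> 1 \<and> A d - Bm d = of_int j"
    proof (elim disjE)
      assume "A d - Bm d = of_int (- 1)"
      then show ?thesis by (intro exI[of _ "- 1"]) simp
    next
      assume "A d - Bm d = of_int 0"
      then show ?thesis by (intro exI[of _ 0]) simp
    next
      assume "A d - Bm d = of_int 1"
      then show ?thesis by (intro exI[of _ 1]) simp
    qed
    then obtain j :: int where j: "\<bar>j\<bar> \<le> 1" "A d - Bm d = of_int j" by blast
    show "of_int (J d) = A d - Bm d" "\<bar>J d\<bar> \<le> 1" unfolding J_def j(2) floor_of_int by (simp_all add: j(1))
  qed
  \<comment> \<open>\<open>Cp d = Cm d\<close> says that the jumps of the slower waves and those of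
    the faster waves have the same total.\<close>
  have J0: "J d = 0" if "d \<in> I" for d
  proof (rule balanced_jumps_zero[OF I(1) _ inj J(2) _ that])
    show "even (card I)" using n I by simp
    fix d assume d: "d \<in> I"
    have "(\<Sum>e\<in>I - {d}. if a e < a d then A e else Bm e) - (\<Sum>e\<in>I - {d}. if a e < a d then Bm e else A e)
      = (\<Sum>e\<in>I - {d}. if a e < a d then of_int (J e) else - of_int (J e))"
      unfolding sum_subtractf[symmetric] by (rule sum.cong) (auto simp: J(1))
    also have "\<dots> = (\<Sum>e\<in>(I - {d}) \<inter> {e. a e < a d}. of_int (J e)) + (\<Sum>e\<in>(I - {d}) \<inter> - {e. a e < a d}. - of_int (J e))"
      using I(1) by (subst sum.If_cases) auto
    also have "(I - {d}) \<inter> {e. a e < a d} = {e \<in> I. a e < a d}" by auto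
    also have "(I - {d}) \<inter> - {e. a e < a d} = {e \<in> I. a e > a d}"
      using inj d by (auto simp: not_less le_less dest: inj_onD)
    finally have "of_int (\<Sum>e\<in>{e \<in> I. a e < a d}. J e) - of_int (\<Sum>e\<in>{e \<in> I. a e > a d}. J e) = Cp d - Cm d"
      unfolding Cp_def Cm_def by (simp add: sum_negf)
    then show "(\<Sum>e\<in>{e \<in> I. a e < a d}. J e) = (\<Sum>e\<in>{e \<in> I. a e > a d}. J e)"
      unfolding Ceq[OF d] by linarith
  qed
  have AB: "Bm d = A d" if "d \<in> I" for d using J(1)[OF that] J0[OF that] by simp
  define c0 where "c0 = (\<Sum>d\<in>I. A d)"
  have Cp: "Cp d = c0 - A d" if d: "d \<in> I" for d
  proof -
    have "Cp d = (\<Sum>e\<in>I - {d}. A e)" unfolding Cp_def by (rule sum.cong) (auto simp: AB)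
    then show ?thesis unfolding c0_def using I d by (simp add: sum.remove[of I d])
  qed
  have st: "f d s - A d + c0 \<in> {0, 1}" if "d \<in> I" "isCont (f d) s" for d s
    using strip(1)[OF that] Cp[OF that(1)] by (simp add: algebra_simps)
  have c01: "c0 \<in> {0, 1}"
  proof -
    obtain d where d: "d \<in> I" using I n2 by fastforce
    show ?thesis using st[OF d, of S] fA[OF d, of S] by simp
  qed
  \<comment> \<open>\<open>c0\<close> is the sum of the end values. A profile can leave its end
    value only towards the other field value: upwards if \<open>c0 = 0\<close>, downwards if
    \<open>c0 = 1\<close>.\<close>
  define \<epsilon> where "\<epsilon> = 1 - 2 * c0"
  have vals: "f d s = A d \<or> f d s = A d + \<epsilon>" if "d \<in> I" "isCont (f d) s" for d s
    using st[OF that] c01 by (auto simp: \<epsilon>_def)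
  have \<epsilon>: "\<epsilon> = 1 \<or> \<epsilon> = - 1" using c01 by (auto simp: \<epsilon>_def)
  have bump: "\<exists>s. isCont (f d) s \<and> f d s = A d + \<epsilon>" if d: "d \<in> I" for d
    using two_vals[OF d] vals[OF d] by metis
  have "\<exists>d e. d \<in> I \<and> e \<in> I \<and> d \<noteq> e"
    using n2 unfolding I_def by (intro exI[of _ 1] exI[of _ 2]) auto
  then obtain d e where de: "d \<in> I" "e \<in> I" "d \<noteq> e" by blast
  obtain s where s: "isCont (f d) s" "f d s = A d + \<epsilon>" using bump[OF de(1)] by blast
  obtain r where r: "isCont (f e) r" "f e r = A e + \<epsilon>" using bump[OF de(2)] by blast
  obtain \<delta>1 where \<delta>1: "\<delta>1 > 0" "\<And>y. dist y s < \<delta>1 \<Longrightarrow> dist (f d y) (f d s) < 1"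
    using s(1) unfolding continuous_at_eps_delta by (metis dist_real_def zero_less_one)
  obtain \<delta>2 where \<delta>2: "\<delta>2 > 0" "\<And>y. dist y r < \<delta>2 \<Longrightarrow> dist (f e y) (f e r) < 1"
    using r(1) unfolding continuous_at_eps_delta by (metis dist_real_def zero_less_one)
  \<comment> \<open>A neighbourhood of the crossing of the two characteristics through bump points.
    Staying within distance 1 of the bump value excludes the end value, so both bumps are present on
    \<open>U\<close>.\<close>
  define U where "U = {p :: real \<times> real. dist (fst p - a d * snd p) s < \<delta>1} \<inter> {p. dist (fst p - a e * snd p) r < \<delta>2}"
  have "open U"
    unfolding U_def by (intro open_Int open_Collect_less continuous_intros)
  moreover have "U \<noteq> {}"
  proof -
    have ne: "a d \<noteq> a e" using inj de by (auto dest: inj_onD)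
    define t where "t = (s - r) / (a e - a d)"
    define x where "x = s + a d * t"
    have "(a e - a d) * t = s - r" using ne by (simp add: t_def)
    then have "x - a d * t = s" "x - a e * t = r" by (simp_all add: x_def algebra_simps)
    then have "(x, t) \<in> U" using \<delta>1(1) \<delta>2(1) by (simp add: U_def)
    then show ?thesis by blast
  qed
  moreover have "AE p in lebesgue. \<forall>k\<in>I. isCont (f k) (fst p - a k * snd p)"
    unfolding AE_lebesgue_iff
  proof (rule AE_finite_allI[OF I(1)])
    fix k assume k: "k \<in> I"
    have "AE y in lborel. y \<notin> disc k"
      by (intro AE_not_in finite_imp_null_set_lborel disc k)
    then have "AE y in lborel. isCont (f k) y" by (rule eventually_mono) (simp add: disc_def)
    then show "AE p in lborel. isCont (f k) (fst p - a k * snd p)" by (rule AE_plane_characteristic)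
  qed
  ultimately obtain p where p: "p \<in> U" "\<forall>k\<in>I. isCont (f k) (fst p - a k * snd p)"
    using AE_open_ex by blast
  \<comment> \<open>Bumps counted with their common sign: every \<open>b k\<close> is 0 or 1 and two
    of them are 1, so the field differs from \<open>c0\<close> by at least 2.\<close>
  define b where "b k = (f k (fst p - a k * snd p) - A k) * \<epsilon>" for k
  have \<epsilon>2: "\<epsilon> * \<epsilon> = 1" using \<epsilon> by auto
  have b01: "b k = 0 \<or> b k = 1" if "k \<in> I" for k
    using vals[OF that, of "fst p - a k * snd p"] p(2) that \<epsilon>2 by (auto simp: b_def)
  have "b d = 1"
  proof -
    have "dist (f d (fst p - a d * snd p)) (f d s) < 1" using p(1) by (intro \<delta>1(2)) (simp add: U_def)
    then have "f d (fst p - a d * snd p) \<noteq> A d" using s(2) \<epsilon> by (auto simp: dist_real_def)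
    then show ?thesis using vals[OF de(1), of "fst p - a d * snd p"] p(2) de(1) \<epsilon>2 by (auto simp: b_def)
  qed
  moreover have "b e = 1"
  proof -
    have "dist (f e (fst p - a e * snd p)) (f e r) < 1" using p(1) by (intro \<delta>2(2)) (simp add: U_def)
    then have "f e (fst p - a e * snd p) \<noteq> A e" using r(2) \<epsilon> by (auto simp: dist_real_def)
    then show ?thesis using vals[OF de(2), of "fst p - a e * snd p"] p(2) de(2) \<epsilon>2 by (auto simp: b_def)
  qed
  moreover have "(\<Sum>k\<in>{d, e}. b k) \<le> (\<Sum>k\<in>I. b k)"
    using I(1) de b01 by (intro sum_mono2) force+
  ultimately have "(\<Sum>k\<in>I. b k) \<ge> 2" using de(3) by simp
  moreover have "(\<Sum>k\<in>I. b k) = ((\<Sum>k\<in>I. f k (fst p - a k * snd p)) - c0) * \<epsilon>"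
    unfolding b_def c0_def sum_subtractf[symmetric] sum_distrib_right ..
  moreover have "(\<Sum>k\<in>I. f k (fst p - a k * snd p)) \<in> {0, 1}" using two[OF p(2)] .
  ultimately show False using c01 \<epsilon> by auto
qed

text \<open>The floor rigidity conjecture enters only as a premise of the sawtooth form; the
  dichotomy between integer and non-integer profiles and the resonance hold unconditionally.\<close>

theorem theorem9:
  shows
    "(\<forall>a f. \<not> wave_solution 2 a f)
     \<and>
     (\<forall>a::nat \<Rightarrow> real. a 1 < a 2 \<and> a 2 < a 3 \<longrightarrow>
        (\<exists>l1 l3. 0 < l1 \<and> 0 < l3 \<and> a 2 = (l1 * a 1 + l3 * a 3) / (l1 + l3)))
     \<and>
     (\<forall>(a::nat \<Rightarrow> real) l1 l3 r1 r3.
        a 1 < a 3 \<and> 0 < l1 \<and> 0 < l3 \<and> a 2 = (l1 * a 1 + l3 * a 3) / (l1 + l3) \<longrightarrow>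
          a 1 < a 2 \<and> a 2 < a 3 \<and>
          wave_solution 3 a (sawtooth_profiles l1 l3 r1 r3) \<and>
          bounded_profiles 3 (sawtooth_profiles l1 l3 r1 r3) \<and>
          superposition 3 a (sawtooth_profiles l1 l3 r1 r3)
            = sawtooth_field l1 l3 r1 r3 (a 1) (a 3) \<and>
          (\<forall>x t. sawtooth_field l1 l3 r1 r3 (a 1) (a 3) x t \<in> {0, 1}))
     \<and>
     (\<forall>(a::nat \<Rightarrow> real) x0 t0 G.
        a 1 < a 2 \<and> a 2 < a 3 \<and>
        (G = (\<lambda>x t. step_field a (x - x0) (t - t0)) \<or>
         G = (\<lambda>x t. 1 - step_field a (x - x0) (t - t0))) \<longrightarrow>
          (\<exists>f. wave_solution 3 a f \<and> bounded_profiles 3 f \<and>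
               (\<forall>d\<in>{1..3}. step_profile (f d) \<and> integer_valued (f d)) \<and>
               superposition 3 a f = G) \<and>
          (\<forall>x t. G x t \<in> {0, 1}) \<and>
          fan_field 3 G)
     \<and>
     (\<forall>a b c. (\<exists>y z. AE p in lebesgue.
           heaviside (fst p - a) + heaviside (snd p - b) - heaviside (fst p + snd p - c) \<in> {y, z})
         \<longrightarrow> c = a + b)
     \<and>
     (\<forall>a c. wave_solution 3 a (front_profiles c) \<longrightarrow>
        min (a 1) (a 3) < a 2 \<and> a 2 < max (a 1) (a 3) \<and>
        (\<exists>x0 t0. \<forall>d\<in>{1..3}. x0 - a d * t0 = c d))
     \<and>
     (\<forall>a f. wave_solution 3 a f \<longrightarrow>
        (\<forall>d\<in>{1..3}. integer_valued (f d)) \<or>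
        (\<forall>d\<in>{1..3}. \<not> integer_valued (f d)) \<and>
        (\<exists>i j m k1 k2 k3.
           {i, j, m} = {1, 2, 3} \<and> 0 < k1 * k2 \<and>
           linear_phase (f i) k1 \<and> linear_phase (f j) k2 \<and> linear_phase (f m) (- k3) \<and>
           k1 + k2 = k3 \<and> k1 * a i + k2 * a j = k3 * a m \<and>
           (floor_rigidity \<and> bounded_profiles 3 f \<longrightarrow>
              sawtooth_form a i j m (superposition 3 a f))))
     \<and>
     (\<forall>n a. odd n \<and> strict_mono_on {1..n} a \<longrightarrow>
        (\<exists>f. wave_solution n a f \<and> bounded_profiles n f \<and>
             (\<forall>d\<in>{1..n}. step_profile (f d)) \<and>
             superposition n a f = alternating_field n a) \<and>
        fan_field n (alternating_field n a))
     \<and>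
     (\<forall>n a f. even n \<longrightarrow>
        \<not> (wave_solution n a f \<and> bounded_profiles n f \<and>
           (\<forall>d\<in>{1..n}. finitely_many_fronts (f d))))
     \<and>
     (\<forall>a \<mu> f. single_resonance a \<mu> \<and> wave_solution 4 a f \<and> bounded_profiles 4 f \<longrightarrow>
        (\<forall>d\<in>{1..4}. integer_valued (f d)))"
proof (intro conjI)
  show "\<forall>a f. \<not> wave_solution 2 a f" using no_two_wave_solution by blast
next
  show "\<forall>a::nat \<Rightarrow> real. a 1 < a 2 \<and> a 2 < a 3 \<longrightarrow>
      (\<exists>l1 l3. 0 < l1 \<and> 0 < l3 \<and> a 2 = (l1 * a 1 + l3 * a 3) / (l1 + l3))"
  proof (intro allI impI, elim conjE)
    fix a :: "nat \<Rightarrow> real" assume a: "a 1 < a 2" "a 2 < a 3"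
    \<comment> \<open>Lever rule: \<open>a 2\<close> is the mean of \<open>a 1\<close> and
      \<open>a 3\<close> weighted by the opposite gaps.\<close>
    have "a 2 = ((a 3 - a 2) * a 1 + (a 2 - a 1) * a 3) / ((a 3 - a 2) + (a 2 - a 1))"
      using a by (simp add: eq_divide_eq algebra_simps)
    then show "\<exists>l1 l3. 0 < l1 \<and> 0 < l3 \<and> a 2 = (l1 * a 1 + l3 * a 3) / (l1 + l3)"
      using a by (intro exI[of _ "a 3 - a 2"] exI[of _ "a 2 - a 1"]) simp
  qed
next
  show "\<forall>(a::nat \<Rightarrow> real) l1 l3 r1 r3.
        a 1 < a 3 \<and> 0 < l1 \<and> 0 < l3 \<and> a 2 = (l1 * a 1 + l3 * a 3) / (l1 + l3) \<longrightarrow>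
          a 1 < a 2 \<and> a 2 < a 3 \<and>
          wave_solution 3 a (sawtooth_profiles l1 l3 r1 r3) \<and>
          bounded_profiles 3 (sawtooth_profiles l1 l3 r1 r3) \<and>
          superposition 3 a (sawtooth_profiles l1 l3 r1 r3)
            = sawtooth_field l1 l3 r1 r3 (a 1) (a 3) \<and>
          (\<forall>x t. sawtooth_field l1 l3 r1 r3 (a 1) (a 3) x t \<in> {0, 1})"
  proof (intro allI impI, elim conjE)
    fix a :: "nat \<Rightarrow> real" and l1 l3 r1 r3
    assume l: "a 1 < a 3" "0 < l1" "0 < l3" "a 2 = (l1 * a 1 + l3 * a 3) / (l1 + l3)"
    show "a 1 < a 2 \<and> a 2 < a 3 \<and>
        wave_solution 3 a (sawtooth_profiles l1 l3 r1 r3) \<and>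
        bounded_profiles 3 (sawtooth_profiles l1 l3 r1 r3) \<and>
        superposition 3 a (sawtooth_profiles l1 l3 r1 r3)
          = sawtooth_field l1 l3 r1 r3 (a 1) (a 3) \<and>
        (\<forall>x t. sawtooth_field l1 l3 r1 r3 (a 1) (a 3) x t \<in> {0, 1})"
      by (intro conjI allI weighted_mean_between[OF l] sawtooth_solution[OF l] sawtooth_field_two_valued)
  qed
next
  show "\<forall>(a::nat \<Rightarrow> real) x0 t0 G.
        a 1 < a 2 \<and> a 2 < a 3 \<and>
        (G = (\<lambda>x t. step_field a (x - x0) (t - t0)) \<or>
         G = (\<lambda>x t. 1 - step_field a (x - x0) (t - t0))) \<longrightarrow>
          (\<exists>f. wave_solution 3 a f \<and> bounded_profiles 3 f \<and>
               (\<forall>d\<in>{1..3}. step_profile (f d) \<and> integer_valued (f d)) \<and>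
               superposition 3 a f = G) \<and>
          (\<forall>x t. G x t \<in> {0, 1}) \<and>
          fan_field 3 G"
    by (intro allI impI, elim conjE, intro conjI) (rule step_solution; assumption)+
next
  show "\<forall>a b c. (\<exists>y z. AE p in lebesgue.
           heaviside (fst p - a) + heaviside (snd p - b) - heaviside (fst p + snd p - c) \<in> {y, z})
         \<longrightarrow> c = a + b"
    by (intro allI impI, elim exE) (rule plane_fronts_concurrent)
next
  show "\<forall>a c. wave_solution 3 a (front_profiles c) \<longrightarrow>
        min (a 1) (a 3) < a 2 \<and> a 2 < max (a 1) (a 3) \<and>
        (\<exists>x0 t0. \<forall>d\<in>{1..3}. x0 - a d * t0 = c d)"
    by (intro allI impI conjI) (erule front_solution_fan)+
next
  show "\<forall>a f. wave_solution 3 a f \<longrightarrow>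
        (\<forall>d\<in>{1..3}. integer_valued (f d)) \<or>
        (\<forall>d\<in>{1..3}. \<not> integer_valued (f d)) \<and>
        (\<exists>i j m k1 k2 k3.
           {i, j, m} = {1, 2, 3} \<and> 0 < k1 * k2 \<and>
           linear_phase (f i) k1 \<and> linear_phase (f j) k2 \<and> linear_phase (f m) (- k3) \<and>
           k1 + k2 = k3 \<and> k1 * a i + k2 * a j = k3 * a m \<and>
           (floor_rigidity \<and> bounded_profiles 3 f \<longrightarrow>
              sawtooth_form a i j m (superposition 3 a f)))"
    by (intro allI impI) (rule three_waves_classification)
next
  show "\<forall>n a. odd n \<and> strict_mono_on {1..n} a \<longrightarrow>
        (\<exists>f. wave_solution n a f \<and> bounded_profiles n f \<and>
             (\<forall>d\<in>{1..n}. step_profile (f d)) \<and>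
             superposition n a f = alternating_field n a) \<and>
        fan_field n (alternating_field n a)"
  proof (intro allI impI conjI; elim conjE)
    fix n and a :: "nat \<Rightarrow> real" assume na: "odd n" "strict_mono_on {1..n} a"
    show "\<exists>f. wave_solution n a f \<and> bounded_profiles n f \<and> (\<forall>d\<in>{1..n}. step_profile (f d)) \<and>
        superposition n a f = alternating_field n a"
      by (rule alternating_solution[OF na])
    show "fan_field n (alternating_field n a)"
      using alternating_fan_field(1)[OF na, of 0 0] by (simp only: diff_zero)
  qed
next
  show "\<forall>n a f. even n \<longrightarrow>
        \<not> (wave_solution n a f \<and> bounded_profiles n f \<and>
           (\<forall>d\<in>{1..n}. finitely_many_fronts (f d)))"
    by (intro allI impI notI, elim conjE) (rule no_even_front_solution)
next
  show "\<forall>a \<mu> f. single_resonance a \<mu> \<and> wave_solution 4 a f \<and> bounded_profiles 4 f \<longrightarrow>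
        (\<forall>d\<in>{1..4}. integer_valued (f d))"
    by (intro allI impI, elim conjE) (rule four_waves_integer_valued)
qed

end
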